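(* For all integers $k\geq 1$ and $n\geq 0$, $$\mathrm{spt}_{C5}\left(5^{2k-1}n+\frac{7\cdot 5^{2k-1}+1}{12}\right)\equiv 0 \pmod{5^{2k-1}},$$ $$\mathrm{spt}_{C5}\left(5^{2k}n+\frac{11\cdot 5^{2k}+1}{12}\right)\equiv 0 \pmod{5^{2k}}.$$
   Context: For $|q|<1$ let $(a;q)_\infty=\prod_{n=0}^\infty(1-aq^n)$ and $(a;q)_n=\frac{(a;q)_\infty}{(aq^n;q)_\infty}$. The integers $\mathrm{spt}_{C5}(n)$ are defined by $$\sum_{n=1}^\infty \mathrm{spt}_{C5}(n)q^n=\sum_{n=1}^\infty \frac{q^{(n^2+n)/2}}{(1-q^n)^2(q^{n+1};q)_n(q^{2n+2};q^2)_\infty}.$$ *)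

theory Defs
  imports "HOL-Analysis.Analysis" "HOL-Number_Theory.Cong"
begin

text \<open>
  The base \<open>q\<close> ranges over an arbitrary topological ring, so that the definitions cover both a
  complex number of modulus less than 1 and the indeterminate of a ring of formal power series.
  On \<^typ>\<open>'a fps\<close>, limits (hence infinite sums and products) are those of the library's
  \<open>X\<close>-adic metric.
\<close>

definition qpoch_inf :: "'a::{t2_space,comm_ring_1} \<Rightarrow> 'a \<Rightarrow> 'a" where
  "qpoch_inf a q = (\<Prod>n. 1 - a * q ^ n)"

definition qpoch :: "'a::{t2_space,comm_ring_1,inverse} \<Rightarrow> 'a \<Rightarrow> nat \<Rightarrow> 'a" where
  "qpoch a q n = qpoch_inf a q / qpoch_inf (a * q ^ n) q"

definition spt_C5_term :: "nat \<Rightarrow> 'a::{t2_space,comm_ring_1,inverse} \<Rightarrow> 'a" where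
  "spt_C5_term n q =
     q ^ ((n ^ 2 + n) div 2) /
       ((1 - q ^ n) ^ 2 * qpoch (q ^ (n + 1)) q n * qpoch_inf (q ^ (2 * n + 2)) (q ^ 2))"

definition spt_C5_series :: "'a::{t2_space,comm_ring_1,inverse} \<Rightarrow> 'a" where
  "spt_C5_series q = (\<Sum>n. spt_C5_term (Suc n) q)"

text \<open>
  The quotients are taken over a field; \<open>spt_C5_sums\<close> below shows that the coefficients are
  integers, so that exactly one \<open>c\<close> satisfies the description.
\<close>

definition spt_C5 :: "nat \<Rightarrow> int" where
  "spt_C5 n = (THE c. of_int c = fps_nth (spt_C5_series (fps_X :: complex fps)) n)"


subsection \<open>Convergence and integrality\<close>

definition int_unit_fps :: "complex fps \<Rightarrow> bool" where
  "int_unit_fps f \<longleftrightarrow> fps_nth f 0 = 1 \<and> (\<forall>n. fps_nth f n \<in> \<int>)"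

lemma int_unit_fps_mult:
  "int_unit_fps f \<Longrightarrow> int_unit_fps g \<Longrightarrow> int_unit_fps (f * g)"
  by (auto simp: int_unit_fps_def fps_mult_nth intro!: Ints_sum Ints_mult)

lemma int_unit_fps_power: "int_unit_fps f \<Longrightarrow> int_unit_fps (f ^ n)"
proof (induction n)
  case 0
  then show ?case by (auto simp: int_unit_fps_def)
next
  case (Suc n)
  then show ?case by (auto intro: int_unit_fps_mult)
qed

lemma int_unit_fps_inverse:
  assumes f: "int_unit_fps f"
  shows "int_unit_fps (inverse f)"
proof -
  have f0: "fps_nth f 0 = 1" and fI: "\<And>n. fps_nth f n \<in> \<int>"
    using f by (auto simp: int_unit_fps_def)
  have g0: "fps_nth (inverse f) 0 = 1"
    by (simp add: f0)
  have "fps_nth (inverse f) n \<in> \<int>" for n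
  proof (induction n rule: less_induct)
    case (less n)
    show ?case
    proof (cases "n = 0")
      case True
      then show ?thesis by (simp add: f0)
    next
      case False
      have "f * inverse f = 1"
        by (rule inverse_mult_eq_1') (simp add: f0)
      then have "fps_nth (f * inverse f) n = 0"
        using False by simp
      then have "fps_nth f 0 * fps_nth (inverse f) n +
          (\<Sum>i=Suc 0..n. fps_nth f i * fps_nth (inverse f) (n - i)) = 0"
        unfolding fps_mult_nth by (subst (asm) sum.atLeast_Suc_atMost) auto
      then have "fps_nth (inverse f) n =
          - (\<Sum>i=Suc 0..n. fps_nth f i * fps_nth (inverse f) (n - i))"
        unfolding f0 mult_1_left by (rule iffD2[OF eq_neg_iff_add_eq_0])
      also have "\<dots> \<in> \<int>"
        by (intro Ints_minus Ints_sum Ints_mult fI less.IH) auto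
      finally show ?thesis .
    qed
  qed
  then show ?thesis
    using g0 by (auto simp: int_unit_fps_def)
qed

lemma int_unit_fps_divide:
  assumes "int_unit_fps f" "int_unit_fps g"
  shows "int_unit_fps (f / g)"
proof -
  have "f / g = f * inverse g"
    using assms by (intro fps_divide_unit) (auto simp: int_unit_fps_def)
  then show ?thesis
    using assms by (simp add: int_unit_fps_mult int_unit_fps_inverse)
qed

lemma int_unit_fps_one_minus_X_power:
  "m \<ge> 1 \<Longrightarrow> int_unit_fps (1 - fps_X ^ m)"
  by (auto simp: int_unit_fps_def)

lemma fps_limitI:
  fixes f :: "nat \<Rightarrow> 'a::{comm_ring_1} fps"
  assumes "\<And>i n. n \<ge> i \<Longrightarrow> fps_nth (f (Suc n)) i = fps_nth (f n) i"
  shows "f \<longlonglongrightarrow> Abs_fps (\<lambda>i. fps_nth (f i) i)"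
proof (rule tendsto_fpsI)
  fix i
  have "fps_nth (f n) i = fps_nth (f i) i" if "n \<ge> i" for n
    using that by (induction n rule: dec_induct) (auto simp: assms)
  then show "\<forall>\<^sub>F n in sequentially.
      fps_nth (f n) i = fps_nth (Abs_fps (\<lambda>i. fps_nth (f i) i)) i"
    unfolding fps_nth_Abs_fps by (rule eventually_sequentiallyI)
qed

lemma qpoch_inf_fps:
  assumes m: "m \<ge> 1" and c: "c \<ge> 1"
  defines "F \<equiv> \<lambda>n. 1 - fps_X ^ m * (fps_X ^ c) ^ n :: complex fps"
  shows "convergent_prod F" "int_unit_fps (qpoch_inf (fps_X ^ m) (fps_X ^ c))"
proof -
  define P where "P = (\<lambda>N. \<Prod>n<N. F n)"
  have F: "F n = 1 - fps_X ^ (m + c * n)" for n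
    by (simp add: F_def power_add power_mult)
  have P: "int_unit_fps (P N)" for N
  proof (induction N)
    case 0
    then show ?case by (auto simp: P_def int_unit_fps_def)
  next
    case (Suc N)
    moreover have "int_unit_fps (F N)"
      unfolding F using m by (intro int_unit_fps_one_minus_X_power) auto
    ultimately show ?case
      by (auto simp: P_def intro: int_unit_fps_mult)
  qed
  have stable: "fps_nth (P (Suc n)) i = fps_nth (P n) i" if "n \<ge> i" for n i
  proof -
    have "c * n \<ge> n"
      using c by simp
    then have "i < m + c * n"
      using that m by linarith
    moreover have "P (Suc n) = P n - P n * fps_X ^ (m + c * n)"
      by (simp add: P_def F algebra_simps)
    ultimately show ?thesis
      by (simp add: fps_X_power_mult_right_nth)
  qed
  define g where "g = Abs_fps (\<lambda>i. fps_nth (P i) i)"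
  have g: "int_unit_fps g"
    using P by (auto simp: g_def int_unit_fps_def)
  then have "g \<noteq> 0"
    by (auto simp: int_unit_fps_def)
  moreover have "P \<longlonglongrightarrow> g"
    unfolding g_def by (rule fps_limitI) (rule stable)
  then have "(\<lambda>n. P (Suc n)) \<longlonglongrightarrow> g"
    by (rule LIMSEQ_Suc)
  then have "(\<lambda>n. \<Prod>i\<le>n. F (i + 0)) \<longlonglongrightarrow> g"
    by (simp add: P_def lessThan_Suc_atMost)
  ultimately have raw: "raw_has_prod F 0 g"
    by (simp add: raw_has_prod_def)
  then show "convergent_prod F"
    by (auto simp: convergent_prod_def)
  have "F has_prod g"
    using raw by (simp add: has_prod_def)
  then have "g = prodinf F"
    by (rule has_prod_unique)
  then show "int_unit_fps (qpoch_inf (fps_X ^ m) (fps_X ^ c))"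
    using g by (simp add: qpoch_inf_def F_def)
qed

lemma spt_C5_term_fps:
  assumes n: "n \<ge> 1"
  obtains U where "int_unit_fps U"
    "spt_C5_term n (fps_X :: complex fps) = fps_X ^ ((n ^ 2 + n) div 2) * U"
proof -
  define D where "D = (1 - fps_X ^ n) ^ 2 * qpoch (fps_X ^ (n + 1)) fps_X n *
    qpoch_inf (fps_X ^ (2 * n + 2)) ((fps_X :: complex fps) ^ 2)"
  have inf1: "int_unit_fps (qpoch_inf (fps_X ^ m) fps_X)" if "m \<ge> 1" for m
    using qpoch_inf_fps(2)[of m 1] that by simp
  have "int_unit_fps (qpoch (fps_X ^ (n + 1)) fps_X n)"
    unfolding qpoch_def power_add[symmetric] by (intro int_unit_fps_divide inf1) auto
  then have D: "int_unit_fps D"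
    unfolding D_def using n
    by (intro int_unit_fps_mult int_unit_fps_power int_unit_fps_one_minus_X_power qpoch_inf_fps(2)) auto
  have "spt_C5_term n fps_X = fps_X ^ ((n ^ 2 + n) div 2) / D"
    by (simp add: spt_C5_term_def D_def)
  also have "\<dots> = fps_X ^ ((n ^ 2 + n) div 2) * inverse D"
    using D by (intro fps_divide_unit) (auto simp: int_unit_fps_def)
  finally show ?thesis
    using int_unit_fps_inverse[OF D] that by blast
qed

lemma spt_C5_term_nth:
  assumes "n \<ge> 1"
  shows "fps_nth (spt_C5_term n (fps_X :: complex fps)) i \<in> \<int>"
    and "i < n \<Longrightarrow> fps_nth (spt_C5_term n (fps_X :: complex fps)) i = 0"
proof -
  obtain U where U: "int_unit_fps U"
    "spt_C5_term n (fps_X :: complex fps) = fps_X ^ ((n ^ 2 + n) div 2) * U"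
    using spt_C5_term_fps[OF assms] .
  show "fps_nth (spt_C5_term n (fps_X :: complex fps)) i \<in> \<int>"
    using U by (auto simp: fps_X_power_mult_nth int_unit_fps_def)
  have "n * 1 \<le> n * n"
    using assms by (intro mult_left_mono) auto
  then have "n \<le> (n ^ 2 + n) div 2"
    unfolding power2_eq_square by linarith
  then show "fps_nth (spt_C5_term n (fps_X :: complex fps)) i = 0" if "i < n"
    using U that by (auto simp: fps_X_power_mult_nth)
qed

lemma spt_C5_series_fps:
  shows "summable (\<lambda>n. spt_C5_term (Suc n) (fps_X :: complex fps))"
    and "fps_nth (spt_C5_series (fps_X :: complex fps)) i \<in> \<int>"
    and "fps_nth (spt_C5_series (fps_X :: complex fps)) 0 = 0"
proof -
  define S where "S = (\<lambda>N. \<Sum>n<N. spt_C5_term (Suc n) (fps_X :: complex fps))"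
  have "S \<longlonglongrightarrow> Abs_fps (\<lambda>i. fps_nth (S i) i)"
    by (rule fps_limitI) (auto simp: S_def spt_C5_term_nth)
  then have sums: "(\<lambda>n. spt_C5_term (Suc n) (fps_X :: complex fps)) sums
      Abs_fps (\<lambda>i. fps_nth (S i) i)"
    by (simp add: sums_def S_def)
  then show "summable (\<lambda>n. spt_C5_term (Suc n) (fps_X :: complex fps))"
    by (rule sums_summable)
  have eq: "spt_C5_series fps_X = Abs_fps (\<lambda>i. fps_nth (S i) i)"
    unfolding spt_C5_series_def by (rule sums_unique[OF sums, symmetric])
  show "fps_nth (spt_C5_series (fps_X :: complex fps)) i \<in> \<int>"
    by (auto simp: eq S_def fps_sum_nth intro!: Ints_sum spt_C5_term_nth(1))
  show "fps_nth (spt_C5_series (fps_X :: complex fps)) 0 = 0"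
    by (simp add: eq S_def)
qed

lemma of_int_spt_C5:
  "of_int (spt_C5 n) = fps_nth (spt_C5_series (fps_X :: complex fps)) n"
proof -
  obtain c where c: "fps_nth (spt_C5_series (fps_X :: complex fps)) n = of_int c"
    using spt_C5_series_fps(2) by (auto elim: Ints_cases)
  show ?thesis
    unfolding spt_C5_def by (rule theI[of _ c]) (auto simp: c)
qed

theorem spt_C5_sums:
  "(\<lambda>n. of_int (spt_C5 (Suc n)) * fps_X ^ Suc n) sums spt_C5_series (fps_X :: complex fps)"
proof -
  define S where "S = (\<lambda>N. \<Sum>n<N. of_int (spt_C5 (Suc n)) * (fps_X :: complex fps) ^ Suc n)"
  have of_int_fps_nth: "fps_nth (of_int c * fps_X ^ m) i = (if i = m then of_int c else (0::complex))"
    for c i m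
  proof -
    have "of_int c * fps_X ^ m = fps_const (of_int c :: complex) * fps_X ^ m"
      by (simp only: fps_of_int)
    then show ?thesis
      by (simp only: fps_mult_left_const_nth fps_X_power_nth) simp
  qed
  have S: "fps_nth (S N) i = (if 1 \<le> i \<and> i \<le> N then of_int (spt_C5 i) else 0)" for N i
  proof -
    have "fps_nth (S N) i =
        (\<Sum>n<N. if n = i - 1 then (if i = 0 then 0 else of_int (spt_C5 i)) else 0)"
      unfolding S_def fps_sum_nth
      by (intro sum.cong refl) (auto simp: of_int_fps_nth)
    then show ?thesis by auto
  qed
  have "S \<longlonglongrightarrow> spt_C5_series fps_X"
  proof (rule tendsto_fpsI)
    fix i
    have "fps_nth (S N) i = fps_nth (spt_C5_series fps_X) i" if "N \<ge> i" for N
      using that by (cases "i = 0") (auto simp: S of_int_spt_C5 spt_C5_series_fps(3))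
    then show "\<forall>\<^sub>F N in sequentially. fps_nth (S N) i = fps_nth (spt_C5_series fps_X) i"
      by (rule eventually_sequentiallyI)
  qed
  then show ?thesis
    by (simp add: sums_def S_def)
qed


subsection \<open>The divisions by 12 in the arguments are exact\<close>

lemma twelve_dvd_odd:
  assumes "k \<ge> 1"
  shows "(12::nat) dvd 7 * 5 ^ (2 * k - 1) + 1"
  using assms
proof (induction k rule: dec_induct)
  case base
  then show ?case by simp
next
  case (step k)
  have *: "12 dvd 7 * (5 * (5 * x)) + 1" if "12 dvd 7 * x + 1" for x :: nat
  proof -
    have "7 * (5 * (5 * x)) + 1 = (7 * x + 1) + 12 * (14 * x)"
      by linarith
    with that show ?thesis
      by (metis dvd_add dvd_triv_left)
  qed
  have "2 * Suc k - 1 = Suc (Suc (2 * k - 1))"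
    using step.hyps by simp
  then show ?case
    by (simp only: power_Suc *[OF step.IH])
qed

lemma twelve_dvd_even: "(12::nat) dvd 11 * 5 ^ (2 * k) + 1"
proof (induction k)
  case 0
  then show ?case by simp
next
  case (Suc k)
  have *: "12 dvd 11 * (5 * (5 * x)) + 1" if "12 dvd 11 * x + 1" for x :: nat
  proof -
    have "11 * (5 * (5 * x)) + 1 = (11 * x + 1) + 12 * (22 * x)"
      by linarith
    with that show ?thesis
      by (metis dvd_add dvd_triv_left)
  qed
  have "2 * Suc k = Suc (Suc (2 * k))"
    by simp
  then show ?case
    by (simp only: power_Suc *[OF Suc.IH])
qed

end

theory Submission
  imports Defs "HOL-Computational_Algebra.Formal_Laurent_Series"
begin

text \<open>
  Let \<open>E = \<phi>(-q)^4\<close> be the generating function of signed representations by four squares and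
  \<open>K = E / (q^2; q^2)\<close>. A telescoping finite form shows that the generating function of \<open>spt_C5\<close>,
  multiplied by \<open>(q^2; q^2)\<close>, is the sum of \<open>q^d / (1 - q^d)^2\<close> over odd \<open>d\<close>. Comparing divisor sums with
  the four-square theorem gives
  \<open>24 spt_C5(N) = c K(N) + (12 N - 1) r(N)\<close>, where \<open>c\<close> is 1 or -3 according to the parity of \<open>N\<close> and \<open>r(N)\<close> are the
  coefficients of \<open>1 / (q^2; q^2)\<close>. In both progressions \<open>12 N - 1\<close> is divisible by the power of 5 in
  question, which leaves the divisibility of \<open>K(N)\<close>.

  The series of the coefficients of \<open>K\<close> along the progressions arise by iterating
  \<open>U5\<close>, which sends the sum of \<open>a(n) q^n\<close> to that of \<open>a(5 n) q^n\<close>. Apart from a product they have the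
  form \<open>P(t) E(q) + Q(t) E(q^5)\<close> with integer polynomials \<open>P\<close> and \<open>Q\<close> in
  \<open>t = q^2 (q^10; q^10)^6 / (q^2; q^2)^6\<close>. The modular equation of degree 5 for \<open>t\<close> yields a linear
  recurrence for the action of \<open>U5\<close>, hence lower bounds for the powers of 5 dividing the
  coefficients of \<open>P\<close> and \<open>Q\<close>, and every step gains one factor 5.
\<close>

section \<open>Limits of formal power series and infinite products\<close>

text \<open>Facts about modular functions are replaced by identities of formal series. The
  parametrization is Ramanujan's: with the Rogers-Ramanujan continued fraction r(q) and k = r(q)
  r(q^2)^2 = q \<open>u1\<close> \<open>u2\<close> / (\<open>u3\<close> \<open>u4\<close>), one has
  \<open>ss\<close> = (1 - k) / (1 + k), \<open>ff\<close> = r(q^2)^5 and \<open>yy\<close> =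
  r(q^10). Since \<open>yy\<close> is q^2 times a series in q^5, its powers separate the residues of
  the exponents mod 5, and the identities needed become rational ones in \<open>ss\<close>, or in
  \<open>yy\<close> and \<open>V5 ss\<close> subject to a single relation. The series E alone is not
  stable: already U5 E = 6 E(q) - 5 E(q^5), which is why pairs P, Q have to be iterated. The two
  progressions are the classes 12 N = 1 mod 5^j for odd and for even j. Their members are 5^j m - c
  with c = (25^k - 1) / 12 for j = 2 k - 1 as well as for j = 2 k. From the lowest one upwards the
  base 5 digits of c are 2, 0, 2, 0, ..., so that steps with and without a shift by q^2
  alternate.\<close>

lemma tendsto_fps_mult:
  fixes f g :: "nat \<Rightarrow> complex fps"
  assumes "f \<longlonglongrightarrow> F" "g \<longlonglongrightarrow> G"
  shows "(\<lambda>n. f n * g n) \<longlonglongrightarrow> F * G"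
proof (rule tendsto_fpsI)
  fix i
  have "\<forall>\<^sub>F n in sequentially. (\<forall>j\<in>{..i}. fps_nth (f n) j = fps_nth F j) \<and>
      (\<forall>j\<in>{..i}. fps_nth (g n) j = fps_nth G j)"
    using assms by (intro eventually_conj eventually_ball_finite) (auto simp: tendsto_fps_iff)
  then show "\<forall>\<^sub>F n in sequentially. fps_nth (f n * g n) i = fps_nth (F * G) i"
    by eventually_elim (auto simp: fps_mult_nth)
qed

definition qfin :: "complex fps \<Rightarrow> complex fps \<Rightarrow> nat \<Rightarrow> complex fps" where
  "qfin a q n = (\<Prod>k<n. 1 - a * q ^ k)"

lemma qfin_0 [simp]: "qfin a q 0 = 1"
  by (simp add: qfin_def)

lemma qfin_Suc: "qfin a q (Suc n) = qfin a q n * (1 - a * q ^ n)"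
  by (simp add: qfin_def)

lemma qfin_add: "qfin a q (n + m) = qfin a q n * qfin (a * q ^ n) q m"
  by (induction m) (simp_all add: qfin_Suc power_add mult_ac)

lemma qfin_nth_0: "fps_nth a 0 = 0 \<Longrightarrow> fps_nth (qfin a q n) 0 = 1"
  by (induction n) (auto simp: qfin_Suc)

lemma fps_nth_mult_power_eq_0:
  fixes a q :: "complex fps"
  assumes "fps_nth a 0 = 0" "fps_nth q 0 = 0" "i \<le> n"
  shows "fps_nth (f * (a * q ^ n)) i = 0"
proof -
  have "a = fps_X * fps_shift 1 a" "q = fps_X * fps_shift 1 q"
    using assms by (simp_all add: fps_eq_iff fps_X_mult_nth)
  then have "fps_X dvd a" "fps_X dvd q"
    by (auto intro: dvdI)
  then have "fps_X ^ Suc n dvd f * (a * q ^ n)"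
    unfolding power_Suc by (intro dvd_mult mult_dvd_mono dvd_power_same)
  then obtain h where "f * (a * q ^ n) = fps_X ^ Suc n * h"
    by (elim dvdE)
  then show ?thesis
    using assms(3) by (simp add: fps_X_power_mult_nth del: power_Suc)
qed

lemma qfin_nth_stable:
  fixes a q :: "complex fps"
  assumes "fps_nth a 0 = 0" "fps_nth q 0 = 0" "i \<le> m" "m \<le> n"
  shows "fps_nth (qfin a q n) i = fps_nth (qfin a q m) i"
  using assms(4)
proof (induction n rule: dec_induct)
  case (step n)
  have "qfin a q (Suc n) = qfin a q n - qfin a q n * (a * q ^ n)"
    by (simp add: qfin_Suc algebra_simps)
  then show ?case
    using step assms fps_nth_mult_power_eq_0[of a q i n "qfin a q n"] by simp
qed auto

lemma qfin_tendsto: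
  fixes a q :: "complex fps"
  assumes a: "fps_nth a 0 = 0" and q: "fps_nth q 0 = 0"
  shows "qfin a q \<longlonglongrightarrow> qpoch_inf a q"
proof -
  define g where "g = Abs_fps (\<lambda>i. fps_nth (qfin a q i) i)"
  have g: "qfin a q \<longlonglongrightarrow> g"
    unfolding g_def by (rule fps_limitI) (rule qfin_nth_stable[OF a q], auto)
  have "fps_nth g 0 = 1"
    by (simp add: g_def)
  then have "g \<noteq> 0"
    by auto
  moreover have "(\<lambda>n. \<Prod>i\<le>n. 1 - a * q ^ (i + 0)) \<longlonglongrightarrow> g"
    using LIMSEQ_Suc[OF g] by (simp add: qfin_def lessThan_Suc_atMost)
  ultimately have "(\<lambda>n. 1 - a * q ^ n) has_prod g"
    by (simp add: has_prod_def raw_has_prod_def)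
  then have "qpoch_inf a q = g"
    unfolding qpoch_inf_def by (rule has_prod_unique[symmetric])
  with g show ?thesis by simp
qed

lemma qpoch_inf_nth:
  fixes a q :: "complex fps"
  assumes "fps_nth a 0 = 0" "fps_nth q 0 = 0" "i \<le> n"
  shows "fps_nth (qpoch_inf a q) i = fps_nth (qfin a q n) i"
proof -
  have "\<forall>\<^sub>F m in sequentially. fps_nth (qfin a q m) i = fps_nth (qpoch_inf a q) i"
    using qfin_tendsto[OF assms(1,2)] by (auto simp: tendsto_fps_iff)
  then obtain m0 where m0: "\<And>m. m \<ge> m0 \<Longrightarrow> fps_nth (qfin a q m) i = fps_nth (qpoch_inf a q) i"
    unfolding eventually_sequentially by blast
  define m where "m = max m0 n"
  then have "m \<ge> n" "fps_nth (qfin a q m) i = fps_nth (qpoch_inf a q) i"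
    using m0[of m] by auto
  then show ?thesis
    using qfin_nth_stable[OF assms, of m] by simp
qed

lemma qpoch_inf_nth_0 [simp]:
  fixes a q :: "complex fps"
  shows "fps_nth a 0 = 0 \<Longrightarrow> fps_nth q 0 = 0 \<Longrightarrow> fps_nth (qpoch_inf a q) 0 = 1"
  by (simp add: qpoch_inf_nth[of a q 0 0])

lemma qpoch_inf_nonzero:
  fixes a q :: "complex fps"
  shows "fps_nth a 0 = 0 \<Longrightarrow> fps_nth q 0 = 0 \<Longrightarrow> qpoch_inf a q \<noteq> 0"
  using qpoch_inf_nth_0 by fastforce

lemma prod_lessThan_add:
  fixes f :: "nat \<Rightarrow> 'a::comm_monoid_mult"
  shows "(\<Prod>k<n + m. f k) = (\<Prod>k<n. f k) * (\<Prod>j<m. f (n + j))"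
  by (induction m) (simp_all add: mult_ac)

lemma qpoch_inf_split:
  fixes a q :: "complex fps"
  assumes a: "fps_nth a 0 = 0" and q: "fps_nth q 0 = 0" and m: "m > 0"
  shows "qpoch_inf a q = (\<Prod>j<m. qpoch_inf (a * q ^ j) (q ^ m))"
proof -
  have fin: "qfin a q (n * m) = (\<Prod>j<m. qfin (a * q ^ j) (q ^ m) n)" for n
  proof (induction n)
    case (Suc n)
    have eq: "a * q ^ (n * m + j) = a * q ^ j * (q ^ m) ^ n" for j
      by (simp only: power_add power_mult [symmetric] mult.commute mult.left_commute mult.assoc)
    have "qfin a q (Suc n * m) = qfin a q (n * m) * (\<Prod>j<m. 1 - a * q ^ (n * m + j))"
      unfolding qfin_def by (simp only: mult_Suc add.commute[of m] prod_lessThan_add)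
    also have "\<dots> = (\<Prod>j<m. qfin (a * q ^ j) (q ^ m) (Suc n))"
      unfolding Suc.IH eq by (simp only: qfin_Suc prod.distrib)
    finally show ?case .
  qed simp
  have "(\<lambda>n. qfin a q (n * m)) \<longlonglongrightarrow> qpoch_inf a q"
    by (rule filterlim_compose[OF qfin_tendsto[OF a q] mult_nat_right_at_top[OF m]])
  moreover have "(\<lambda>n. \<Prod>j<k. qfin (a * q ^ j) (q ^ m) n) \<longlonglongrightarrow> (\<Prod>j<k. qpoch_inf (a * q ^ j) (q ^ m))" for k
  proof (induction k)
    case (Suc k)
    then show ?case
      using a q m by (simp, intro tendsto_fps_mult qfin_tendsto) auto
  qed simp
  ultimately show ?thesis
    unfolding fin using LIMSEQ_unique by blast
qed

lemma qpoch_inf_mult_minus: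
  fixes a q :: "complex fps"
  assumes a: "fps_nth a 0 = 0" and q: "fps_nth q 0 = 0"
  shows "qpoch_inf a q * qpoch_inf (- a) q = qpoch_inf (a\<^sup>2) (q\<^sup>2)"
proof -
  have "qfin a q n * qfin (- a) q n = qfin (a\<^sup>2) (q\<^sup>2) n" for n
    unfolding qfin_def prod.distrib[symmetric]
    by (intro prod.cong refl) (simp add: algebra_simps power2_eq_square power_mult_distrib)
  then have "(\<lambda>n. qfin (a\<^sup>2) (q\<^sup>2) n) \<longlonglongrightarrow> qpoch_inf a q * qpoch_inf (- a) q"
    using tendsto_fps_mult[OF qfin_tendsto[of a q] qfin_tendsto[of "-a" q]] a q by simp
  moreover have "(\<lambda>n. qfin (a\<^sup>2) (q\<^sup>2) n) \<longlonglongrightarrow> qpoch_inf (a\<^sup>2) (q\<^sup>2)"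
    using a q by (intro qfin_tendsto) auto
  ultimately show ?thesis
    by (rule LIMSEQ_unique)
qed

lemma qpoch_inf_shift:
  fixes a q :: "complex fps"
  assumes a: "fps_nth a 0 = 0" and q: "fps_nth q 0 = 0"
  shows "qpoch_inf a q = qfin a q n * qpoch_inf (a * q ^ n) q"
proof -
  have "(\<lambda>m. qfin a q (n + m)) \<longlonglongrightarrow> qfin a q n * qpoch_inf (a * q ^ n) q"
    unfolding qfin_add using a q by (intro tendsto_fps_mult tendsto_const qfin_tendsto) auto
  moreover have "(\<lambda>m. qfin a q (n + m)) \<longlonglongrightarrow> qpoch_inf a q"
    using LIMSEQ_ignore_initial_segment[OF qfin_tendsto[OF a q], of n] by (simp add: add.commute)
  ultimately show ?thesis
    using LIMSEQ_unique by blast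
qed


text \<open>The tail \<open>(q\<^sup>m\<^sup>+\<^sup>1; q)\<close>, extended by 0 to negative \<open>m\<close> so that the sums in the finite form of the triple
  product may run over any large symmetric interval.\<close>

definition qtail :: "complex fps \<Rightarrow> int \<Rightarrow> complex fps" where
  "qtail q m = (if m < 0 then 0 else qpoch_inf (q ^ Suc (nat m)) q)"

lemma qtail_neg [simp]: "m < 0 \<Longrightarrow> qtail q m = 0"
  by (simp add: qtail_def)

lemma qtail_Suc:
  fixes q :: "complex fps"
  assumes "fps_nth q 0 = 0"
  shows "qtail q (int m) = (1 - q ^ Suc m) * qtail q (int (Suc m))"
proof -
  have "qpoch_inf (q ^ Suc m) q = (1 - q ^ Suc m) * qpoch_inf (q ^ Suc (Suc m)) q"
    using qpoch_inf_shift[of "q ^ Suc m" q 1] assms by (simp add: qfin_def mult.commute)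
  then show ?thesis
    by (simp only: qtail_def nat_int) simp
qed

text \<open>One step from N to N + 1 in the finite triple product, term by term: u = N + 1 - n and v
  = N + s + 1 + n are the indices of the new tails, and the left side collects the products of old
  tails at n and at its two neighbours. For positive u and v both sides are polynomials in x =
  q^(u-1), y = q^(v-1) and q, times the product of the new tails; the cases where u or v is not
  positive rest on the extension of \<open>qtail\<close> by 0.\<close>

lemma qtail_rec:
  fixes q :: "complex fps"
  assumes q: "fps_nth q 0 = 0" and s: "u + v = int (Suc m)"
  shows "(1 + q ^ m) * (qtail q (u - 1) * qtail q (v - 1))
      + q ^ nat u * (qtail q u * qtail q (v - 2)) + q ^ nat v * (qtail q (u - 2) * qtail q v)
      = (1 - q ^ m) * (1 - q ^ Suc m) * (qtail q u * qtail q v)"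
proof -
  have one: "qtail q (v - 2) = (1 - q ^ m) * (1 - q ^ Suc m) * qtail q v" if "v = int (Suc m)" for v m
  proof (cases m)
    case (Suc k)
    have "qtail q (int k) = (1 - q ^ Suc k) * ((1 - q ^ Suc (Suc k)) * qtail q (int (Suc (Suc k))))"
      by (simp only: qtail_Suc[OF q, symmetric])
    then show ?thesis
      using that Suc by (simp add: mult.assoc)
  qed (use that in simp)
  consider "u < 0" | "v < 0" | "u = 0" | "v = 0" | u' v' where "u = int (Suc u')" "v = int (Suc v')"
  proof -
    assume *: "u < 0 \<Longrightarrow> thesis" "v < 0 \<Longrightarrow> thesis" "u = 0 \<Longrightarrow> thesis" "v = 0 \<Longrightarrow> thesis"
      "\<And>u' v'. u = int (Suc u') \<Longrightarrow> v = int (Suc v') \<Longrightarrow> thesis"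
    show thesis
      using *(1-4) *(5)[of "nat (u - 1)" "nat (v - 1)"] by linarith
  qed
  then show ?thesis
  proof cases
    case 3
    then show ?thesis using one[of v m] s by simp
  next
    case 4
    then show ?thesis using one[of u m] s by (simp add: mult_ac)
  next
    case 5
    have m: "m = Suc (u' + v')"
      using 5 s by simp
    have *: "qtail q (int (Suc k) - 1) = (1 - q ^ Suc k) * qtail q (int (Suc k))"
      "qtail q (int (Suc k) - 2) = (1 - q ^ k) * ((1 - q ^ Suc k) * qtail q (int (Suc k)))" for k
      using qtail_Suc[OF q, of k] qtail_Suc[OF q, of "k - 1"]
      by (simp, cases k) simp_all
    have ring: "(1 + x * y * q) * ((1 - q * x) * A * ((1 - q * y) * B))
        + q * x * (A * ((1 - y) * ((1 - q * y) * B))) + q * y * ((1 - x) * ((1 - q * x) * A) * B)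
        = (1 - x * y * q) * (1 - x * y * q * q) * (A * B)" for x y A B :: "complex fps"
      by (simp add: algebra_simps)
    show ?thesis
      using ring[of "q ^ u'" "q ^ v'" "qtail q u" "qtail q v"]
      unfolding 5 * m nat_int by (simp add: power_add mult_ac)
  qed simp_all
qed

lemma qtail_tendsto:
  fixes q :: "complex fps"
  assumes q: "fps_nth q 0 = 0" and f: "filterlim f at_top sequentially"
  shows "(\<lambda>n. qtail q (f n)) \<longlonglongrightarrow> 1"
proof (rule tendsto_fpsI)
  fix i
  have "\<forall>\<^sub>F n in sequentially. f n \<ge> int i"
    using f by (simp add: filterlim_at_top)
  then show "\<forall>\<^sub>F n in sequentially. fps_nth (qtail q (f n)) i = fps_nth 1 i"
  proof eventually_elim
    case (elim n)
    have "fps_nth (qfin (q ^ Suc (nat (f n))) q i) i = fps_nth 1 i"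
    proof -
      have "fps_nth (qfin (q ^ Suc k) q j) l = fps_nth 1 l" if "l \<le> k" for k j l
      proof (induction j)
        case (Suc j)
        have "qfin (q ^ Suc k) q (Suc j) = qfin (q ^ Suc k) q j - (qfin (q ^ Suc k) q j * q ^ j) * (q * q ^ k)"
          by (simp add: qfin_Suc algebra_simps)
        then show ?case
          using Suc fps_nth_mult_power_eq_0[OF q q that, of "qfin (q ^ Suc k) q j * q ^ j"] by simp
      qed simp
      then show ?thesis using elim by auto
    qed
    then show ?case
      using elim q by (simp add: qtail_def qpoch_inf_nth[of _ _ i i] del: power_Suc)
  qed
qed

section \<open>Series indexed by lattices\<close>

definition finite_fibres :: "'i set \<Rightarrow> ('i \<Rightarrow> nat) \<Rightarrow> bool" where
  "finite_fibres S e \<longleftrightarrow> (\<forall>n. finite {i\<in>S. e i = n})"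

text \<open>A formal series over an index set such as the integers or a plane lattice, given by its
  coefficients so that reindexing and multiplying need no convergence. An infinite fibre of
  \<open>e\<close> would yield the coefficient 0, hence the hypothesis \<open>finite_fibres\<close>
  in products, decompositions and limits.\<close>

definition lsum :: "'i set \<Rightarrow> ('i \<Rightarrow> nat) \<Rightarrow> ('i \<Rightarrow> complex) \<Rightarrow> complex fps" where
  "lsum S e c = Abs_fps (\<lambda>n. \<Sum>i | i \<in> S \<and> e i = n. c i)"

lemma lsum_nth: "fps_nth (lsum S e c) n = (\<Sum>i | i \<in> S \<and> e i = n. c i)"
  by (simp add: lsum_def)

lemma finite_fibres_times:
  assumes "finite_fibres S e" "finite_fibres S' e'"
  shows "finite_fibres (S \<times> S') (\<lambda>(i, j). e i + e' j)"
  unfolding finite_fibres_def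
proof
  fix n
  have "{p \<in> S \<times> S'. (case p of (i, j) \<Rightarrow> e i + e' j) = n} \<subseteq>
      (\<Union>k\<le>n. {i\<in>S. e i = k}) \<times> (\<Union>k\<le>n. {i\<in>S'. e' i = k})"
    by auto
  then show "finite {p \<in> S \<times> S'. (case p of (i, j) \<Rightarrow> e i + e' j) = n}"
    using assms by (elim finite_subset) (auto simp: finite_fibres_def)
qed

lemma lsum_mult:
  assumes "finite_fibres S e" "finite_fibres S' e'"
  shows "lsum S e c * lsum S' e' c' = lsum (S \<times> S') (\<lambda>(i, j). e i + e' j) (\<lambda>(i, j). c i * c' j)"
proof (rule fps_ext)
  fix n
  define A where "A = (\<lambda>k. {i\<in>S. e i = k})"
  define B where "B = (\<lambda>k. {i\<in>S'. e' i = k})"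
  have fin: "finite (A k)" "finite (B k)" for k
    using assms by (auto simp: finite_fibres_def A_def B_def)
  have eq: "{p. p \<in> S \<times> S' \<and> (case p of (i, j) \<Rightarrow> e i + e' j) = n} = (\<Union>k\<in>{0..n}. A k \<times> B (n - k))"
    by (auto simp: A_def B_def)
  have "fps_nth (lsum S e c * lsum S' e' c') n = (\<Sum>k=0..n. (\<Sum>i\<in>A k. c i) * (\<Sum>j\<in>B (n - k). c' j))"
    by (simp add: fps_mult_nth lsum_nth A_def B_def)
  also have "\<dots> = (\<Sum>k=0..n. \<Sum>(i, j)\<in>A k \<times> B (n - k). c i * c' j)"
    by (simp add: sum_product sum.cartesian_product)
  also have "\<dots> = (\<Sum>(i, j)\<in>(\<Union>k\<in>{0..n}. A k \<times> B (n - k)). c i * c' j)"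
    using fin by (intro sum.UNION_disjoint[symmetric]) (auto simp: A_def)
  finally show "fps_nth (lsum S e c * lsum S' e' c') n =
      fps_nth (lsum (S \<times> S') (\<lambda>(i, j). e i + e' j) (\<lambda>(i, j). c i * c' j)) n"
    by (simp add: lsum_nth eq)
qed

lemma lsum_reindex:
  assumes "bij_betw h S' S" "\<And>i. i \<in> S' \<Longrightarrow> e (h i) = e' i" "\<And>i. i \<in> S' \<Longrightarrow> c (h i) = c' i"
  shows "lsum S e c = lsum S' e' c'"
proof (rule fps_ext)
  fix n
  have "bij_betw h {i. i \<in> S' \<and> e' i = n} {i. i \<in> S \<and> e i = n}"
    using assms(1,2) unfolding bij_betw_def by (force intro: inj_on_subset)
  then show "fps_nth (lsum S e c) n = fps_nth (lsum S' e' c') n"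
    using assms(3) sum.reindex_bij_betw[of h "{i. i \<in> S' \<and> e' i = n}" "{i. i \<in> S \<and> e i = n}" c]
    by (simp add: lsum_nth)
qed

lemma lsum_cong:
  assumes "S = S'" "\<And>i. i \<in> S' \<Longrightarrow> e i = e' i" "\<And>i. i \<in> S' \<Longrightarrow> c i = c' i"
  shows "lsum S e c = lsum S' e' c'"
  using assms by (intro lsum_reindex[where h = id]) (simp_all add: bij_betw_def)

lemma lsum_const_mult: "lsum S e (\<lambda>i. a * c i) = fps_const a * lsum S e c"
  by (rule fps_ext) (simp add: lsum_nth sum_distrib_left)

lemma lsum_add: "lsum S e (\<lambda>i. c i + c' i) = lsum S e c + lsum S e c'"
  by (rule fps_ext) (simp add: lsum_nth sum.distrib)

lemma lsum_X_power: "lsum S (\<lambda>i. k + e i) c = fps_X ^ k * lsum S e c"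
proof (rule fps_ext)
  fix n
  have "{i. i \<in> S \<and> k + e i = n} = (if n < k then {} else {i. i \<in> S \<and> e i = n - k})"
    by auto
  then show "fps_nth (lsum S (\<lambda>i. k + e i) c) n = fps_nth (fps_X ^ k * lsum S e c) n"
    by (simp add: lsum_nth fps_X_power_mult_nth)
qed

lemma lsum_compose: 
  assumes "m > 0"
  shows "lsum S (\<lambda>i. m * e i) c = lsum S e c oo fps_X ^ m"
proof (rule fps_ext)
  fix n
  have "{i. i \<in> S \<and> m * e i = n} = (if m dvd n then {i. i \<in> S \<and> e i = n div m} else {})"
    using assms by auto
  then show "fps_nth (lsum S (\<lambda>i. m * e i) c) n = fps_nth (lsum S e c oo fps_X ^ m) n"
    by (simp add: lsum_nth fps_nth_compose_X_power)
qed

lemma lsum_XD: "lsum S e (\<lambda>i. of_nat (e i) * c i) = fps_XD (lsum S e c)"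
  by (rule fps_ext) (simp add: lsum_nth sum_distrib_left)

lemma finite_fibres_intI:
  assumes "\<And>n. n \<in> S \<Longrightarrow> \<bar>n\<bar> \<le> int (e n) + k"
  shows "finite_fibres S e"
  unfolding finite_fibres_def
proof
  fix m
  have "{i \<in> S. e i = m} \<subseteq> {- (int m + k)..int m + k}"
    using assms by force
  then show "finite {i \<in> S. e i = m}"
    by (rule finite_subset) simp
qed

text \<open>The formal counterpart of dominated convergence: only the finitely many i with
  \<open>e i \<le> k\<close> reach the coefficient at k, and for these \<open>h N i\<close> finally
  agrees with 1 up to degree k.\<close>

lemma lsum_tendsto:
  fixes h :: "nat \<Rightarrow> 'i \<Rightarrow> complex fps"
  assumes e: "finite_fibres UNIV e" and h: "\<And>i. (\<lambda>N. h N i) \<longlonglongrightarrow> 1"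
    and I: "\<And>N. finite (I N)" "\<And>i. \<forall>\<^sub>F N in sequentially. i \<in> I N"
  shows "(\<lambda>N. \<Sum>i\<in>I N. fps_const (c i) * fps_X ^ e i * h N i) \<longlonglongrightarrow> lsum UNIV e c"
proof (rule tendsto_fpsI)
  fix k
  define F where "F = (\<Union>m\<le>k. {i. e i = m})"
  have F: "finite F"
    using e by (auto simp: F_def finite_fibres_def)
  have "\<forall>\<^sub>F N in sequentially. \<forall>i\<in>F. i \<in> I N"
    using F I(2) by (intro eventually_ball_finite) auto
  moreover have "\<forall>\<^sub>F N in sequentially. \<forall>i\<in>F. \<forall>l\<in>{..k}. fps_nth (h N i) l = fps_nth 1 l"
    using F h by (intro eventually_ball_finite ballI) (auto simp: tendsto_fps_iff)
  ultimately show "\<forall>\<^sub>F N in sequentially.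
      fps_nth (\<Sum>i\<in>I N. fps_const (c i) * fps_X ^ e i * h N i) k = fps_nth (lsum UNIV e c) k"
  proof eventually_elim
    case (elim N)
    have nth: "fps_nth (fps_const (c i) * fps_X ^ e i * h N i) k
        = (if k < e i then 0 else c i * fps_nth (h N i) (k - e i))" for i
      unfolding mult.assoc by (simp add: fps_X_power_mult_nth)
    have "fps_nth (\<Sum>i\<in>I N. fps_const (c i) * fps_X ^ e i * h N i) k
        = (\<Sum>i\<in>F. fps_nth (fps_const (c i) * fps_X ^ e i * h N i) k)"
      unfolding fps_sum_nth using elim(1) I(1)[of N]
      by (intro sum.mono_neutral_right) (auto simp: nth F_def)
    also have "\<dots> = (\<Sum>i\<in>F. if e i = k then c i else 0)"
      using elim(2) by (intro sum.cong refl) (auto simp: nth F_def)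
    also have "\<dots> = (\<Sum>i | e i = k. c i)"
      using F by (subst sum.If_cases) (auto simp: F_def intro!: sum.cong)
    finally show ?case by (simp add: lsum_nth)
  qed
qed

lemma sum_int_shift:
  fixes f :: "int \<Rightarrow> 'a::comm_monoid_add"
  assumes "\<And>n. \<bar>n\<bar> \<ge> K \<Longrightarrow> f n = 0" and "\<bar>d\<bar> \<le> 1"
  shows "(\<Sum>n\<in>{-K..K}. f (n + d)) = (\<Sum>n\<in>{-K..K}. f n)"
proof -
  have "(\<Sum>n\<in>{-K..K}. f (n + d)) = (\<Sum>n\<in>{-K+d..K+d}. f n)"
    by (rule sum.reindex_bij_witness[of _ "\<lambda>n. n - d" "\<lambda>n. n + d"]) auto
  also have "\<dots> = (\<Sum>n\<in>{-K..K}. f n)"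
    using assms by (intro sum.mono_neutral_cong) auto
  finally show ?thesis .
qed

section \<open>The Jacobi triple product\<close>

text \<open>The exponent of the n-th term of the sum of a^(n(n+1)/2) b^(n(n-1)/2) at a = q^i, b =
  q^j. Identities between such exponents are compared after doubling, through
  \<open>texp_eq\<close>, where \<open>div\<close> and \<open>nat\<close> have disappeared.\<close>

definition texp :: "nat \<Rightarrow> nat \<Rightarrow> int \<Rightarrow> nat" where
  "texp i j n = nat ((int i * (n * (n + 1)) + int j * (n * (n - 1))) div 2)"

lemma texp_eq: "2 * int (texp i j n) = int i * (n * (n + 1)) + int j * (n * (n - 1))"
proof -
  have ev: "even (n * (n + 1))" "even (n * (n - 1))"
    by auto
  have "n * (n + 1) \<ge> 0" "n * (n - 1) \<ge> 0"
    by (auto simp: zero_le_mult_iff)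
  then have "int i * (n * (n + 1)) + int j * (n * (n - 1)) \<ge> 0"
    by simp
  moreover have "even (int i * (n * (n + 1)) + int j * (n * (n - 1)))"
    using ev by simp
  ultimately obtain k where "int i * (n * (n + 1)) + int j * (n * (n - 1)) = 2 * k" "k \<ge> 0"
    by (elim evenE) auto
  then show ?thesis
    by (simp add: texp_def)
qed

lemma of_nat_double_cancel: "2 * int a = 2 * int b \<Longrightarrow> a = b"
  by simp

lemma texp_eqI: "2 * int m = int i * (n * (n + 1)) + int j * (n * (n - 1)) \<Longrightarrow> texp i j n = m"
  using texp_eq[of i j n] by linarith

lemma texp_ge_abs:
  assumes "i \<ge> 1" "j \<ge> 1"
  shows "\<bar>n\<bar> \<le> int (texp i j n)"
proof -
  have "1 * (n * (n + 1)) \<le> int i * (n * (n + 1))" "1 * (n * (n - 1)) \<le> int j * (n * (n - 1))"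
    using assms by (intro mult_right_mono; force simp: zero_le_mult_iff)+
  then have "2 * (n * n) \<le> 2 * int (texp i j n)"
    unfolding texp_eq by (simp add: algebra_simps)
  moreover have "\<bar>n\<bar> * 1 \<le> \<bar>n\<bar> * \<bar>n\<bar>"
  proof (cases "n = 0")
    case False
    then have "1 \<le> \<bar>n\<bar>"
      by simp
    then show ?thesis
      by (rule mult_left_mono) simp
  qed simp
  ultimately show ?thesis
    by (simp add: abs_mult_self_eq)
qed

lemma finite_fibres_texp: "i \<ge> 1 \<Longrightarrow> j \<ge> 1 \<Longrightarrow> finite_fibres S (texp i j)"
  by (rule finite_fibres_intI[where k = 0]) (simp add: texp_ge_abs)

text \<open>Ramanujan's \<open>f(c q^i, c q^j)\<close>. Only \<open>c = 1\<close> and \<open>c = -1\<close> occur, for which the power of \<open>c\<close>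
  depends on the parity of the index alone.\<close>

definition theta :: "complex \<Rightarrow> nat \<Rightarrow> nat \<Rightarrow> complex fps" where
  "theta c i j = lsum UNIV (texp i j) (\<lambda>n. c ^ nat \<bar>n\<bar>)"

lemma sign_power_abs:
  fixes c :: "'a::comm_ring_1"
  assumes "c ^ 2 = 1"
  shows "c ^ nat \<bar>n\<bar> = (if even n then 1 else c)"
proof -
  have "c ^ m = (if even m then 1 else c)" for m
    using assms by (induction m rule: induct_nat_012) (auto simp: power2_eq_square)
  then show ?thesis by (simp add: even_nat_iff)
qed

text \<open>Multiplication by \<open>M\<close> replaces g n by its neighbours, so
  \<open>M * S N\<close> is a sum of two shifted copies; shifting keeps the range because the tails
  vanish near its ends, and \<open>qtail_rec\<close> merges the three sums. The relation for
  \<open>M\<close> is asked only where both tails can be nonzero. The offset s is 0 for the triple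
  product and 1 for Jacobi's cube.\<close>

lemma qtail_sum_step:
  fixes q M :: "complex fps"
  assumes q0: "fps_nth q 0 = 0" and K: "K > int (Suc N) + s" "s \<ge> 0"
    and M: "\<And>n. n \<le> int N \<Longrightarrow> n \<ge> - int N - s \<Longrightarrow>
      M * g n = q ^ nat (int N - n) * g (n + 1) + q ^ nat (int N + s + n) * g (n - 1)"
  defines "m \<equiv> nat (2 * int N + s + 1)"
    and "S \<equiv> \<lambda>N. \<Sum>n\<in>{-K..K}. g n * (qtail q (int N - n) * qtail q (int N + s + n))"
  shows "(1 + q ^ m + M) * S N = (1 - q ^ m) * (1 - q ^ Suc m) * S (Suc N)"
proof -
  define A where "A = qtail q"
  have A_neg [simp]: "A m = 0" if "m < 0" for m
    using that by (simp add: A_def)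
  have "M * S N = (\<Sum>n\<in>{-K..K}. (q ^ nat (int N - n) * g (n + 1) + q ^ nat (int N + s + n) * g (n - 1)) *
      (A (int N - n) * A (int N + s + n)))"
    unfolding S_def A_def[symmetric] sum_distrib_left mult.assoc[symmetric]
  proof (intro sum.cong refl)
    fix n
    show "M * g n * A (int N - n) * A (int N + s + n) =
        (q ^ nat (int N - n) * g (n + 1) + q ^ nat (int N + s + n) * g (n - 1)) * A (int N - n) * A (int N + s + n)"
      using M[of n] by (cases "n \<le> int N"; cases "n \<ge> - int N - s") auto
  qed
  also have "\<dots> =
      (\<Sum>n\<in>{-K..K}. (\<lambda>m. q ^ nat (int N - m + 1) * g m * (A (int N - m + 1) * A (int N + s + m - 1))) (n + 1))
    + (\<Sum>n\<in>{-K..K}. (\<lambda>m. q ^ nat (int N + s + m + 1) * g m * (A (int N - m - 1) * A (int N + s + m + 1))) (n + (-1)))"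
    unfolding sum.distrib[symmetric] by (intro sum.cong refl) (simp add: algebra_simps)
  also have "\<dots> =
      (\<Sum>n\<in>{-K..K}. q ^ nat (int N - n + 1) * g n * (A (int N - n + 1) * A (int N + s + n - 1)))
    + (\<Sum>n\<in>{-K..K}. q ^ nat (int N + s + n + 1) * g n * (A (int N - n - 1) * A (int N + s + n + 1)))"
    using K by (intro arg_cong2[where f = plus] sum_int_shift) (auto simp: abs_le_iff abs_if split: if_splits)
  finally have MS: "M * S N = \<dots>" .
  have "(1 + q ^ m + M) * S N = (\<Sum>n\<in>{-K..K}. g n * ((1 + q ^ m) * (A (int N - n) * A (int N + s + n))
      + q ^ nat (int N - n + 1) * (A (int N - n + 1) * A (int N + s + n - 1))
      + q ^ nat (int N + s + n + 1) * (A (int N - n - 1) * A (int N + s + n + 1))))"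
    unfolding distrib_right[of "1 + q ^ m" M] MS
    unfolding S_def A_def[symmetric] sum_distrib_left sum.distrib[symmetric]
    by (intro sum.cong refl) (simp add: algebra_simps)
  also have "\<dots> = (\<Sum>n\<in>{-K..K}. g n * ((1 - q ^ m) * (1 - q ^ Suc m) *
      (A (int (Suc N) - n) * A (int (Suc N) + s + n))))"
  proof (intro sum.cong refl arg_cong2[where f = times])
    fix n
    show "(1 + q ^ m) * (A (int N - n) * A (int N + s + n))
      + q ^ nat (int N - n + 1) * (A (int N - n + 1) * A (int N + s + n - 1))
      + q ^ nat (int N + s + n + 1) * (A (int N - n - 1) * A (int N + s + n + 1)) =
      (1 - q ^ m) * (1 - q ^ Suc m) * (A (int (Suc N) - n) * A (int (Suc N) + s + n))"
      using qtail_rec[OF q0, of "int N + 1 - n" "int N + s + 1 + n" m] K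
      by (simp add: A_def m_def algebra_simps)
  qed
  finally show ?thesis
    by (simp add: S_def A_def sum_distrib_left mult_ac)
qed

text \<open>Cauchy's finite form. As \<open>qtail q m\<close> is (q; q) divided by its first m
  factors, the summand together with \<open>qfin q q (2 * N)\<close> contains the q-binomial
  coefficient of 2 N over N + n; in terms of tails no division occurs. The range of summation does
  not depend on N, which suits the induction.\<close>

lemma jacobi_triple_product_finite:
  fixes c :: complex
  assumes c: "c\<^sup>2 = 1" and ij: "i \<ge> 1" "j \<ge> 1" and K: "K > int N"
  defines "q \<equiv> (fps_X :: complex fps) ^ (i + j)"
    and "g \<equiv> \<lambda>n. fps_const (c ^ nat \<bar>n\<bar>) * fps_X ^ texp i j n"
  shows "qtail q 0 ^ 2 * (qfin (- (fps_const c * fps_X ^ i)) q N * qfin (- (fps_const c * fps_X ^ j)) q N)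
    = qfin q q (2 * N) * (\<Sum>n\<in>{-K..K}. g n * (qtail q (int N - n) * qtail q (int N + n)))"
  using K
proof (induction N)
  case 0
  have "(\<Sum>n\<in>{-K..K}. g n * (qtail q (int 0 - n) * qtail q (int 0 + n)))
      = (\<Sum>n\<in>{0}. g n * (qtail q (int 0 - n) * qtail q (int 0 + n)))"
  proof (intro sum.mono_neutral_right ballI)
    fix n assume "n \<in> {-K..K} - {0}"
    then have "int 0 - n < 0 \<or> int 0 + n < 0"
      by auto
    then show "g n * (qtail q (int 0 - n) * qtail q (int 0 + n)) = 0"
      by auto
  qed (use 0 in auto)
  then show ?case
    by (simp add: g_def texp_def power2_eq_square)
next
  case (Suc N)
  have q0: "fps_nth q 0 = 0"
    using ij by (simp add: q_def)
  define S where "S = (\<lambda>N. \<Sum>n\<in>{-K..K}. g n * (qtail q (int N - n) * qtail q (int N + n)))"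
  define a where "a = fps_const c * (fps_X :: complex fps) ^ i"
  define b where "b = fps_const c * (fps_X :: complex fps) ^ j"
  have cpow: "c ^ nat \<bar>n\<bar> = (if even n then 1 else c)" for n
    by (rule sign_power_abs[OF c])
  have cc: "c * c = 1"
    using c by (simp add: power2_eq_square)
  have a_step: "a * q ^ N * g n = q ^ nat (int N - n) * g (n + 1)" if "n \<le> int N" for n
  proof -
    have "2 * int (i + (i + j) * N + texp i j n) = 2 * int ((i + j) * nat (int N - n) + texp i j (n + 1))"
      using that by (simp only: of_nat_add of_nat_mult distrib_left[of "2::int"] texp_eq) (simp add: algebra_simps)
    then have e: "i + (i + j) * N + texp i j n = (i + j) * nat (int N - n) + texp i j (n + 1)"
      by (rule of_nat_double_cancel)
    have "a * q ^ N * g n = fps_const (c * c ^ nat \<bar>n\<bar>) * fps_X ^ (i + (i + j) * N + texp i j n)"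
      unfolding a_def q_def g_def power_add power_mult by (simp add: mult_ac)
    also have "\<dots> = q ^ nat (int N - n) * g (n + 1)"
      unfolding e g_def q_def power_add power_mult cpow by (simp add: mult_ac cc)
    finally show ?thesis .
  qed
  have b_step: "b * q ^ N * g n = q ^ nat (int N + n) * g (n - 1)" if "n \<ge> - int N" for n
  proof -
    have "2 * int (j + (i + j) * N + texp i j n) = 2 * int ((i + j) * nat (int N + n) + texp i j (n - 1))"
      using that by (simp only: of_nat_add of_nat_mult distrib_left[of "2::int"] texp_eq) (simp add: algebra_simps)
    then have e: "j + (i + j) * N + texp i j n = (i + j) * nat (int N + n) + texp i j (n - 1)"
      by (rule of_nat_double_cancel)
    have "b * q ^ N * g n = fps_const (c * c ^ nat \<bar>n\<bar>) * fps_X ^ (j + (i + j) * N + texp i j n)"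
      unfolding b_def q_def g_def power_add power_mult by (simp add: mult_ac)
    also have "\<dots> = q ^ nat (int N + n) * g (n - 1)"
      unfolding e g_def q_def power_add power_mult cpow by (simp add: mult_ac cc)
    finally show ?thesis .
  qed
  have "a * b = fps_const (c * c) * (fps_X ^ i * fps_X ^ j)"
    by (simp add: a_def b_def mult_ac flip: fps_const_mult)
  then have "a * b = q"
    by (simp add: cc q_def flip: power_add)
  moreover have "a * q ^ N * (b * q ^ N) = (a * b) * (q ^ N * q ^ N)"
    by (simp only: mult_ac)
  ultimately have ab: "a * q ^ N * (b * q ^ N) = q ^ (2 * N + 1)"
    by (simp add: mult_2 power_add)
  have "(1 + q ^ nat (2 * int N + 0 + 1) + (a * q ^ N + b * q ^ N)) * S N
      = (1 - q ^ nat (2 * int N + 0 + 1)) * (1 - q ^ Suc (nat (2 * int N + 0 + 1))) * S (Suc N)"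
    using qtail_sum_step[OF q0, of N 0 K "a * q ^ N + b * q ^ N" g] a_step b_step Suc.prems
    by (simp add: S_def distrib_right)
  moreover have "nat (2 * int N + 0 + 1) = 2 * N + 1"
    by simp
  ultimately have step: "(1 + a * q ^ N) * (1 + b * q ^ N) * S N
      = (1 - q ^ (2 * N + 1)) * (1 - q ^ Suc (2 * N + 1)) * S (Suc N)"
    using ab by (simp add: algebra_simps)
  have IH: "qtail q 0 ^ 2 * (qfin (- a) q N * qfin (- b) q N) = qfin q q (2 * N) * S N"
    using Suc by (simp add: a_def b_def S_def)
  have "qtail q 0 ^ 2 * (qfin (- a) q (Suc N) * qfin (- b) q (Suc N))
      = qtail q 0 ^ 2 * (qfin (- a) q N * qfin (- b) q N) * ((1 + a * q ^ N) * (1 + b * q ^ N))"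
    by (simp add: qfin_Suc mult_ac)
  also have "\<dots> = qfin q q (2 * N) * ((1 + a * q ^ N) * (1 + b * q ^ N) * S N)"
    unfolding IH by (simp add: mult_ac)
  also have "\<dots> = qfin q q (2 * Suc N) * S (Suc N)"
    unfolding step by (simp add: qfin_Suc mult_ac)
  finally show ?case
    by (simp add: a_def b_def S_def)
qed

lemma filterlim_int_add: "filterlim (\<lambda>N. int N + n) at_top sequentially"
  unfolding filterlim_at_top
proof
  fix Z
  show "\<forall>\<^sub>F N in sequentially. Z \<le> int N + n"
    by (rule eventually_sequentiallyI[of "nat (Z - n)"]) auto
qed

theorem jacobi_triple_product:
  fixes c :: complex
  assumes c: "c\<^sup>2 = 1" and ij: "i \<ge> 1" "j \<ge> 1"
  defines "q \<equiv> (fps_X :: complex fps) ^ (i + j)"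
  shows "theta c i j = qpoch_inf (- (fps_const c * fps_X ^ i)) q * qpoch_inf (- (fps_const c * fps_X ^ j)) q
    * qpoch_inf q q"
proof -
  have q0: "fps_nth q 0 = 0"
    using ij by (simp add: q_def)
  define F where "F = (\<lambda>N. \<Sum>n\<in>{-(int N + 1)..int N + 1}. fps_const (c ^ nat \<bar>n\<bar>) * fps_X ^ texp i j n *
      (qtail q (int N - n) * qtail q (int N + n)))"
  have "(\<lambda>N. qtail q (int N - n) * qtail q (int N + n)) \<longlonglongrightarrow> 1 * 1" for n
  proof (intro tendsto_fps_mult qtail_tendsto q0)
    show "filterlim (\<lambda>N. int N - n) at_top sequentially" "filterlim (\<lambda>N. int N + n) at_top sequentially"
      using filterlim_int_add[of n] filterlim_int_add[of "- n"] by simp_all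
  qed
  then have "F \<longlonglongrightarrow> theta c i j"
    unfolding F_def theta_def
  proof (intro lsum_tendsto finite_fibres_texp ij)
    show "\<forall>\<^sub>F N in sequentially. n \<in> {-(int N + 1)..int N + 1}" for n
      by (rule eventually_sequentiallyI[of "nat \<bar>n\<bar>"]) auto
  qed auto
  moreover have "(\<lambda>N. qfin q q (2 * N)) \<longlonglongrightarrow> qpoch_inf q q"
    by (rule filterlim_compose[OF qfin_tendsto[OF q0 q0] mult_nat_left_at_top]) simp
  ultimately have "(\<lambda>N. qfin q q (2 * N) * F N) \<longlonglongrightarrow> qpoch_inf q q * theta c i j"
    by (intro tendsto_fps_mult)
  moreover have "(\<lambda>N. qtail q 0 ^ 2 * (qfin (- (fps_const c * fps_X ^ i)) q N * qfin (- (fps_const c * fps_X ^ j)) q N))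
      \<longlonglongrightarrow> qtail q 0 ^ 2 * (qpoch_inf (- (fps_const c * fps_X ^ i)) q * qpoch_inf (- (fps_const c * fps_X ^ j)) q)"
    using ij by (intro tendsto_fps_mult tendsto_const qfin_tendsto q0) auto
  moreover have "qtail q 0 ^ 2 * (qfin (- (fps_const c * fps_X ^ i)) q N * qfin (- (fps_const c * fps_X ^ j)) q N)
      = qfin q q (2 * N) * F N" for N
    unfolding F_def q_def by (rule jacobi_triple_product_finite[OF c ij]) simp
  ultimately have "qpoch_inf q q * theta c i j = qtail q 0 ^ 2 *
      (qpoch_inf (- (fps_const c * fps_X ^ i)) q * qpoch_inf (- (fps_const c * fps_X ^ j)) q)"
    using LIMSEQ_unique by simp
  moreover have "qtail q 0 = qpoch_inf q q"
    by (simp add: qtail_def)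
  moreover have "qpoch_inf q q \<noteq> 0"
    using q0 by (intro qpoch_inf_nonzero)
  ultimately show ?thesis
    by (simp add: power2_eq_square mult_ac)
qed


section \<open>Jacobi's identity for the cube of the Euler product\<close>

lemma finite_fibres_texp_1_0: "finite_fibres UNIV (texp 1 0)"
proof (rule finite_fibres_intI)
  fix n :: int
  have "0 \<le> (\<bar>n\<bar> - 1) * (\<bar>n\<bar> - 2)"
    by (cases "\<bar>n\<bar> \<le> 1") (auto simp: mult_nonneg_nonneg mult_nonpos_nonpos)
  then have "0 \<le> \<bar>n\<bar> * \<bar>n\<bar> - 3 * \<bar>n\<bar> + 2"
    by (simp add: algebra_simps)
  moreover have "2 * int (texp 1 0 n) \<ge> \<bar>n\<bar> * \<bar>n\<bar> - \<bar>n\<bar>"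
    unfolding texp_eq abs_mult_self_eq by (simp add: algebra_simps)
  ultimately show "\<bar>n\<bar> \<le> int (texp 1 0 n) + 1"
    by linarith
qed

text \<open>In place of differentiating the triple product: the coefficients c(n) = (-1)^n (2 n + 1)
  solve c(n+1) + 2 c(n) + c(n-1) = 0, whose characteristic polynomial has the double root -1. Hence
  -2 q^(N+1) can serve as \<open>M\<close>, and 1 + q^(2N+2) - 2 q^(N+1) is a square. The factor 2
  appears because n and -1 - n contribute the same term.\<close>

theorem jacobi_cube:
  "2 * qpoch_inf fps_X fps_X ^ 3
    = lsum UNIV (texp 1 0) (\<lambda>n. (- 1) ^ nat \<bar>n\<bar> * of_int (2 * n + 1))"
proof -
  define q :: "complex fps" where "q = fps_X"
  have q0: "fps_nth q 0 = 0"
    by (simp add: q_def)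
  define c :: "int \<Rightarrow> complex" where "c = (\<lambda>n. (- 1) ^ nat \<bar>n\<bar> * of_int (2 * n + 1))"
  define g where "g = (\<lambda>n. fps_const (c n) * q ^ texp 1 0 n)"
  define S where "S = (\<lambda>K N. \<Sum>n\<in>{-K..K}. g n * (qtail q (int N - n) * qtail q (int N + 1 + n)))"
  have c_eq: "c n = (if even n then 1 else - 1) * of_int (2 * n + 1)" for n
    using sign_power_abs[of "-1::complex" n] by (simp add: c_def)
  have c_rec: "- 2 * c n = c (n + 1) + c (n - 1)" for n
    by (simp add: c_eq algebra_simps)
  have fin: "2 * (qtail q 0 ^ 2 * qfin q q N ^ 2) = qfin q q (2 * N + 1) * S K N" if "K > int N + 1" for K N
    using that
  proof (induction N)
    case 0
    have "S K 0 = (\<Sum>n\<in>{-1, 0}. g n * (qtail q (int 0 - n) * qtail q (int 0 + 1 + n)))"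
      unfolding S_def
    proof (intro sum.mono_neutral_right ballI)
      fix n assume "n \<in> {-K..K} - {-1, 0}"
      then have "int 0 - n < 0 \<or> int 0 + 1 + n < 0"
        by auto
      then show "g n * (qtail q (int 0 - n) * qtail q (int 0 + 1 + n)) = 0"
        by auto
    qed (use 0 in auto)
    also have "\<dots> = 2 * (qtail q 0 * qtail q 1)"
      by (simp add: g_def c_eq texp_def)
    finally show ?case
      using qtail_Suc[OF q0, of 0] by (simp add: qfin_def power2_eq_square mult_ac)
  next
    case (Suc N)
    have M: "- 2 * q ^ Suc N * g n = q ^ nat (int N - n) * g (n + 1) + q ^ nat (int N + 1 + n) * g (n - 1)"
      if n: "n \<le> int N" "n \<ge> - int N - 1" for n
    proof -
      have "2 * int (Suc N + texp 1 0 n) = 2 * int (nat (int N - n) + texp 1 0 (n + 1))"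
           "2 * int (Suc N + texp 1 0 n) = 2 * int (nat (int N + 1 + n) + texp 1 0 (n - 1))"
        using n by (simp_all only: of_nat_add of_nat_mult distrib_left[of "2::int"] texp_eq) (simp_all add: algebra_simps)
      then have e: "nat (int N - n) + texp 1 0 (n + 1) = Suc N + texp 1 0 n"
           "nat (int N + 1 + n) + texp 1 0 (n - 1) = Suc N + texp 1 0 n"
        by (intro of_nat_double_cancel; simp)+
      have "q ^ nat (int N - n) * g (n + 1) + q ^ nat (int N + 1 + n) * g (n - 1)
          = fps_const (c (n + 1)) * q ^ (nat (int N - n) + texp 1 0 (n + 1))
            + fps_const (c (n - 1)) * q ^ (nat (int N + 1 + n) + texp 1 0 (n - 1))"
        by (simp only: g_def power_add mult_ac)
      also have "\<dots> = fps_const (c (n + 1) + c (n - 1)) * q ^ (Suc N + texp 1 0 n)"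
        unfolding e by (simp add: algebra_simps flip: fps_const_add)
      also have "\<dots> = - 2 * q ^ Suc N * g n"
      proof -
        have *: "fps_const (- 2 * c n) = - 2 * fps_const (c n)"
          by (simp add: fps_numeral_fps_const flip: fps_const_mult fps_const_neg)
        then show ?thesis
          unfolding c_rec[symmetric] * by (simp add: g_def power_add mult_ac)
      qed
      finally show ?thesis by simp
    qed
    have "(1 + q ^ nat (2 * int N + 1 + 1) + - 2 * q ^ Suc N) * S K N
        = (1 - q ^ nat (2 * int N + 1 + 1)) * (1 - q ^ Suc (nat (2 * int N + 1 + 1))) * S K (Suc N)"
      unfolding S_def using Suc.prems by (intro qtail_sum_step[OF q0 _ _ M]) auto
    moreover have "nat (2 * int N + 1 + 1) = 2 * N + 2"
      by simp
    moreover have "1 + q ^ (2 * N + 2) + - 2 * q ^ Suc N = (1 - q ^ Suc N)\<^sup>2"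
    proof -
      have "2 * N + 2 = Suc N + Suc N"
        by simp
      then have "q ^ (2 * N + 2) = q ^ Suc N * q ^ Suc N"
        by (simp only: power_add)
      moreover have "1 + x * x + - 2 * x = (1 - x)\<^sup>2" for x :: "complex fps"
        by (simp add: power2_eq_square algebra_simps)
      ultimately show ?thesis
        by (simp only:)
    qed
    ultimately have step: "(1 - q ^ Suc N)\<^sup>2 * S K N = (1 - q ^ (2 * N + 2)) * (1 - q ^ Suc (2 * N + 2)) * S K (Suc N)"
      by (simp only:)
    have "2 * (qtail q 0 ^ 2 * qfin q q (Suc N) ^ 2) = 2 * (qtail q 0 ^ 2 * qfin q q N ^ 2) * (1 - q ^ Suc N)\<^sup>2"
      by (simp add: qfin_Suc power_mult_distrib mult_ac)
    also have "\<dots> = qfin q q (2 * N + 1) * ((1 - q ^ Suc N)\<^sup>2 * S K N)"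
      using Suc by (simp only: mult_ac)
    also have "\<dots> = qfin q q (Suc (Suc (2 * N + 1))) * S K (Suc N)"
      unfolding step by (simp add: qfin_Suc mult_ac)
    finally show ?case
      by simp
  qed
  note finite_fibres_texp_1_0
  moreover have "(\<lambda>N. qtail q (int N - n) * qtail q (int N + 1 + n)) \<longlonglongrightarrow> 1 * 1" for n
  proof (intro tendsto_fps_mult qtail_tendsto q0)
    show "filterlim (\<lambda>N. int N - n) at_top sequentially" "filterlim (\<lambda>N. int N + 1 + n) at_top sequentially"
      using filterlim_int_add[of "1 + n"] filterlim_int_add[of "- n"] by (simp_all add: add.assoc)
  qed
  ultimately have "(\<lambda>N. S (int N + 2) N) \<longlonglongrightarrow> lsum UNIV (texp 1 0) c"
    unfolding S_def g_def q_def
  proof (intro lsum_tendsto)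
    show "\<forall>\<^sub>F N in sequentially. n \<in> {-(int N + 2)..int N + 2}" for n
      by (rule eventually_sequentiallyI[of "nat \<bar>n\<bar>"]) auto
  qed auto
  moreover have "(\<lambda>N. qfin q q (2 * N + 1)) \<longlonglongrightarrow> qpoch_inf q q"
    by (rule filterlim_compose[OF qfin_tendsto[OF q0 q0] filterlim_subseq]) (auto simp: strict_mono_def)
  ultimately have "(\<lambda>N. qfin q q (2 * N + 1) * S (int N + 2) N) \<longlonglongrightarrow> qpoch_inf q q * lsum UNIV (texp 1 0) c"
    by (intro tendsto_fps_mult)
  moreover have "(\<lambda>N. 2 * (qtail q 0 ^ 2 * (qfin q q N * qfin q q N))) \<longlonglongrightarrow> 2 * (qtail q 0 ^ 2 * (qpoch_inf q q * qpoch_inf q q))"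
    by (intro tendsto_fps_mult tendsto_const qfin_tendsto q0)
  moreover have "2 * (qtail q 0 ^ 2 * (qfin q q N * qfin q q N)) = qfin q q (2 * N + 1) * S (int N + 2) N" for N
    using fin[of N "int N + 2"] by (simp add: power2_eq_square)
  ultimately have "qpoch_inf q q * lsum UNIV (texp 1 0) c = 2 * (qtail q 0 ^ 2 * (qpoch_inf q q * qpoch_inf q q))"
    using LIMSEQ_unique by (simp only:)
  moreover have "qtail q 0 = qpoch_inf q q"
    by (simp add: qtail_def)
  moreover have "qpoch_inf q q \<noteq> 0"
    using q0 by (intro qpoch_inf_nonzero)
  ultimately show ?thesis
    by (simp add: power2_eq_square power3_eq_cube mult_ac c_def q_def)
qed

section \<open>Theta function identities\<close>

lemma lsum_decompose:
  assumes R: "finite R" and bij: "bij_betw (\<lambda>(r, m). h r m) (R \<times> M) S" and e: "finite_fibres S e"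
  shows "lsum S e c = (\<Sum>r\<in>R. lsum M (\<lambda>m. e (h r m)) (\<lambda>m. c (h r m)))"
proof (rule fps_ext)
  fix n
  define A where "A = (\<lambda>r. {m \<in> M. e (h r m) = n})"
  have bij': "bij_betw (\<lambda>(r, m). h r m) (SIGMA r:R. A r) {i \<in> S. e i = n}"
  proof (rule bij_betw_imageI)
    show "inj_on (\<lambda>(r, m). h r m) (SIGMA r:R. A r)"
      using bij by (auto simp: bij_betw_def A_def intro: inj_on_subset)
    have "(\<lambda>(r, m). h r m) ` (R \<times> M) = S"
      using bij by (simp add: bij_betw_def)
    then show "(\<lambda>(r, m). h r m) ` (SIGMA r:R. A r) = {i \<in> S. e i = n}"
      by (auto simp: A_def image_iff)
  qed
  have "finite (SIGMA r:R. A r)"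
    using bij_betw_finite[OF bij'] e by (simp add: finite_fibres_def)
  then have "finite (Pair r ` A r)" if "r \<in> R" for r
    by (rule finite_subset[rotated]) (use that in auto)
  then have "finite (A r)" if "r \<in> R" for r
    using finite_imageD[of "Pair r" "A r"] that by (auto simp: inj_on_def)
  then have "(\<Sum>r\<in>R. \<Sum>m\<in>A r. c (h r m)) = (\<Sum>(r, m)\<in>(SIGMA r:R. A r). c (h r m))"
    using R by (intro sum.Sigma) auto
  also have "\<dots> = (\<Sum>i | i \<in> S \<and> e i = n. c i)"
    using sum.reindex_bij_betw[OF bij', of c] by (simp add: case_prod_unfold)
  finally show "fps_nth (lsum S e c) n = fps_nth (\<Sum>r\<in>R. lsum M (\<lambda>m. e (h r m)) (\<lambda>m. c (h r m))) n"
    by (simp add: lsum_nth fps_sum_nth A_def)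
qed

lemma theta_commute: "theta c i j = theta c j i"
  unfolding theta_def
proof (rule lsum_reindex[of uminus])
  fix n :: int
  show "texp i j (- n) = texp j i n"
    by (rule texp_eqI) (simp add: texp_eq algebra_simps)
qed (auto intro!: bij_betwI[of _ _ _ uminus])

lemma theta_mult:
  assumes "i \<ge> 1" "j \<ge> 1" "k \<ge> 1" "l \<ge> 1"
  shows "theta c i j * theta d k l = lsum UNIV (\<lambda>(m, n). texp i j m + texp k l n)
    (\<lambda>(m, n). c ^ nat \<bar>m\<bar> * d ^ nat \<bar>n\<bar>)"
  unfolding theta_def using assms by (subst lsum_mult) (auto intro: finite_fibres_texp)

lemma texp_eq_addI:
  assumes "2 * int k + int l * (int i' * (m * (m + 1)) + int j' * (m * (m - 1))) = int i * (n * (n + 1)) + int j * (n * (n - 1))"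
  shows "texp i j n = k + l * texp i' j' m"
proof (rule texp_eqI)
  have "2 * int (k + l * texp i' j' m) = 2 * int k + int l * (2 * int (texp i' j' m))"
    by (simp add: algebra_simps)
  then show "2 * int (k + l * texp i' j' m) = int i * (n * (n + 1)) + int j * (n * (n - 1))"
    unfolding texp_eq assms .
qed

lemma finite_fibres_texp2:
  assumes "i \<ge> 1" "j \<ge> 1" "k \<ge> 1" "l \<ge> 1"
  shows "finite_fibres UNIV (\<lambda>(m, n). texp i j m + texp k l n)"
  using finite_fibres_times[OF finite_fibres_texp[of i j UNIV] finite_fibres_texp[of k l UNIV]] assms by simp

lemma sign_power_abs_minus: "(- 1) ^ nat \<bar>n\<bar> = (if even n then 1 else (- 1 :: complex))"
  by (rule sign_power_abs) simp

lemma bij_betw_parity: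
  "bij_betw (\<lambda>(r, m). (\<lambda>(a, b). (a + b + r, a - b)) m) ({0, 1} \<times> UNIV) (UNIV :: (int \<times> int) set)"
proof (rule bij_betw_imageI)
  have ex: "\<exists>r\<in>{0, 1}. \<exists>a b. (a + b + r, a - b) = (m, n)" for m n :: int
  proof (cases "even (m + n)")
    case True
    then obtain k where "m + n = 2 * k" ..
    then have "(k + (k - n) + 0, k - (k - n)) = (m, n)"
      by simp
    then show ?thesis by blast
  next
    case False
    then obtain k where "m + n = 2 * k + 1" ..
    then have "(k + (k - n) + 1, k - (k - n)) = (m, n)"
      by simp
    then show ?thesis by blast
  qed
  have "p \<in> (\<lambda>(r, m). (\<lambda>(a, b). (a + b + r, a - b)) m) ` ({0, 1} \<times> UNIV)" for p :: "int \<times> int"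
  proof -
    obtain m n where "p = (m, n)"
      by force
    then obtain r a b where "r \<in> {0, 1}" "(a + b + r, a - b) = p"
      using ex[of m n] by blast
    then show ?thesis
      by (auto intro!: image_eqI[of _ _ "(r, (a, b))"])
  qed
  then show "(\<lambda>(r, m). (\<lambda>(a, b). (a + b + r, a - b)) m) ` ({0, 1} \<times> UNIV) = (UNIV :: (int \<times> int) set)"
    by blast
qed (auto intro!: inj_onI; presburger)

text \<open>Since 1 + 4 = 2 + 3, both exponents have the same leading coefficient, so the
  substitution (m, n) = (a + b + r, a - b) removes the cross term. The opposite signs c and -c
  produce (-1)^(a+b) on both cosets, up to the factor c on the second.\<close>

lemma theta_product_mod_5:
  fixes c :: complex
  assumes c: "c = 1 \<or> c = - 1"
  shows "theta c 1 4 * theta (- c) 2 3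
    = theta (- 1) 3 7 * theta (- 1) 4 6 + fps_const c * (fps_X * (theta (- 1) 8 2 * theta (- 1) 9 1))"
proof -
  have c1: "c ^ nat \<bar>n\<bar> = (if even n then 1 else c)" and c2: "(- c) ^ nat \<bar>n\<bar> = (if even n then 1 else - c)" for n
    using c by (auto intro!: sign_power_abs)
  let ?e = "\<lambda>(m, n). texp 1 4 m + texp 2 3 n" and ?c = "\<lambda>(m, n). c ^ nat \<bar>m\<bar> * (- c) ^ nat \<bar>n\<bar>"
  let ?h = "\<lambda>r (a, b). (a + b + r, a - b)"
  have "theta c 1 4 * theta (- c) 2 3 = lsum UNIV ?e ?c"
    by (rule theta_mult) auto
  also have "\<dots> = (\<Sum>r\<in>{0, 1}. lsum UNIV (\<lambda>m. ?e (?h r m)) (\<lambda>m. ?c (?h r m)))"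
    by (rule lsum_decompose[OF _ bij_betw_parity]) (auto intro!: finite_fibres_texp2)
  also have "\<dots> = lsum UNIV (\<lambda>m. ?e (?h 0 m)) (\<lambda>m. ?c (?h 0 m)) + lsum UNIV (\<lambda>m. ?e (?h 1 m)) (\<lambda>m. ?c (?h 1 m))"
    by simp
  also have "lsum UNIV (\<lambda>m. ?e (?h 0 m)) (\<lambda>m. ?c (?h 0 m)) = theta (- 1) 3 7 * theta (- 1) 4 6"
  proof (subst theta_mult; (simp; fail)?; intro lsum_cong refl)
    fix m :: "int \<times> int"
    obtain a b where m: "m = (a, b)" by force
    have "texp 1 4 (a + b + 0) + texp 2 3 (a - b) = texp 3 7 a + texp 4 6 b"
      by (rule of_nat_double_cancel) (simp only: of_nat_add distrib_left[of "2::int"] texp_eq; simp add: algebra_simps)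
    then show "?e (?h 0 m) = (case m of (m, n) \<Rightarrow> texp 3 7 m + texp 4 6 n)"
      by (simp add: m)
    show "?c (?h 0 m) = (case m of (m, n) \<Rightarrow> (- 1) ^ nat \<bar>m\<bar> * (- 1) ^ nat \<bar>n\<bar>)"
      unfolding m prod.case c1 c2 sign_power_abs_minus using c by auto
  qed
  also have "lsum UNIV (\<lambda>m. ?e (?h 1 m)) (\<lambda>m. ?c (?h 1 m)) =
      lsum UNIV (\<lambda>m. 1 + (\<lambda>(m, n). texp 8 2 m + texp 9 1 n) m) (\<lambda>m. c * (\<lambda>(m, n). (- 1) ^ nat \<bar>m\<bar> * (- 1) ^ nat \<bar>n\<bar>) m)"
  proof (intro lsum_cong refl)
    fix m :: "int \<times> int"
    obtain a b where m: "m = (a, b)" by force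
    have "texp 1 4 (a + b + 1) + texp 2 3 (a - b) = 1 + (texp 8 2 a + texp 9 1 b)"
      by (rule of_nat_double_cancel) (simp only: of_nat_add distrib_left[of "2::int"] texp_eq; simp add: algebra_simps)
    then show "?e (?h 1 m) = 1 + (case m of (m, n) \<Rightarrow> texp 8 2 m + texp 9 1 n)"
      by (simp add: m)
    show "?c (?h 1 m) = c * (case m of (m, n) \<Rightarrow> (- 1) ^ nat \<bar>m\<bar> * (- 1) ^ nat \<bar>n\<bar>)"
      unfolding m prod.case c1 c2 sign_power_abs_minus using c by auto
  qed
  also have "\<dots> = fps_const c * (fps_X * (theta (- 1) 8 2 * theta (- 1) 9 1))"
    unfolding lsum_const_mult lsum_X_power by (subst theta_mult) simp_all
  finally show ?thesis .
qed

text \<open>Read (A, B) as a Gaussian integer: r = 0 is an ideal of norm 5, r = 1 its translate by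
  1, and r = 2, 3, 4 are the images of that translate under quarter turns, on which A^2 + B^2 takes
  the same values. The residue of A - 2 B mod 5 tells the five cosets apart.\<close>

lemma bij_betw_mod_5_plane:
  defines "h \<equiv> \<lambda>(r::nat) (a::int, b::int). if r = 0 then (2 * a + b, a - 2 * b)
      else if r = 1 then (2 * a + b + 1, a - 2 * b) else if r = 2 then (2 * b - a, 2 * a + b + 1)
      else if r = 3 then (- (2 * a + b + 1), 2 * b - a) else (a - 2 * b, - (2 * a + b + 1))"
  shows "bij_betw (\<lambda>(r, m). h r m) ({0, 1, 2, 3, 4} \<times> UNIV) UNIV"
proof (rule bij_betw_imageI)
  show "inj_on (\<lambda>(r, m). h r m) ({0, 1, 2, 3, 4} \<times> UNIV)"
  proof (intro inj_onI, clarify)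
    fix r r' :: nat and a b a' b' :: int
    assume r: "r \<in> {0, 1, 2, 3, 4}" "r' \<in> {0, 1, 2, 3, 4}" and eq: "h r (a, b) = h r' (a', b')"
    define res :: "nat \<Rightarrow> int" where
      "res = (\<lambda>r. if r = 0 then 0 else if r = 1 then 1 else if r = 2 then 3 else if r = 3 then 4 else 2)"
    have res: "(fst (h r (a, b)) - 2 * snd (h r (a, b))) mod 5 = res r" if "r \<in> {0, 1, 2, 3, 4}" for r a b
    proof -
      have "fst (h r (a, b)) - 2 * snd (h r (a, b)) = res r +
          5 * (if r = 0 \<or> r = 1 then b else if r = 2 \<or> r = 3 then - a * of_bool (r = 2) - b * of_bool (r = 3) - 1 else a)"
        using that by (auto simp: h_def res_def)
      moreover have "0 \<le> res r" "res r < 5"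
        by (auto simp: res_def)
      ultimately show ?thesis
        by simp
    qed
    have "res r = res r'"
      using res[OF r(1), of a b] res[OF r(2), of a' b'] eq by simp
    then have "r = r'"
      using r by (auto simp: res_def)
    then show "r = r' \<and> (a, b) = (a', b')"
      using r eq by (auto simp: h_def)
  qed
  have ex: "\<exists>r\<in>{0, 1, 2, 3, 4}. \<exists>a b. h r (a, b) = (A, B)" for A B
  proof -
    define k where "k = (A - 2 * B) mod 5"
    define d where "d = (A - 2 * B) div 5"
    have A: "A = 2 * B + 5 * d + k"
      by (simp add: k_def d_def)
    have "k \<in> {0, 1, 2, 3, 4}"
      unfolding k_def using pos_mod_sign[of 5 "A - 2 * B"] pos_mod_bound[of 5 "A - 2 * B"] by auto
    then consider "k = 0" | "k = 1" | "k = 2" | "k = 3" | "k = 4"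
      by auto
    then show ?thesis
    proof cases
      case 1
      then have "h 0 (B + 2 * d, d) = (A, B)"
        using A by (simp add: h_def)
      then show ?thesis by blast
    next
      case 2
      then have "h 1 (B + 2 * d, d) = (A, B)"
        using A by (simp add: h_def)
      then show ?thesis by blast
    next
      case 3
      define b where "b = - B - 2 * d - 1"
      have "h 4 (A + 2 * b, b) = (A, B)"
        using A 3 by (simp add: h_def b_def)
      then show ?thesis by blast
    next
      case 4
      define b where "b = B + 2 * d + 1"
      have "h 2 (2 * b - A, b) = (A, B)"
        using A 4 by (simp add: h_def b_def)
      then show ?thesis by blast
    next
      case 5
      define b where "b = - d - 1"
      have "h 3 (2 * b - B, b) = (A, B)"
        using A 5 by (simp add: h_def b_def)
      then show ?thesis by blast
    qed
  qed
  have "p \<in> (\<lambda>(r, m). h r m) ` ({0, 1, 2, 3, 4} \<times> UNIV)" for p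
  proof -
    obtain m n where "p = (m, n)"
      by force
    then obtain r a b where "r \<in> {0, 1, 2, 3, 4}" "h r (a, b) = p"
      using ex[of m n] by blast
    then show ?thesis
      by (intro image_eqI[of _ _ "(r, (a, b))"]) auto
  qed
  then show "(\<lambda>(r, m). h r m) ` ({0, 1, 2, 3, 4} \<times> UNIV) = UNIV"
    by blast
qed

lemma int_texp_1_1: "int (texp 1 1 n) = n * n"
  using texp_eq[of 1 1 n] by (simp add: algebra_simps)

text \<open>The left side is the sum of (-1)^(A+B) q^(A^2+B^2). On the ideal of norm 5 the form is 5
  (a^2 + b^2); the four other cosets are rotations of one another and give four equal
  series.\<close>

lemma phi_square_mod_5:
  "theta (- 1) 1 1 ^ 2 = (theta (- 1) 1 1 oo fps_X ^ 5) ^ 2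
    - 4 * (fps_X * (theta (- 1) 9 1 * theta (- 1) 7 3))"
proof -
  let ?e = "\<lambda>(m, n). texp 1 1 m + texp 1 1 n"
  let ?c = "\<lambda>(m, n). (- 1) ^ nat \<bar>m\<bar> * (- 1 :: complex) ^ nat \<bar>n\<bar>"
  define h where "h = (\<lambda>(r::nat) (a::int, b::int). if r = 0 then (2 * a + b, a - 2 * b)
      else if r = 1 then (2 * a + b + 1, a - 2 * b) else if r = 2 then (2 * b - a, 2 * a + b + 1)
      else if r = 3 then (- (2 * a + b + 1), 2 * b - a) else (a - 2 * b, - (2 * a + b + 1)))"
  define s where "s = (\<lambda>r. lsum UNIV (\<lambda>m. ?e (h r m)) (\<lambda>m. ?c (h r m)))"
  have "theta (- 1) 1 1 ^ 2 = lsum UNIV ?e ?c"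
    unfolding power2_eq_square by (rule theta_mult) auto
  also have "\<dots> = (\<Sum>r\<in>{0, 1, 2, 3, 4}. s r)"
    unfolding s_def
    by (rule lsum_decompose[OF _ bij_betw_mod_5_plane[folded h_def]]) (auto intro!: finite_fibres_texp2)
  finally have "theta (- 1) 1 1 ^ 2 = s 0 + s 1 + s 2 + s 3 + s 4"
    by simp
  moreover have "s 0 = theta (- 1) 1 1 ^ 2 oo fps_X ^ 5"
  proof -
    have "s 0 = lsum UNIV (\<lambda>m. 5 * ?e m) ?c"
      unfolding s_def
    proof (intro lsum_cong refl)
      fix m :: "int \<times> int"
      obtain a b where m: "m = (a, b)" by force
      have "int (?e (h 0 m)) = int (5 * ?e m)"
        by (simp add: int_texp_1_1 m h_def algebra_simps del: One_nat_def)
      then show "?e (h 0 m) = 5 * ?e m"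
        by linarith
      show "?c (h 0 m) = ?c m"
        unfolding m h_def by (auto simp: sign_power_abs_minus)
    qed
    also have "\<dots> = theta (- 1) 1 1 ^ 2 oo fps_X ^ 5"
      unfolding power2_eq_square by (subst theta_mult) (auto simp: lsum_compose)
    finally show ?thesis .
  qed
  moreover have "s r = - (fps_X * (theta (- 1) 9 1 * theta (- 1) 7 3))" if "r \<in> {1, 2, 3, 4}" for r
  proof -
    let ?d = "\<lambda>(m, n). texp 9 1 m + texp 7 3 n"
    have "s r = lsum UNIV (\<lambda>m. 1 + ?d m) (\<lambda>m. - 1 * ?c m)"
      unfolding s_def
    proof (intro lsum_cong refl)
      fix m :: "int \<times> int"
      obtain a b where m: "m = (a, b)" by force
      have d: "2 * int (1 + ?d m) = 2 + (9 * (a * (a + 1)) + 1 * (a * (a - 1))) + (7 * (b * (b + 1)) + 3 * (b * (b - 1)))"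
        using texp_eq[of 9 1 a] texp_eq[of 7 3 b] by (simp add: m)
      have "2 * int (?e (h r m)) = 2 * int (1 + ?d m)"
        using that unfolding d unfolding m
        by (auto simp: h_def int_texp_1_1 algebra_simps simp del: One_nat_def)
      then show "?e (h r m) = 1 + ?d m"
        by (rule of_nat_double_cancel)
      show "?c (h r m) = - 1 * ?c m"
        using that unfolding m h_def by (auto simp: sign_power_abs_minus)
    qed
    also have "\<dots> = - (fps_X * (theta (- 1) 9 1 * theta (- 1) 7 3))"
      unfolding lsum_const_mult lsum_X_power by (subst theta_mult) (simp_all flip: fps_const_neg)
    finally show ?thesis .
  qed
  ultimately show ?thesis
    by (simp add: fps_compose_power mult_ac)
qed

section \<open>The 5-dissections of phi(-q) and psi(q)\<close>

lemma bij_betw_mod_5_int: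
  "bij_betw (\<lambda>(r, m). 5 * m + r) ({-2, -1, 0, 1, 2} \<times> UNIV) (UNIV :: int set)"
proof (rule bij_betw_byWitness[where f' = "\<lambda>n. ((n + 2) mod 5 - 2, (n + 2) div 5)"])
  show "\<forall>n\<in>(UNIV :: int set). (\<lambda>(r, m). 5 * m + r) ((n + 2) mod 5 - 2, (n + 2) div 5) = n"
    by (simp, presburger)
  have "(n + 2) mod 5 - 2 \<in> {-2, -1, 0, 1, 2}" for n :: int
    using pos_mod_sign[of 5 "n + 2"] pos_mod_bound[of 5 "n + 2"] by auto
  then show "(\<lambda>n. ((n + 2) mod 5 - 2, (n + 2) div 5)) ` UNIV \<subseteq> {-2, -1, 0, 1, 2} \<times> (UNIV :: int set)"
    by blast
qed auto

lemma phi_dissection: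
  "theta (- 1) 1 1 = (theta (- 1) 1 1 oo fps_X ^ 25) - 2 * (fps_X * (theta (- 1) 3 7 oo fps_X ^ 5))
    + 2 * (fps_X ^ 4 * (theta (- 1) 1 9 oo fps_X ^ 5))"
proof -
  define s where "s = (\<lambda>r. lsum UNIV (\<lambda>m. texp 1 1 (5 * m + r)) (\<lambda>m. (- 1 :: complex) ^ nat \<bar>5 * m + r\<bar>))"
  have "theta (- 1) 1 1 = (\<Sum>r\<in>{-2, -1, 0, 1, 2}. s r)"
    unfolding s_def theta_def
    by (rule lsum_decompose[OF _ bij_betw_mod_5_int]) (auto intro: finite_fibres_texp)
  moreover have piece: "s r = fps_const d * (fps_X ^ k * (theta (- 1) i j oo fps_X ^ l))"
    if l: "l > 0" and e: "\<And>m. texp 1 1 (5 * m + r) = k + l * texp i j m"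
      and d: "\<And>m. (- 1) ^ nat \<bar>5 * m + r\<bar> = d * (- 1) ^ nat \<bar>m\<bar>" for r d k i j l
    unfolding s_def e d theta_def lsum_const_mult lsum_X_power lsum_compose[OF l] ..
  have "s (-2) = fps_const 1 * (fps_X ^ 4 * (theta (- 1) 1 9 oo fps_X ^ 5))"
  proof (rule piece)
    show "texp 1 1 (5 * m + - 2) = 4 + 5 * texp 1 9 m" for m
      by (rule texp_eq_addI) (simp add: algebra_simps)
  qed (auto simp: sign_power_abs_minus)
  moreover have "s (-1) = fps_const (- 1) * (fps_X ^ 1 * (theta (- 1) 3 7 oo fps_X ^ 5))"
  proof (rule piece)
    show "texp 1 1 (5 * m + - 1) = 1 + 5 * texp 3 7 m" for m
      by (rule texp_eq_addI) (simp add: algebra_simps)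
  qed (auto simp: sign_power_abs_minus)
  moreover have "s 0 = fps_const 1 * (fps_X ^ 0 * (theta (- 1) 1 1 oo fps_X ^ 25))"
  proof (rule piece)
    show "texp 1 1 (5 * m + 0) = 0 + 25 * texp 1 1 m" for m
      by (rule texp_eq_addI) (simp add: algebra_simps)
  qed (auto simp: sign_power_abs_minus)
  moreover have "s 1 = fps_const (- 1) * (fps_X ^ 1 * (theta (- 1) 7 3 oo fps_X ^ 5))"
  proof (rule piece)
    show "texp 1 1 (5 * m + 1) = 1 + 5 * texp 7 3 m" for m
      by (rule texp_eq_addI) (simp add: algebra_simps)
  qed (auto simp: sign_power_abs_minus)
  moreover have "s 2 = fps_const 1 * (fps_X ^ 4 * (theta (- 1) 9 1 oo fps_X ^ 5))"
  proof (rule piece)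
    show "texp 1 1 (5 * m + 2) = 4 + 5 * texp 9 1 m" for m
      by (rule texp_eq_addI) (simp add: algebra_simps)
  qed (auto simp: sign_power_abs_minus)
  ultimately show ?thesis
    by (simp add: theta_commute[of _ 7 3] theta_commute[of _ 9 1] algebra_simps del: One_nat_def flip: fps_const_neg)
qed

text \<open>Over all integers every triangular number is met twice, by n and -1 - n; even and odd n
  each give Ramanujan's psi(q).\<close>

lemma psi_eq: "lsum UNIV (texp 1 0) (\<lambda>_. 1) = 2 * theta 1 1 3"
proof -
  have fin: "finite_fibres UNIV (texp 1 0)"
    by (rule finite_fibres_texp_1_0)
  have "lsum UNIV (texp 1 0) (\<lambda>_. 1) = (\<Sum>r\<in>{0, 1}. lsum UNIV (\<lambda>m. texp 1 0 (2 * m - r)) (\<lambda>_. 1))"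
    by (rule lsum_decompose[where h = "\<lambda>r m. 2 * m - r", OF _ _ fin])
       (auto intro!: bij_betw_byWitness[where f' = "\<lambda>n. (n mod 2, (n + 1) div 2)"], presburger+)
  moreover have "texp 1 0 (2 * m - 0) = texp 3 1 m" "texp 1 0 (2 * m - 1) = texp 1 3 m" for m
    by (rule texp_eqI; simp add: texp_eq algebra_simps)+
  ultimately show ?thesis
    using theta_commute[of 1 3 1] by (simp add: theta_def del: One_nat_def)
qed

text \<open>The doubled series over all n is split by n mod 5, and the factor 2 is cancelled at the
  end. The classes of -2 and 1, and those of -1 and 0, give equal pieces; the class of 2 returns the
  series itself at q^25.\<close>

lemma psi_dissection:
  "theta 1 1 3 = fps_X ^ 3 * (theta 1 1 3 oo fps_X ^ 25) + (theta 1 2 3 oo fps_X ^ 5)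
    + fps_X * (theta 1 1 4 oo fps_X ^ 5)"
proof -
  define P where "P = lsum UNIV (texp 1 0) (\<lambda>_. 1 :: complex)"
  define s where "s = (\<lambda>r. lsum UNIV (\<lambda>m. texp 1 0 (5 * m + r)) (\<lambda>m. 1 :: complex))"
  have "P = (\<Sum>r\<in>{-2, -1, 0, 1, 2}. s r)"
    unfolding s_def P_def
    by (rule lsum_decompose[OF _ bij_betw_mod_5_int finite_fibres_texp_1_0]) simp
  moreover have piece: "s r = fps_X ^ k * (lsum UNIV (texp i j) (\<lambda>_. 1) oo fps_X ^ l)"
    if l: "l > 0" and e: "\<And>m. texp 1 0 (5 * m + r) = k + l * texp i j m" for r k i j l
    unfolding s_def e lsum_X_power lsum_compose[OF l] ..
  have th: "lsum UNIV (texp i j) (\<lambda>_. 1) = theta 1 i j" for i j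
    by (simp add: theta_def)
  have "s (-2) = fps_X ^ 1 * (theta 1 1 4 oo fps_X ^ 5)"
    unfolding th[symmetric]
  proof (rule piece)
    show "texp 1 0 (5 * m + - 2) = 1 + 5 * texp 1 4 m" for m
      by (rule texp_eq_addI) (simp add: algebra_simps)
  qed auto
  moreover have "s (-1) = fps_X ^ 0 * (theta 1 2 3 oo fps_X ^ 5)"
    unfolding th[symmetric]
  proof (rule piece)
    show "texp 1 0 (5 * m + - 1) = 0 + 5 * texp 2 3 m" for m
      by (rule texp_eq_addI) (simp add: algebra_simps)
  qed auto
  moreover have "s 0 = fps_X ^ 0 * (theta 1 3 2 oo fps_X ^ 5)"
    unfolding th[symmetric]
  proof (rule piece)
    show "texp 1 0 (5 * m + 0) = 0 + 5 * texp 3 2 m" for m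
      by (rule texp_eq_addI) (simp add: algebra_simps)
  qed auto
  moreover have "s 1 = fps_X ^ 1 * (theta 1 4 1 oo fps_X ^ 5)"
    unfolding th[symmetric]
  proof (rule piece)
    show "texp 1 0 (5 * m + 1) = 1 + 5 * texp 4 1 m" for m
      by (rule texp_eq_addI) (simp add: algebra_simps)
  qed auto
  moreover have "s 2 = fps_X ^ 3 * (P oo fps_X ^ 25)"
    unfolding P_def
  proof (rule piece)
    show "texp 1 0 (5 * m + 2) = 3 + 25 * texp 1 0 m" for m
      by (rule texp_eq_addI) (simp add: algebra_simps)
  qed auto
  ultimately have "P = fps_X ^ 3 * (P oo fps_X ^ 25) + 2 * ((theta 1 2 3 oo fps_X ^ 5) + fps_X * (theta 1 1 4 oo fps_X ^ 5))"
    by (simp add: theta_commute[of _ 3 2] theta_commute[of _ 4 1] algebra_simps del: One_nat_def)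
  moreover have "P = 2 * theta 1 1 3"
    unfolding P_def by (rule psi_eq)
  moreover have "(2 * theta 1 1 3) oo fps_X ^ 25 = 2 * (theta 1 1 3 oo fps_X ^ 25)"
    by (simp add: fps_eq_iff fps_nth_compose_X_power fps_numeral_fps_const)
  ultimately have "2 * theta 1 1 3 = 2 * (fps_X ^ 3 * (theta 1 1 3 oo fps_X ^ 25) + (theta 1 2 3 oo fps_X ^ 5)
      + fps_X * (theta 1 1 4 oo fps_X ^ 5))"
    by (simp add: algebra_simps)
  then show ?thesis
    by (simp only: mult_cancel_left) simp
qed

section \<open>Infinite products modulo 10\<close>

abbreviation qX :: "nat \<Rightarrow> nat \<Rightarrow> complex fps" where
  "qX i m \<equiv> qpoch_inf (fps_X ^ i) (fps_X ^ m)"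

lemma qX_nonzero [simp]: "i > 0 \<Longrightarrow> m > 0 \<Longrightarrow> qX i m \<noteq> 0"
  by (rule qpoch_inf_nonzero) auto

lemma qX_nth_0 [simp]: "i > 0 \<Longrightarrow> m > 0 \<Longrightarrow> fps_nth (qX i m) 0 = 1"
  by (rule qpoch_inf_nth_0) auto

lemma qX1_nonzero [simp]: "m > 0 \<Longrightarrow> qpoch_inf fps_X ((fps_X :: complex fps) ^ m) \<noteq> 0"
  by (rule qpoch_inf_nonzero) auto

lemma prod_lessThan_2: "(\<Prod>j<2. f (j::nat)) = f 0 * f 1"
  by (simp add: numeral_2_eq_2)

lemma qX_split2:
  assumes "i > 0" "m > 0"
  shows "qX i m = qX i (m * 2) * qX (i + m) (m * 2)"
  using qpoch_inf_split[of "fps_X ^ i" "fps_X ^ m" 2] assms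
  by (simp add: numeral_2_eq_2 flip: power_add power_mult)

lemma qX_mult_minus:
  assumes "i > 0" "m > 0"
  shows "qX i m * qpoch_inf (- (fps_X ^ i)) (fps_X ^ m) = qX (2 * i) (2 * m)"
  using qpoch_inf_mult_minus[of "fps_X ^ i" "fps_X ^ m"] assms
  by (simp add: mult.commute flip: power_mult)

lemma theta_minus_eq:
  "i \<ge> 1 \<Longrightarrow> j \<ge> 1 \<Longrightarrow> theta (- 1) i j = qX i (i + j) * qX j (i + j) * qX (i + j) (i + j)"
  by (subst jacobi_triple_product) (simp_all flip: fps_const_neg)

lemma theta_plus_eq:
  "i \<ge> 1 \<Longrightarrow> j \<ge> 1 \<Longrightarrow> theta 1 i j = qpoch_inf (- (fps_X ^ i)) (fps_X ^ (i + j))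
    * qpoch_inf (- (fps_X ^ j)) (fps_X ^ (i + j)) * qX (i + j) (i + j)"
  by (subst jacobi_triple_product) simp_all

text \<open>Pairing the two signs turns the factors 1 + q^m into factors 1 - q^(2m), so that only
  products \<open>qX\<close> remain.\<close>

lemma theta_plus_mult_minus:
  assumes "i \<ge> 1" "j \<ge> 1"
  shows "theta 1 i j * theta (- 1) i j
    = qX (2 * i) (2 * (i + j)) * qX (2 * j) (2 * (i + j)) * qX (i + j) (i + j) ^ 2"
proof -
  have "theta 1 i j * theta (- 1) i j = (qX i (i + j) * qpoch_inf (- (fps_X ^ i)) (fps_X ^ (i + j)))
      * (qX j (i + j) * qpoch_inf (- (fps_X ^ j)) (fps_X ^ (i + j))) * qX (i + j) (i + j) ^ 2"
    unfolding theta_plus_eq[OF assms] theta_minus_eq[OF assms] by (simp only: power2_eq_square mult_ac)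
  then show ?thesis
    using qX_mult_minus[of i "i + j"] qX_mult_minus[of j "i + j"] assms by simp
qed

lemma theta_compose: "m > 0 \<Longrightarrow> theta c i j oo fps_X ^ m = theta c (m * i) (m * j)"
  unfolding theta_def lsum_compose[symmetric]
  by (rule lsum_cong) (auto intro!: texp_eqI[symmetric] simp: texp_eq algebra_simps)

lemma phi_product: "m > 0 \<Longrightarrow> theta (- 1) m m = qX m (2 * m) ^ 2 * qX (2 * m) (2 * m)"
  by (subst theta_minus_eq) (auto simp: power2_eq_square mult_2)

lemma psi_product:
  assumes "m > 0"
  shows "theta 1 m (3 * m) * qX m (2 * m) = qX (2 * m) (2 * m)"
proof -
  have a: "fps_nth (- ((fps_X :: complex fps) ^ m)) 0 = 0" "fps_nth ((fps_X :: complex fps) ^ (2 * m)) 0 = 0"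
    using assms by auto
  have "qpoch_inf (- (fps_X ^ m)) (fps_X ^ (2 * m))
      = qpoch_inf (- (fps_X ^ m)) (fps_X ^ (4 * m)) * qpoch_inf (- (fps_X ^ (3 * m))) ((fps_X :: complex fps) ^ (4 * m))"
  proof -
    have "- (fps_X ^ m) * fps_X ^ (2 * m) = - ((fps_X :: complex fps) ^ (3 * m))"
      "(fps_X ^ (2 * m)) ^ 2 = (fps_X :: complex fps) ^ (4 * m)"
      by (simp_all flip: power_add power_mult)
    then show ?thesis
      using qpoch_inf_split[OF a, of 2] by (simp only: prod_lessThan_2 power_0 power_one_right mult_1_right)
  qed
  moreover have "qX (2 * m) (2 * m) = qX (2 * m) (4 * m) * qX (4 * m) (4 * m)"
    using qX_split2[of "2 * m" "2 * m"] assms by (simp add: mult.commute)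
  ultimately show ?thesis
    using qX_mult_minus[of m "2 * m"] assms by (subst theta_plus_eq) (auto simp: mult_ac)
qed

definition u1 where "u1 = qX 1 10 * qX 9 10"
definition u2 where "u2 = qX 2 10 * qX 8 10"
definition u3 where "u3 = qX 3 10 * qX 7 10"
definition u4 where "u4 = qX 4 10 * qX 6 10"
definition v5 where "v5 = qX 5 10"
definition J10 where "J10 = qX 10 10"

lemmas level10_defs = u1_def u2_def u3_def u4_def v5_def J10_def

lemma level10_nonzero: "u1 \<noteq> 0" "u2 \<noteq> 0" "u3 \<noteq> 0" "u4 \<noteq> 0" "v5 \<noteq> 0" "J10 \<noteq> 0"
  by (simp_all add: level10_defs)

lemma level10_nth_0:
  "fps_nth u1 0 = 1" "fps_nth u2 0 = 1" "fps_nth u3 0 = 1" "fps_nth u4 0 = 1" "fps_nth v5 0 = 1" "fps_nth J10 0 = 1"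
  by (simp_all add: level10_defs fps_mult_nth_0)

lemma theta_level10:
  "theta (- 1) 9 1 = u1 * J10" "theta (- 1) 8 2 = u2 * J10"
  "theta (- 1) 3 7 = u3 * J10" "theta (- 1) 7 3 = u3 * J10" "theta (- 1) 4 6 = u4 * J10"
  "theta (- 1) 1 4 = u1 * u4 * v5 * J10" "theta (- 1) 2 3 = u2 * u3 * v5 * J10"
  "theta 1 1 4 * (u1 * u4) = u2 * v5 * J10" "theta 1 2 3 * (u2 * u3) = u4 * v5 * J10"
  "theta (- 1) 5 5 = v5\<^sup>2 * J10" "theta 1 5 15 * v5 = J10"
proof -
  have J: "qX 5 5 = v5 * J10"
    using qX_split2[of 5 5] by (simp add: level10_defs)
  show *: "theta (- 1) 1 4 = u1 * u4 * v5 * J10" "theta (- 1) 2 3 = u2 * u3 * v5 * J10"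
    using qX_split2[of 1 5] qX_split2[of 4 5] qX_split2[of 2 5] qX_split2[of 3 5] J
    by (simp_all add: theta_minus_eq level10_defs mult_ac)
  have "theta 1 1 4 * (u1 * u4) * (v5 * J10) = u2 * v5 * J10 * (v5 * J10)"
    using theta_plus_mult_minus[of 1 4] J * by (simp add: level10_defs power2_eq_square mult_ac)
  then show "theta 1 1 4 * (u1 * u4) = u2 * v5 * J10"
    using level10_nonzero by simp
  have "theta 1 2 3 * (u2 * u3) * (v5 * J10) = u4 * v5 * J10 * (v5 * J10)"
    using theta_plus_mult_minus[of 2 3] J * by (simp add: level10_defs power2_eq_square mult_ac)
  then show "theta 1 2 3 * (u2 * u3) = u4 * v5 * J10"
    using level10_nonzero by simp
  show "theta (- 1) 5 5 = v5\<^sup>2 * J10" "theta 1 5 15 * v5 = J10"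
    using phi_product[of 5] psi_product[of 5] by (simp_all add: level10_defs)
qed (simp_all add: theta_minus_eq level10_defs mult_ac)

text \<open>With k = q \<open>u1\<close> \<open>u2\<close> / (\<open>u3\<close> \<open>u4\<close>),
  this and \<open>kappa_minus\<close> express 1 + k and 1 - k as products. The sum on the left is
  the right side of \<open>theta_product_mod_5\<close> at c = 1 (at c = -1 for
  \<open>kappa_minus\<close>), and the triple product factors the other side.\<close>

lemma kappa_plus: "(u3 * u4 + fps_X * (u1 * u2)) * (u1 * u4) = u2\<^sup>2 * u3 * v5\<^sup>2"
proof -
  have "J10\<^sup>2 * ((u3 * u4 + fps_X * (u1 * u2)) * (u1 * u4)) = theta 1 1 4 * (u1 * u4) * theta (- 1) 2 3"
  proof -
    have "theta 1 1 4 * theta (- 1) 2 3 = J10\<^sup>2 * (u3 * u4 + fps_X * (u1 * u2))"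
      using theta_product_mod_5[of 1] unfolding theta_level10(1-5)
      by (simp add: power2_eq_square algebra_simps del: One_nat_def)
    then have "J10\<^sup>2 * (u3 * u4 + fps_X * (u1 * u2)) * (u1 * u4) = theta 1 1 4 * theta (- 1) 2 3 * (u1 * u4)"
      by (simp only:)
    then show ?thesis
      by (simp only: mult_ac)
  qed
  also have "\<dots> = J10\<^sup>2 * (u2\<^sup>2 * u3 * v5\<^sup>2)"
    unfolding theta_level10 by (simp add: power2_eq_square mult_ac)
  finally show ?thesis
    using level10_nonzero by simp
qed

lemma kappa_minus: "(u3 * u4 - fps_X * (u1 * u2)) * (u2 * u3) = u1 * u4\<^sup>2 * v5\<^sup>2"
proof -
  have "J10\<^sup>2 * ((u3 * u4 - fps_X * (u1 * u2)) * (u2 * u3)) = theta (- 1) 1 4 * (theta 1 2 3 * (u2 * u3))"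
  proof -
    have "theta (- 1) 1 4 * theta 1 2 3 = J10\<^sup>2 * (u3 * u4 - fps_X * (u1 * u2))"
      using theta_product_mod_5[of "-1"] unfolding theta_level10(1-5)
      by (simp add: power2_eq_square algebra_simps del: One_nat_def flip: fps_const_neg)
    then show ?thesis
      by (simp only: mult.assoc [symmetric])
  qed
  also have "\<dots> = J10\<^sup>2 * (u1 * u4\<^sup>2 * v5\<^sup>2)"
    unfolding theta_level10 by (simp add: power2_eq_square mult_ac)
  finally show ?thesis
    using level10_nonzero by simp
qed

section \<open>Laurent series and the operator \<open>U\<^sub>5\<close>\<close>

definition V5 :: "complex fls \<Rightarrow> complex fls" where
  "V5 f = fls_compose_power f 5"

lemma V5_simps [simp]:
  "V5 (f + g) = V5 f + V5 g" "V5 (f - g) = V5 f - V5 g" "V5 (- f) = - V5 f" "V5 (f * g) = V5 f * V5 g"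
  "V5 (f ^ n) = V5 f ^ n" "V5 0 = 0" "V5 1 = 1"
  by (simp_all add: V5_def)

lemma V5_nth: "fls_nth (V5 f) n = (if 5 dvd n then fls_nth f (n div 5) else 0)"
  by (simp add: V5_def fls_nth_compose_power)

definition U5 :: "complex fls \<Rightarrow> complex fls" where
  "U5 f = Abs_fls (\<lambda>n. fls_nth f (5 * n))"

lemma U5_nth [simp]: "fls_nth (U5 f) n = fls_nth f (5 * n)"
  unfolding U5_def
  by (rule nth_Abs_fls_lower_bound[of "- \<bar>fls_subdegree f\<bar>"]) (auto intro!: fls_eq0_below_subdegree)

lemma V5_numeral [simp]: "V5 (numeral k) = numeral k"
  using fls_compose_power_const_left[of 5 "numeral k :: complex"] by (simp add: V5_def)

lemma V5_eq_0_iff [simp]: "V5 f = 0 \<longleftrightarrow> f = 0"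
proof
  assume *: "V5 f = 0"
  show "f = 0"
  proof (rule fls_eqI)
    fix n
    have "fls_nth (V5 f) (5 * n) = fls_nth f n"
      by (simp add: V5_nth)
    with * show "fls_nth f n = fls_nth 0 n" by simp
  qed
qed simp

lemma V5_divide [simp]: "V5 (f / g) = V5 f / V5 g"
proof (cases "g = 0")
  case False
  then have "V5 (f / g) * V5 g = V5 f"
    by (simp flip: V5_simps(4))
  with False show ?thesis
    by (simp add: field_simps)
qed simp

text \<open>The indeterminate under an opaque name, since the simplifier turns products with
  \<^const>\<open>fls_X\<close> into shifts.\<close>

definition qL :: "complex fls" where "qL = fls_X"

lemma qL_nonzero [simp]: "qL \<noteq> 0"
  by (simp add: qL_def)

lemma V5_qL [simp]: "V5 qL = qL ^ 5"
  by (simp add: V5_def qL_def fls_X_power_conv_shift_1)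

lemma U5_add: "U5 (f + g) = U5 f + U5 g" and U5_diff: "U5 (f - g) = U5 f - U5 g"
  by (rule fls_eqI, simp)+

lemma U5_X_power_V5:
  assumes "r < 5"
  shows "U5 (qL ^ r * V5 f) = (if r = 0 then f else 0)"
proof (rule fls_eqI)
  fix n
  have "5 * n - int r = 5 * (n - 1) + (5 - int r)"
    by simp
  have "\<not> 5 dvd 5 * n - int r" if "r \<noteq> 0"
    using assms that by presburger
  then show "fls_nth (U5 (qL ^ r * V5 f)) n = fls_nth (if r = 0 then f else 0) n"
    by (auto simp: qL_def fls_X_power_times_conv_shift V5_nth)
qed

lemma U5_expansion: "f = (\<Sum>r<(5::nat). qL ^ r * V5 (U5 (fls_shift (int r) f)))"
proof (rule fls_eqI)
  fix n
  have "fls_nth (\<Sum>r<(5::nat). qL ^ r * V5 (U5 (fls_shift (int r) f))) n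
      = (\<Sum>r<(5::nat). if 5 dvd n - int r then fls_nth f n else 0)"
    unfolding fls_nth_sum
    by (intro sum.cong refl) (auto simp: qL_def fls_X_power_times_conv_shift V5_nth)
  also have "\<dots> = (\<Sum>r<(5::nat). if r = nat (n mod 5) then fls_nth f n else 0)"
  proof (intro sum.cong refl)
    fix r :: nat assume "r \<in> {..<5}"
    then have "5 dvd n - int r \<longleftrightarrow> r = nat (n mod 5)"
      by (auto simp: mod_eq_dvd_iff[symmetric] nat_eq_iff)
    then show "(if 5 dvd n - int r then fls_nth f n else 0) = (if r = nat (n mod 5) then fls_nth f n else 0)"
      by simp
  qed
  also have "\<dots> = fls_nth f n"
    by (simp add: nat_less_iff)
  finally show "fls_nth f n = fls_nth (\<Sum>r<(5::nat). qL ^ r * V5 (U5 (fls_shift (int r) f))) n" ..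
qed

lemma U5_sum: "U5 (\<Sum>r\<in>R. f r) = (\<Sum>r\<in>R. U5 (f r))"
  by (rule fls_eqI) (simp add: fls_nth_sum)

text \<open>Series in q^5 are scalars for \<open>U5\<close>: in the expansion of f by residues of
  the exponent, multiplication by \<open>V5 g\<close> respects the residues, and only r = 0
  survives.\<close>

lemma U5_V5_mult: "U5 (V5 g * f) = g * U5 f"
  for f g :: "complex fls"
proof -
  have "U5 (V5 g * f) = U5 (\<Sum>r<(5::nat). qL ^ r * V5 (g * U5 (fls_shift (int r) f)))"
    by (subst U5_expansion[of f]) (simp add: sum_distrib_left mult_ac)
  also have "\<dots> = (\<Sum>r<(5::nat). if r = 0 then g * U5 f else 0)"
    unfolding U5_sum by (intro sum.cong refl) (simp add: U5_X_power_V5 del: V5_simps)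
  finally show ?thesis by simp
qed

lemma U5_V5: "U5 (V5 g) = g"
  using U5_X_power_V5[of 0 g] by simp

section \<open>The parametrization\<close>

definition F2L :: "complex fps \<Rightarrow> complex fls" where "F2L = fps_to_fls"

lemma F2L_eq_iff [simp]: "F2L f = F2L g \<longleftrightarrow> f = g" "F2L f = 0 \<longleftrightarrow> f = 0"
  by (simp_all add: F2L_def)

text \<open>All level 10 functions needed below are rational in \<open>ss\<close>, and \<open>yy\<close> is a fifth root of a rational
  function of \<open>V5 ss\<close> (\<open>yy_power_5\<close>); so 5-dissections are expansions in powers of \<open>yy\<close>.\<close>

definition phi :: "complex fls" where "phi = F2L (theta (- 1) 1 1)"
definition P2 :: "complex fls" where "P2 = F2L (qX 2 2)"
definition ww :: "complex fls" where "ww = F2L u2 / F2L u4"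
definition ss :: "complex fls" where "ss = F2L u1 ^ 2 * F2L u4 ^ 3 / (F2L u2 ^ 3 * F2L u3 ^ 2)"
definition yy :: "complex fls" where "yy = qL ^ 2 * V5 ww"

lemma F2L_simps: "F2L (f * g) = F2L f * F2L g" "F2L (f + g) = F2L f + F2L g" "F2L (f - g) = F2L f - F2L g"
  "F2L (f ^ n) = F2L f ^ n" "F2L fps_X = qL" "F2L (numeral k) = numeral k" "F2L 1 = 1"
  by (simp_all add: F2L_def fls_times_fps_to_fls fps_to_fls_power qL_def)

lemma F2L_compose: "F2L (f oo fps_X ^ 5) = V5 (F2L f)"
  by (simp add: V5_def F2L_def fls_compose_power_fps_to_fls)

lemma F2L_compose_25: "F2L (f oo fps_X ^ 25) = V5 (V5 (F2L f))"
proof -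
  have "f oo fps_X ^ 25 = (f oo fps_X ^ 5) oo fps_X ^ 5"
    by (rule fps_ext) (auto simp: fps_nth_compose_X_power div_mult2_eq dvd_div_iff_mult)
  then show ?thesis
    by (simp add: F2L_compose)
qed

text \<open>With k = q x1 x2 / (x3 x4), dividing \<open>minus\<close> by \<open>plus\<close> shows s
  = (1 - k) / (1 + k); hence 1 + s = 2 / (1 + k) and 1 - s = 2 k / (1 + k), and \<open>plus\<close>
  makes these products.\<close>

lemma kappa_relations:
  fixes x1 x2 x3 x4 v q :: "'a::field_char_0"
  assumes nz: "x1 \<noteq> 0" "x2 \<noteq> 0" "x3 \<noteq> 0" "x4 \<noteq> 0" "v \<noteq> 0" "q \<noteq> 0"
    and plus: "(x3 * x4 + q * (x1 * x2)) * (x1 * x4) = x2\<^sup>2 * x3 * v\<^sup>2"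
    and minus: "(x3 * x4 - q * (x1 * x2)) * (x2 * x3) = x1 * x4\<^sup>2 * v\<^sup>2"
  defines "s \<equiv> x1 ^ 2 * x4 ^ 3 / (x2 ^ 3 * x3 ^ 2)"
  shows "1 + s = 2 * x1 * x4\<^sup>2 / (x2\<^sup>2 * v\<^sup>2)" "1 - s = 2 * q * x1\<^sup>2 * x4 / (x2 * x3 * v\<^sup>2)"
proof -
  have *: "x3 * x4 + q * (x1 * x2) = x2\<^sup>2 * x3 * v\<^sup>2 / (x1 * x4)" "x3 * x4 - q * (x1 * x2) = x1 * x4\<^sup>2 * v\<^sup>2 / (x2 * x3)"
    using plus minus nz by (simp_all add: eq_divide_eq)
  \<comment> \<open>By \<open>plus\<close>, c is the reciprocal of x3 x4 + q x1 x2.\<close>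
  define c where "c = x1 * x4 / (x2\<^sup>2 * x3 * v\<^sup>2)"
  have "1 + s = c * (x2\<^sup>2 * x3 * v\<^sup>2 / (x1 * x4) + x1 * x4\<^sup>2 * v\<^sup>2 / (x2 * x3))"
    using nz by (simp add: s_def c_def field_simps power2_eq_square power3_eq_cube)
  also have "\<dots> = c * (2 * (x3 * x4))"
    unfolding *[symmetric] by simp
  also have "\<dots> = 2 * x1 * x4\<^sup>2 / (x2\<^sup>2 * v\<^sup>2)"
    using nz by (simp add: c_def field_simps power2_eq_square)
  finally show "1 + s = 2 * x1 * x4\<^sup>2 / (x2\<^sup>2 * v\<^sup>2)" .
  have "1 - s = c * (x2\<^sup>2 * x3 * v\<^sup>2 / (x1 * x4) - x1 * x4\<^sup>2 * v\<^sup>2 / (x2 * x3))"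
    using nz by (simp add: s_def c_def field_simps power2_eq_square power3_eq_cube)
  also have "\<dots> = c * (2 * (q * (x1 * x2)))"
    unfolding *[symmetric] by simp
  also have "\<dots> = 2 * q * x1\<^sup>2 * x4 / (x2 * x3 * v\<^sup>2)"
    using nz by (simp add: c_def field_simps power2_eq_square)
  finally show "1 - s = 2 * q * x1\<^sup>2 * x4 / (x2 * x3 * v\<^sup>2)" .
qed

declare level10_nonzero [simp]

lemma F2L_nonzero [simp]: "F2L u1 \<noteq> 0" "F2L u2 \<noteq> 0" "F2L u3 \<noteq> 0" "F2L u4 \<noteq> 0" "F2L v5 \<noteq> 0" "F2L J10 \<noteq> 0"
  using level10_nonzero by simp_all

lemma ss_relations:
  "1 + ss = 2 * F2L u1 * F2L u4 ^ 2 / (F2L u2 ^ 2 * F2L v5 ^ 2)"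
  "1 - ss = 2 * qL * F2L u1 ^ 2 * F2L u4 / (F2L u2 * F2L u3 * F2L v5 ^ 2)"
  unfolding ss_def
  using kappa_relations[of "F2L u1" "F2L u2" "F2L u3" "F2L u4" "F2L v5" qL]
    arg_cong[OF kappa_plus, of F2L] arg_cong[OF kappa_minus, of F2L]
  by (simp_all add: F2L_simps)

lemma ss_nonzero: "ss \<noteq> 0" "1 + ss \<noteq> 0" "1 - ss \<noteq> 0" "ww \<noteq> 0" "yy \<noteq> 0"
  unfolding ss_relations by (simp_all add: ss_def ww_def yy_def)

text \<open>Ramanujan's formula r(q^2)^5 = k^2 (1 + k) / (1 - k) at q^5, with k written in terms of
  \<open>ss\<close>.\<close>

lemma yy_power_5: "yy ^ 5 = V5 ((1 - ss) ^ 2 / (ss * (1 + ss) ^ 2))"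
proof -
  have "qL ^ 2 * ww ^ 5 = (1 - ss) ^ 2 / (ss * (1 + ss) ^ 2)"
    unfolding ss_relations unfolding ss_def ww_def by (simp add: field_simps eval_nat_numeral)
  moreover have "yy ^ 5 = V5 (qL ^ 2 * ww ^ 5)"
    by (simp add: yy_def power_mult_distrib flip: power_mult)
  ultimately show ?thesis by (simp only:)
qed

lemma phi_product_5: "V5 phi = F2L v5 ^ 2 * F2L J10"
  using theta_level10(10) theta_compose[of 5 "-1" 1 1]
  by (simp add: phi_def F2L_simps flip: F2L_compose)

lemma phi_nonzero: "phi \<noteq> 0"
  using phi_product_5 by (metis F2L_nonzero(5,6) V5_eq_0_iff mult_eq_0_iff power_not_zero)

lemma eps_eq: "phi ^ 2 / V5 phi ^ 2 = (ss ^ 2 + ss - 1) / ss"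
proof -
  have "phi ^ 2 = V5 phi ^ 2 - 4 * qL * (F2L u1 * F2L u3 * F2L J10 ^ 2)"
    using arg_cong[OF phi_square_mod_5, of F2L] unfolding theta_level10
    by (simp add: F2L_simps F2L_compose phi_def power2_eq_square mult_ac)
  then have "phi ^ 2 / V5 phi ^ 2 = 1 - 4 * qL * F2L u1 * F2L u3 / F2L v5 ^ 4"
    unfolding phi_product_5 by (simp add: diff_divide_distrib) (simp add: field_simps eval_nat_numeral)
  also have "4 * qL * F2L u1 * F2L u3 / F2L v5 ^ 4 = (1 + ss) * (1 - ss) / ss"
    unfolding ss_relations unfolding ss_def by (simp add: field_simps eval_nat_numeral)
  finally show ?thesis
    using ss_nonzero by (simp add: field_simps power2_eq_square)
qed

lemma phi_dissection_fls:
  "phi / V5 (V5 phi) = 1 - V5 ((1 - ss) / ss) / yy ^ 2 + V5 (1 + ss) * yy ^ 2"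
proof -
  have "phi = V5 (V5 phi) - 2 * qL * V5 (F2L u3 * F2L J10) + 2 * qL ^ 4 * V5 (F2L u1 * F2L J10)"
    using arg_cong[OF phi_dissection, of F2L] theta_level10 theta_commute[of "-1" 1 9]
    by (simp add: F2L_simps F2L_compose F2L_compose_25 phi_def mult_ac)
  then have "phi / V5 (V5 phi) = 1 - 2 * qL * V5 (F2L u3 / F2L v5 ^ 2) + 2 * qL ^ 4 * V5 (F2L u1 / F2L v5 ^ 2)"
    unfolding phi_product_5
    by (simp add: diff_divide_distrib add_divide_distrib) (simp add: field_simps)
  also have "2 * qL * V5 (F2L u3 / F2L v5 ^ 2) = V5 ((1 - ss) / ss) / yy ^ 2"
  proof -
    have "(1 - ss) / ss = 2 * qL * ww ^ 2 * (F2L u3 / F2L v5 ^ 2)"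
      unfolding ss_relations unfolding ss_def ww_def by (simp add: field_simps eval_nat_numeral)
    then have "V5 ((1 - ss) / ss) = V5 (2 * qL * ww ^ 2 * (F2L u3 / F2L v5 ^ 2))"
      by (simp only:)
    also have "\<dots> = 2 * qL * (qL ^ 4 * V5 ww ^ 2) * V5 (F2L u3 / F2L v5 ^ 2)"
      by (simp flip: power_Suc)
    also have "qL ^ 4 * V5 ww ^ 2 = yy ^ 2"
      by (simp add: yy_def power_mult_distrib flip: power_mult)
    finally show ?thesis
      by (simp add: ss_nonzero)
  qed
  also have "2 * qL ^ 4 * V5 (F2L u1 / F2L v5 ^ 2) = V5 (1 + ss) * yy ^ 2"
  proof -
    have "1 + ss = 2 * (F2L u1 / F2L v5 ^ 2) / ww ^ 2"
      unfolding ss_relations ww_def by (simp add: field_simps)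
    then have "V5 (1 + ss) = V5 (2 * (F2L u1 / F2L v5 ^ 2) / ww ^ 2)"
      by (simp only:)
    then show ?thesis
      by (simp add: yy_def power_mult_distrib ss_nonzero flip: power_mult)
  qed
  finally show ?thesis .
qed


definition psi :: "complex fls" where "psi = F2L (theta 1 1 3)"

lemma psi_product_5: "V5 psi = F2L J10 / F2L v5"
proof -
  have "V5 psi * F2L v5 = F2L J10"
    using theta_level10(11) theta_compose[of 5 1 1 3]
    by (simp add: psi_def flip: F2L_compose F2L_simps(1))
  then show ?thesis
    by (simp add: field_simps)
qed

lemma psi_dissection_fls:
  "psi / (qL ^ 3 * V5 (V5 psi)) = 1 + 2 * V5 (1 / (1 + ss)) / yy + 2 * V5 (ss / (1 - ss)) * yy"
proof -
  have th: "F2L (theta 1 2 3) = F2L u4 * F2L v5 * F2L J10 / (F2L u2 * F2L u3)"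
    "F2L (theta 1 1 4) = F2L u2 * F2L v5 * F2L J10 / (F2L u1 * F2L u4)"
    using arg_cong[OF theta_level10(8), of F2L] arg_cong[OF theta_level10(9), of F2L]
    by (simp_all add: F2L_simps eq_divide_eq)
  have "psi = qL ^ 3 * V5 (V5 psi) + V5 (F2L (theta 1 2 3)) + qL * V5 (F2L (theta 1 1 4))"
    using arg_cong[OF psi_dissection, of F2L] by (simp add: F2L_simps F2L_compose F2L_compose_25 psi_def)
  then have "psi / (qL ^ 3 * V5 (V5 psi)) =
      1 + V5 (F2L u4 * F2L v5 ^ 2 / (F2L u2 * F2L u3)) / qL ^ 3
        + V5 (F2L u2 * F2L v5 ^ 2 / (F2L u1 * F2L u4)) / qL ^ 2"
    unfolding psi_product_5 th
    by (simp add: add_divide_distrib) (simp add: field_simps eval_nat_numeral)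
  also have "V5 (F2L u4 * F2L v5 ^ 2 / (F2L u2 * F2L u3)) / qL ^ 3 = 2 * V5 (ss / (1 - ss)) * yy"
  proof -
    have "2 * (ss / (1 - ss)) * ww = (F2L u4 * F2L v5 ^ 2 / (F2L u2 * F2L u3)) / qL"
      unfolding ss_relations unfolding ss_def ww_def by (simp add: field_simps eval_nat_numeral)
    then have "V5 (2 * (ss / (1 - ss)) * ww) = V5 ((F2L u4 * F2L v5 ^ 2 / (F2L u2 * F2L u3)) / qL)"
      by (simp only:)
    then have "2 * V5 (ss / (1 - ss)) * V5 ww = V5 (F2L u4 * F2L v5 ^ 2 / (F2L u2 * F2L u3)) / (qL ^ 3 * qL ^ 2)"
      by (simp flip: power_add)
    then show ?thesis
      by (simp add: yy_def field_simps)
  qed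
  also have "V5 (F2L u2 * F2L v5 ^ 2 / (F2L u1 * F2L u4)) / qL ^ 2 = 2 * V5 (1 / (1 + ss)) / yy"
  proof -
    have "2 * (1 / (1 + ss)) / ww = F2L u2 * F2L v5 ^ 2 / (F2L u1 * F2L u4)"
      unfolding ss_relations ww_def by (simp add: field_simps eval_nat_numeral)
    then have "V5 (2 * (1 / (1 + ss)) / ww) = V5 (F2L u2 * F2L v5 ^ 2 / (F2L u1 * F2L u4))"
      by (simp only:)
    then have h: "2 * V5 (1 / (1 + ss)) / V5 ww = V5 (F2L u2 * F2L v5 ^ 2 / (F2L u1 * F2L u4))"
      by (simp only: V5_divide V5_simps V5_numeral)
    then show ?thesis
      unfolding yy_def by (simp only: divide_divide_eq_left mult.commute h [symmetric])
  qed
  finally show ?thesis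
    by (simp only: add_ac)
qed

lemma P2_cube: "P2 ^ 3 = phi * psi ^ 2"
proof -
  have "theta (- 1) 1 1 * theta 1 1 3 ^ 2 = (theta 1 1 3 * qX 1 2) ^ 2 * qX 2 2"
    using phi_product[of 1] by (simp add: power2_eq_square mult_ac)
  also have "\<dots> = qX 2 2 ^ 3"
    using psi_product[of 1] by (simp add: power2_eq_square power3_eq_cube)
  finally show ?thesis
    by (simp add: P2_def phi_def psi_def flip: F2L_simps(1,4))
qed

lemma P2_nonzero: "P2 \<noteq> 0"
  by (simp add: P2_def)

text \<open>Its reciprocal \<open>beta\<close> is what is left of q^2 / \<open>P2\<close> once a
  series in q^25 is split off, so the powers of \<open>bb\<close> are what \<open>U5\<close> has to
  be computed on.\<close>

definition bb :: "complex fls" where "bb = P2 / (qL ^ 2 * V5 (V5 P2))"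

text \<open>The factors on the left are the shapes of the dissections of phi and psi, the right side
  is the cube of the expected dissection of the Euler product. The explicit polynomial in the proof
  is the cofactor with which \<open>rel\<close> divides the difference of the two sides, cleared of
  denominators.\<close>

lemma cube_identity:
  fixes y s :: "'a::field_char_0"
  assumes nz: "y \<noteq> 0" "s \<noteq> 0" "1 + s \<noteq> 0" "1 - s \<noteq> 0"
    and rel: "y ^ 5 * (s * (1 + s) ^ 2) = (1 - s) ^ 2"
  shows "(1 - ((1 - s) / s) / y ^ 2 + (1 + s) * y ^ 2) * (1 + 2 * (1 / (1 + s)) / y + 2 * (s / (1 - s)) * y) ^ 2
    = (1 / y - 1 - y) ^ 3"
proof -
  define d where "d = s * y ^ 2 - (1 - s) + s * (1 + s) * y ^ 4"
  define p where "p = (1 + s) * (1 - s) * y + 2 * (1 - s) + 2 * s * (1 + s) * y ^ 2"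
  have "y * (1 - y - y ^ 2) ^ 3 * s * (1 + s) ^ 2 * (1 - s) ^ 2 - d * p ^ 2 =
      (- 4 + 4 * s - 4 * y - y * s + 2 * y * s^2 - y * s^3 - y^2 - 2 * y^2 * s - y^2 * s^2 + 4 * y^2 * s^3
       - 4 * y^3 * s^2 - 4 * y^3 * s^3) * (y ^ 5 * (s * (1 + s) ^ 2) - (1 - s) ^ 2)"
    unfolding d_def p_def by algebra
  then have "d * p ^ 2 = y * (1 - y - y ^ 2) ^ 3 * s * (1 + s) ^ 2 * (1 - s) ^ 2"
    using rel by simp
  moreover have "1 - ((1 - s) / s) / y ^ 2 + (1 + s) * y ^ 2 = d / (s * y ^ 2)"
    using nz by (simp add: d_def field_simps eval_nat_numeral)
  moreover have "1 + 2 * (1 / (1 + s)) / y + 2 * (s / (1 - s)) * y = p / (y * (1 + s) * (1 - s))"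
    using nz by (simp add: p_def divide_simps) (simp add: algebra_simps power2_eq_square)
  moreover have "1 / y - 1 - y = (1 - y - y ^ 2) / y"
    using nz by (simp add: field_simps power2_eq_square)
  ultimately show ?thesis
    using nz by (simp add: power_divide power_mult_distrib) (simp add: field_simps eval_nat_numeral)
qed

lemma V5_ss_nonzero: "V5 ss \<noteq> 0" "1 + V5 ss \<noteq> 0" "1 - V5 ss \<noteq> 0"
  using ss_nonzero V5_eq_0_iff[of "1 + ss"] V5_eq_0_iff[of "1 - ss"] by simp_all

lemma yy_relation: "yy ^ 5 * (V5 ss * (1 + V5 ss) ^ 2) = (1 - V5 ss) ^ 2"
  using V5_ss_nonzero unfolding yy_power_5 by simp

text \<open>The constant terms exclude the other cube roots: f^2 + f g + g^2 starts with 3 and is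
  not 0.\<close>

lemma fps_cube_unique:
  fixes f g :: "complex fps"
  assumes "f ^ 3 = g ^ 3" "fps_nth f 0 = 1" "fps_nth g 0 = 1"
  shows "f = g"
proof -
  have "(f - g) * (f * f + f * g + g * g) = 0"
    using assms(1) by (simp add: power3_eq_cube algebra_simps)
  moreover have "fps_nth (f * f + f * g + g * g) 0 = 3"
    using assms by simp
  then have "f * f + f * g + g * g \<noteq> 0"
    by (metis fps_zero_nth zero_neq_numeral)
  ultimately show ?thesis
    by simp
qed

lemma F2L_divide:
  "fps_nth g 0 \<noteq> 0 \<Longrightarrow> F2L f / F2L g = F2L (f * inverse g)"
  by (simp add: F2L_def fls_times_fps_to_fls fls_inverse_fps_to_fls divide_inverse)

text \<open>The classical dissection of the Euler product, at q^2, is reached through the cube: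
  \<open>P2 ^ 3 = phi * psi ^ 2\<close>, and both theta functions are already dissected.
  Multiplication by q^2 turns the two sides into power series f and g with constant term 1, as
  uniqueness of the cube root requires.\<close>

lemma bb_eq: "bb = 1 / yy - 1 - yy"
proof -
  define f where "f = qX 2 2 * inverse (qX 2 2 oo fps_X ^ 25)"
  have nth0: "fps_nth (h oo fps_X ^ m) 0 = fps_nth h 0" for h :: "complex fps" and m
    by (simp add: fps_nth_compose_X_power)
  have f: "F2L f = qL ^ 2 * bb"
    unfolding f_def by (subst F2L_divide[symmetric]) (simp_all add: nth0 bb_def P2_def F2L_compose_25)
  define w where "w = (u2 * inverse u4) oo fps_X ^ 5"
  define w' where "w' = (u4 * inverse u2) oo fps_X ^ 5"
  have w: "F2L w = V5 ww" "F2L w' = V5 (1 / ww)"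
    by (simp_all add: w_def w'_def F2L_compose ww_def F2L_divide[symmetric] level10_nth_0 del: V5_divide)
  define g where "g = w' - fps_X ^ 2 - fps_X ^ 4 * w"
  have g: "F2L g = qL ^ 2 * (1 / yy - 1 - yy)"
    unfolding g_def by (simp add: F2L_simps w yy_def algebra_simps flip: power_add)
  have nth: "fps_nth f 0 = 1" "fps_nth g 0 = 1"
    by (simp_all add: f_def g_def w'_def nth0 level10_nth_0)
  have "bb ^ 3 = (phi / V5 (V5 phi)) * (psi / (qL ^ 3 * V5 (V5 psi))) ^ 2"
  proof -
    have "V5 (V5 P2) ^ 3 = V5 (V5 phi) * V5 (V5 psi) ^ 2"
      using arg_cong[OF P2_cube, of "\<lambda>f. V5 (V5 f)"] by simp
    then show ?thesis
      unfolding bb_def by (simp add: power_divide power_mult_distrib P2_cube flip: power_mult)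
  qed
  also have "\<dots> = (1 / yy - 1 - yy) ^ 3"
    unfolding phi_dissection_fls psi_dissection_fls
    using cube_identity[OF ss_nonzero(5) V5_ss_nonzero yy_relation] by simp
  finally have "F2L f ^ 3 = F2L g ^ 3"
    unfolding f g by (simp only: power_mult_distrib)
  then have "f ^ 3 = g ^ 3"
    by (simp only: F2L_simps(4) [symmetric] F2L_eq_iff)
  then have "f = g"
    using nth by (rule fps_cube_unique)
  then have "qL ^ 2 * bb = qL ^ 2 * (1 / yy - 1 - yy)"
    using f g by simp
  then show ?thesis
    by simp
qed

section \<open>The level 10 function \<open>t\<close>\<close>

definition tt :: "complex fls" where "tt = qL ^ 2 * V5 P2 ^ 6 / P2 ^ 6"
definition ee :: "complex fls" where "ee = phi ^ 2 / V5 phi ^ 2"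

lemma ee_eq: "ee = (ss ^ 2 + ss - 1) / ss"
  unfolding ee_def by (rule eps_eq)

lemma tt_nonzero: "tt \<noteq> 0" and bb_nonzero: "bb \<noteq> 0"
  by (simp_all add: tt_def bb_def P2_nonzero)

lemma tt_V5_tt: "tt * V5 tt * bb ^ 6 = 1"
  unfolding tt_def bb_def using P2_nonzero
  by (simp add: power_divide power_mult_distrib flip: power_mult)

text \<open>Meant for d = \<open>phi / V5 (V5 phi)\<close>, e = \<open>V5 ee\<close> and
  \<open>ee\<close> = d^2 / e: squared, it becomes \<open>RR_ee\<close>, the analogue of
  \<open>tt_V5_tt\<close> for a rational function of \<open>ee\<close>. As in
  \<open>cube_identity\<close>, the long polynomial is the cofactor of \<open>rel\<close>.\<close>

lemma dd_identity:
  fixes y s :: "'a::field_char_0"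
  assumes nz: "y \<noteq> 0" "s \<noteq> 0" and rel: "y ^ 5 * (s * (1 + s) ^ 2) = (1 - s) ^ 2"
  defines "d \<equiv> 1 - ((1 - s) / s) / y ^ 2 + (1 + s) * y ^ 2" and "e \<equiv> (s ^ 2 + s - 1) / s"
  shows "(d ^ 2 - e) * (1 / y - 1 - y) ^ 3 * (e - 1) = d * (d ^ 2 - 5 * e) * (e - 5)"
proof -
  define D where "D = s * y ^ 2 - (1 - s) + s * (1 + s) * y ^ 4"
  define F where "F = s ^ 2 + s - 1"
  have "(D ^ 2 - F * s * y ^ 4) * (1 - y - y ^ 2) ^ 3 * (F - s) * s - D * (D ^ 2 - 5 * F * s * y ^ 4) * (F - 5 * s) * y
    = (s - s^3 + y - 5 * y * s^2 + 4 * y * s^3 - 2 * y^2 * s^2 - 2 * y^2 * s^3 + 2 * y^3 * s - 6 * y^3 * s^2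
      + 4 * y^3 * s^3 - y^4 * s^2 - 2 * y^4 * s^3 - y^4 * s^4 - y^5 * s + 2 * y^5 * s^2 - y^5 * s^3 + 4 * y^6 * s^2
      + 6 * y^6 * s^3 + 2 * y^6 * s^4 + 2 * y^7 * s^2 - 2 * y^7 * s^3 + 4 * y^8 * s^2 + 5 * y^8 * s^3 - y^8 * s^5
      + y^9 * s^2 - y^9 * s^4) * (y ^ 5 * (s * (1 + s) ^ 2) - (1 - s) ^ 2)"
    unfolding D_def F_def by algebra
  then have main: "(D ^ 2 - F * s * y ^ 4) * (1 - y - y ^ 2) ^ 3 * (F - s) * s
      = D * (D ^ 2 - 5 * F * s * y ^ 4) * (F - 5 * s) * y"
    using rel by simp
  have d: "d = D / (s * y ^ 2)" and b: "1 / y - 1 - y = (1 - y - y ^ 2) / y" and e: "e = F / s"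
    using nz by (simp_all add: d_def D_def e_def F_def field_simps eval_nat_numeral)
  have de: "d ^ 2 - e = (D ^ 2 - F * s * y ^ 4) / (s ^ 2 * y ^ 4)"
    "d ^ 2 - 5 * e = (D ^ 2 - 5 * F * s * y ^ 4) / (s ^ 2 * y ^ 4)"
    using nz unfolding d e by (simp_all add: field_simps eval_nat_numeral)
  have e1: "e - 1 = (F - s) / s" "e - 5 = (F - 5 * s) / s"
    using nz by (simp_all add: e field_simps)
  have "(d ^ 2 - e) * (1 / y - 1 - y) ^ 3 * (e - 1)
      = (D ^ 2 - F * s * y ^ 4) * (1 - y - y ^ 2) ^ 3 * (F - s) * s / (s ^ 4 * y ^ 7)"
    "d * (d ^ 2 - 5 * e) * (e - 5) = D * (D ^ 2 - 5 * F * s * y ^ 4) * (F - 5 * s) * y / (s ^ 4 * y ^ 7)"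
    unfolding de e1 unfolding d b using nz by (simp_all add: power_divide divide_simps) (simp_all add: eval_nat_numeral mult_ac)
  then show ?thesis
    by (simp only: main)
qed

definition RR :: "complex fls \<Rightarrow> complex fls" where "RR z = (z - 1) ^ 2 / (z * (z - 5) ^ 2)"

lemma ee_V5_ee: "ee * V5 ee = (phi / V5 (V5 phi)) ^ 2"
  using phi_nonzero by (simp add: ee_def power_divide)

text \<open>In terms of d and e the product in \<open>RR_ee\<close> is the square of the left side
  of \<open>dd_identity\<close> over the square of its right side. That \<open>ee\<close> is not 5
  also comes from there: the left side is nonzero, hence so is every factor on the right.\<close>

lemma ee_nonzero: "ee \<noteq> 0" "ee \<noteq> 1" "ee \<noteq> 5"
  and RR_ee: "RR ee * V5 (RR ee) * bb ^ 6 = 1"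
proof -
  define d where "d = phi / V5 (V5 phi)"
  define e where "e = V5 ee"
  have d: "d = 1 - ((1 - V5 ss) / V5 ss) / yy ^ 2 + (1 + V5 ss) * yy ^ 2"
    unfolding d_def phi_dissection_fls by simp
  have e: "e = (V5 ss ^ 2 + V5 ss - 1) / V5 ss"
    unfolding e_def ee_eq by simp
  have d0: "d \<noteq> 0" and e0: "e \<noteq> 0" and *: "ee \<noteq> 0"
    using phi_nonzero by (simp_all add: d_def e_def ee_def)
  show "ee \<noteq> 0" by fact
  have ee: "ee = d ^ 2 / e"
    using ee_V5_ee e0 unfolding d_def e_def by (intro eq_divide_imp)
  have "ee - 1 = - ((1 + ss) * (1 - ss) / ss)"
    unfolding ee_eq using ss_nonzero by (simp add: field_simps power2_eq_square)
  also have "\<dots> \<noteq> 0"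
    using ss_nonzero by simp
  finally show ne: "ee \<noteq> 1"
    by auto
  then have e1: "e \<noteq> 1"
    unfolding e_def using V5_eq_0_iff[of "ee - 1"] by simp
  have id: "(d ^ 2 - e) * bb ^ 3 * (e - 1) = d * (d ^ 2 - 5 * e) * (e - 5)"
    unfolding d e bb_eq by (rule dd_identity[OF ss_nonzero(5) V5_ss_nonzero(1) yy_relation])
  have "d ^ 2 - e \<noteq> 0"
    using ne e0 unfolding ee by simp
  then have "(d ^ 2 - e) * bb ^ 3 * (e - 1) \<noteq> 0"
    using e1 bb_nonzero by simp
  then have ne5: "d ^ 2 - 5 * e \<noteq> 0" "e \<noteq> 5"
    unfolding id by auto
  then show "ee \<noteq> 5"
    unfolding ee using e0 by (auto simp: field_simps)
  have R1: "RR ee = (d ^ 2 - e) ^ 2 * e / (d ^ 2 * (d ^ 2 - 5 * e) ^ 2)"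
  proof -
    have "ee - 1 = (d ^ 2 - e) / e" "ee - 5 = (d ^ 2 - 5 * e) / e"
      unfolding ee using e0 by (simp_all add: field_simps)
    then show ?thesis
      unfolding RR_def ee using e0 by (simp add: power_divide divide_simps)
  qed
  have R2: "V5 (RR ee) = (e - 1) ^ 2 / (e * (e - 5) ^ 2)"
    by (simp add: e_def RR_def)
  have "RR ee * V5 (RR ee) * bb ^ 6 = ((d ^ 2 - e) * bb ^ 3 * (e - 1)) ^ 2 / (d * (d ^ 2 - 5 * e) * (e - 5)) ^ 2"
    unfolding R2 unfolding R1 using e0 by (simp add: power_mult_distrib mult_ac flip: power_mult)
  also have "\<dots> = 1"
    unfolding id using d0 ne5 by simp
  finally show "RR ee * V5 (RR ee) * bb ^ 6 = 1" .
qed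

text \<open>The coefficient of f(q^5) at n > 0 is 0 or a coefficient of f at n / 5 < n, which
  vanishes by induction; the equation then leaves the coefficient of f at n alone.\<close>

lemma fps_mult_compose_5_eq_1:
  fixes f :: "complex fps"
  assumes f: "f * (f oo fps_X ^ 5) = 1" and f0: "fps_nth f 0 = 1"
  shows "f = 1"
proof -
  have "fps_nth f n = 0" if "n > 0" for n
    using that
  proof (induction n rule: less_induct)
    case (less n)
    have "0 = (\<Sum>i=0..n. fps_nth f i * fps_nth (f oo fps_X ^ 5) (n - i))"
      using f less.prems by (simp flip: fps_mult_nth)
    also have "\<dots> = (\<Sum>i\<in>{0, n}. fps_nth f i * fps_nth (f oo fps_X ^ 5) (n - i))"
      using less.IH by (intro sum.mono_neutral_right) auto
    also have "\<dots> = fps_nth (f oo fps_X ^ 5) n + fps_nth f n"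
      using less.prems f0 by (simp add: fps_nth_compose_X_power)
    also have "fps_nth (f oo fps_X ^ 5) n = 0"
      using less by (auto simp: fps_nth_compose_X_power elim!: dvdE)
    finally show ?case by simp
  qed
  then show ?thesis
    using f0 by (simp add: fps_eq_iff)
qed

text \<open>By \<open>tt_V5_tt\<close> and \<open>RR_ee\<close> the quotient \<open>f\<close> of the two sides satisfies \<open>f * V5 f = 1\<close>, which forces
  \<open>f = 1\<close>.\<close>

lemma tt_eq: "tt = RR ee"
proof -
  define e where "e = theta (- 1) 1 1 ^ 2 * inverse ((theta (- 1) 1 1 oo fps_X ^ 5) ^ 2)"
  \<comment> \<open>W is \<open>tt\<close> / \<open>RR ee\<close> as a power series. The factors
    v5^8 / (16 (u1 u3)^2) come from ee - 1 = -4 q u1 u3 / v5^4, whose square carries the same q^2 as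
    \<open>tt\<close>. Since also (1 - 5)^2 = 16, the constant term of W is 1.\<close>
  define W where "W = (qX 2 2 oo fps_X ^ 5) ^ 6 * inverse (qX 2 2 ^ 6) * (e * (e - 5) ^ 2) * v5 ^ 8
    * inverse (16 * (u1 * u3) ^ 2)"
  have nth0: "fps_nth (h oo fps_X ^ m) 0 = fps_nth h 0" for h :: "complex fps" and m
    by (simp add: fps_nth_compose_X_power)
  have th0: "fps_nth (theta (- 1) 1 1) 0 = 1"
    using phi_product[of 1] by (simp add: fps_power_zeroth)
  have e0: "fps_nth e 0 = 1"
    by (simp add: e_def fps_power_zeroth nth0 th0 del: One_nat_def)
  have ee: "F2L e = ee"
    unfolding e_def ee_def
    by (subst F2L_divide[symmetric]) (simp_all add: F2L_simps F2L_compose phi_def nth0 th0 fps_power_zeroth del: One_nat_def)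
  have W0: "fps_nth W 0 = 1"
    by (simp add: W_def nth0 fps_power_zeroth e0 level10_nth_0)
  have W: "F2L W = V5 P2 ^ 6 / P2 ^ 6 * (ee * (ee - 5) ^ 2) * F2L v5 ^ 8 / (16 * (F2L u1 * F2L u3) ^ 2)"
  proof -
    have "F2L W = F2L ((qX 2 2 oo fps_X ^ 5) ^ 6 * inverse (qX 2 2 ^ 6)) * F2L (e * (e - 5) ^ 2 * v5 ^ 8 * inverse (16 * (u1 * u3) ^ 2))"
      by (simp add: W_def mult_ac flip: F2L_simps(1))
    also have "F2L ((qX 2 2 oo fps_X ^ 5) ^ 6 * inverse (qX 2 2 ^ 6)) = V5 P2 ^ 6 / P2 ^ 6"
      by (subst F2L_divide[symmetric]) (simp_all add: fps_power_zeroth F2L_simps F2L_compose P2_def)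
    also have "F2L (e * (e - 5) ^ 2 * v5 ^ 8 * inverse (16 * (u1 * u3) ^ 2)) =
        ee * (ee - 5) ^ 2 * F2L v5 ^ 8 / (16 * (F2L u1 * F2L u3) ^ 2)"
      by (subst F2L_divide[symmetric]) (simp_all add: fps_power_zeroth F2L_simps ee level10_nth_0)
    finally show ?thesis
      by simp
  qed
  have ee1: "ee - 1 = - (4 * qL * F2L u1 * F2L u3 / F2L v5 ^ 4)"
  proof -
    have "4 * qL * F2L u1 * F2L u3 / F2L v5 ^ 4 = (1 + ss) * (1 - ss) / ss"
      unfolding ss_relations unfolding ss_def by (simp add: field_simps eval_nat_numeral)
    then show ?thesis
      unfolding ee_eq using ss_nonzero by (simp add: field_simps power2_eq_square)
  qed
  have tW: "tt = F2L W * RR ee"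
  proof -
    have "RR ee = qL ^ 2 * (16 * (F2L u1 * F2L u3) ^ 2) / (F2L v5 ^ 8 * (ee * (ee - 5) ^ 2))"
      unfolding RR_def ee1 by (simp add: power_mult_distrib power_divide flip: power_mult)
    then show ?thesis
      unfolding W tt_def using ee_nonzero by simp
  qed
  have "F2L (W * (W oo fps_X ^ 5)) * (RR ee * V5 (RR ee) * bb ^ 6) = tt * V5 tt * bb ^ 6"
    unfolding tW by (simp add: F2L_simps F2L_compose mult_ac)
  then have "F2L (W * (W oo fps_X ^ 5)) = F2L 1"
    unfolding RR_ee tt_V5_tt by (simp add: F2L_simps)
  then have "W * (W oo fps_X ^ 5) = 1"
    by (simp only: F2L_eq_iff)
  then have "W = 1"
    using W0 by (rule fps_mult_compose_5_eq_1)
  then show ?thesis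
    using tW by (simp only: F2L_simps mult_1_left)
qed

section \<open>The modular equation of degree 5\<close>

definition ff :: "complex fls" where "ff = (1 - ss) ^ 2 / (ss * (1 + ss) ^ 2)"

lemma ff_nonzero: "ff \<noteq> 0"
  using ss_nonzero by (simp add: ff_def)

lemma yy_5: "yy ^ 5 = V5 ff"
  unfolding ff_def by (rule yy_power_5)

text \<open>Ramanujan's evaluation of 1 / r^5 - 11 - r^5 for r = r(q^2), whose fifth power is
  \<open>ff\<close>. Both sides are now rational in \<open>ss\<close>, the left one through
  \<open>tt_eq\<close> and \<open>ee_eq\<close>.\<close>

lemma inverse_tt: "1 / tt = 1 / ff - 11 - ff"
proof -
  have e: "ee = (ss ^ 2 + ss - 1) / ss" "ee - 1 = (ss ^ 2 - 1) / ss" "ee - 5 = (ss ^ 2 - 4 * ss - 1) / ss"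
    unfolding ee_eq using ss_nonzero by (simp_all add: field_simps)
  have "1 / tt = (ss ^ 2 + ss - 1) * (ss ^ 2 - 4 * ss - 1) ^ 2 / (ss * (ss ^ 2 - 1) ^ 2)"
    unfolding tt_eq RR_def e(2,3) unfolding e(1) using ss_nonzero
    by (simp add: power_divide)
  also have "ss ^ 2 - 1 = - ((1 + ss) * (1 - ss))"
    by (simp add: algebra_simps power2_eq_square)
  also have "(ss ^ 2 + ss - 1) * (ss ^ 2 - 4 * ss - 1) ^ 2 =
      ss ^ 2 * (1 + ss) ^ 4 - 11 * ss * (1 - ss) ^ 2 * (1 + ss) ^ 2 - (1 - ss) ^ 4"
    by algebra
  also have "\<dots> / (ss * (- ((1 + ss) * (1 - ss))) ^ 2) = 1 / ff - 11 - ff"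
    unfolding ff_def using ss_nonzero by (simp add: divide_simps) (simp add: algebra_simps eval_nat_numeral)
  finally show ?thesis .
qed

text \<open>With Z = 1 / y - y one has 1 / y^5 - y^5 = Z^5 + 5 Z^3 + 5 Z. Substituting Z = b + 1 and
  subtracting 11 removes the constant term and gives the polynomial in b.\<close>

lemma bb_quintic: "bb ^ 5 + 5 * bb ^ 4 + 15 * bb ^ 3 + 25 * bb ^ 2 + 25 * bb = 1 / V5 tt"
proof -
  have "(1 / y - 1 - y) ^ 5 + 5 * (1 / y - 1 - y) ^ 4 + 15 * (1 / y - 1 - y) ^ 3 + 25 * (1 / y - 1 - y) ^ 2
      + 25 * (1 / y - 1 - y) = 1 / y ^ 5 - 11 - y ^ 5" if "y \<noteq> 0" for y :: "complex fls"
  proof -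
    define z where "z = 1 / y"
    have "y * z = 1"
      using that by (simp add: z_def)
    then have "(z - 1 - y) ^ 5 + 5 * (z - 1 - y) ^ 4 + 15 * (z - 1 - y) ^ 3 + 25 * (z - 1 - y) ^ 2
      + 25 * (z - 1 - y) = z ^ 5 - 11 - y ^ 5"
      by algebra
    then show ?thesis
      by (simp add: z_def power_one_over)
  qed
  moreover have "1 / V5 tt = 1 / V5 ff - 11 - V5 ff"
    using arg_cong[OF inverse_tt, of V5] by simp
  ultimately show ?thesis
    using ss_nonzero(5) unfolding bb_eq yy_5[symmetric] by simp
qed

section \<open>The action of \<open>U\<^sub>5\<close> on the generators\<close>

text \<open>The powers 0, 1, 2, -1, -2 of \<open>yy\<close> carry the residues 0, 2, 4, 3, 1 of the
  exponent mod 5, so that \<open>U5\<close> picks out a0. In a product of two such forms the powers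
  lie between -4 and 4, and only the power 0 contributes to a0.\<close>

definition vec5 :: "complex fls \<Rightarrow> complex fls \<Rightarrow> complex fls \<Rightarrow> complex fls \<Rightarrow> complex fls \<Rightarrow> complex fls" where
  "vec5 a0 a1 a2 a3 a4 = V5 a0 + V5 a1 * yy + V5 a2 * yy ^ 2 + V5 a3 / yy + V5 a4 / yy ^ 2"

lemma U5_vec5: "U5 (vec5 a0 a1 a2 a3 a4) = a0"
proof -
  have U: "U5 (qL ^ r * V5 f) = 0" if "0 < r" "r < 5" for r f
    using U5_X_power_V5[of r f] that by (simp add: qL_def)
  have ww: "ww \<noteq> 0"
    by (rule ss_nonzero)
  have *: "V5 a1 * yy = qL ^ 2 * V5 (a1 * ww)" "V5 a2 * yy ^ 2 = qL ^ 4 * V5 (a2 * ww ^ 2)"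
    "V5 a3 / yy = qL ^ 3 * V5 (a3 / (ww * qL))" "V5 a4 / yy ^ 2 = qL ^ 1 * V5 (a4 / (ww ^ 2 * qL))"
    using ww unfolding yy_def
    by (simp_all add: power_mult_distrib field_simps flip: power_mult power_add power_Suc)
  show ?thesis
    unfolding vec5_def * U5_add U5_V5 by (simp only: U, simp)
qed

lemma vec5_mult:
  "U5 (vec5 a0 a1 a2 a3 a4 * vec5 c0 c1 c2 c3 c4) = a0 * c0 + a1 * c3 + a3 * c1 + a2 * c4 + a4 * c2"
proof -
  have expand: "(a0 + a1 * y + a2 * y ^ 2 + a3 / y + a4 / y ^ 2) * (c0 + c1 * y + c2 * y ^ 2 + c3 / y + c4 / y ^ 2)
    = (a0 * c0 + a1 * c3 + a3 * c1 + a2 * c4 + a4 * c2)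
      + (a0 * c1 + a1 * c0 + a2 * c3 + a3 * c2 + a4 * c4 / y ^ 5) * y
      + (a0 * c2 + a1 * c1 + a2 * c0 + (a3 * c4 + a4 * c3) / y ^ 5) * y ^ 2
      + (a0 * c3 + a3 * c0 + a1 * c4 + a4 * c1 + a2 * c2 * y ^ 5) / y
      + (a0 * c4 + a4 * c0 + a3 * c3 + (a1 * c2 + a2 * c1) * y ^ 5) / y ^ 2"
    if "y \<noteq> 0" for y a0 a1 a2 a3 a4 c0 c1 c2 c3 c4 :: "complex fls"
    using that by (simp add: divide_simps) (simp add: algebra_simps eval_nat_numeral)
  have "vec5 a0 a1 a2 a3 a4 * vec5 c0 c1 c2 c3 c4
    = vec5 (a0 * c0 + a1 * c3 + a3 * c1 + a2 * c4 + a4 * c2)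
      (a0 * c1 + a1 * c0 + a2 * c3 + a3 * c2 + a4 * c4 / ff)
      (a0 * c2 + a1 * c1 + a2 * c0 + (a3 * c4 + a4 * c3) / ff)
      (a0 * c3 + a3 * c0 + a1 * c4 + a4 * c1 + a2 * c2 * ff)
      (a0 * c4 + a4 * c0 + a3 * c3 + (a1 * c2 + a2 * c1) * ff)"
    unfolding vec5_def expand[OF ss_nonzero(5)] yy_5 by simp
  then show ?thesis
    by (simp only: U5_vec5)
qed

lemma bb_vec5:
  "bb = vec5 (- 1) (- 1) 0 1 0"
  "bb ^ 2 = vec5 (- 1) 2 1 (- 2) 1"
  "bb ^ 3 = vec5 5 0 (1 / ff - 3) 0 (- 3 - ff)"
  "bb ^ 4 = vec5 (- 5) (1 / ff - 8) (2 - 4 / ff) (8 + ff) (2 + 4 * ff)"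
proof -
  have y: "yy \<noteq> 0" by (rule ss_nonzero)
  show "bb = vec5 (- 1) (- 1) 0 1 0"
    by (simp add: bb_eq vec5_def)
  show "bb ^ 2 = vec5 (- 1) 2 1 (- 2) 1"
    "bb ^ 3 = vec5 5 0 (1 / ff - 3) 0 (- 3 - ff)"
    "bb ^ 4 = vec5 (- 5) (1 / ff - 8) (2 - 4 / ff) (8 + ff) (2 + 4 * ff)"
    unfolding bb_eq vec5_def
    using y ff_nonzero by (simp_all add: yy_5[symmetric] divide_simps) (simp_all add: algebra_simps eval_nat_numeral)
qed

lemma dd_vec5:
  assumes "A = - ((1 - ss) / ss)" and "B = 1 + ss"
  shows "(phi / V5 (V5 phi)) ^ 4 = vec5 (1 + 12 * A * B + 6 * A ^ 2 * B ^ 2)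
    ((6 * A ^ 2 + 4 * A ^ 3 * B) / ff + 4 * B ^ 3 * ff) (4 * B + 12 * A * B ^ 2 + A ^ 4 / ff ^ 2)
    ((6 * B ^ 2 + 4 * A * B ^ 3) * ff + 4 * A ^ 3 / ff) (4 * A + 12 * A ^ 2 * B + B ^ 4 * ff ^ 2)"
proof -
  have y: "yy \<noteq> 0" by (rule ss_nonzero)
  have d: "phi / V5 (V5 phi) = 1 + V5 A / yy ^ 2 + V5 B * yy ^ 2"
    unfolding phi_dissection_fls assms by simp
  have "(1 + a / y ^ 2 + b * y ^ 2) ^ 4 = (1 + 12 * a * b + 6 * a ^ 2 * b ^ 2)
      + ((6 * a ^ 2 + 4 * a ^ 3 * b) / y ^ 5 + 4 * b ^ 3 * y ^ 5) * y
      + (4 * b + 12 * a * b ^ 2 + a ^ 4 / (y ^ 5) ^ 2) * y ^ 2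
      + ((6 * b ^ 2 + 4 * a * b ^ 3) * y ^ 5 + 4 * a ^ 3 / y ^ 5) / y
      + (4 * a + 12 * a ^ 2 * b + b ^ 4 * (y ^ 5) ^ 2) / y ^ 2" if "y \<noteq> 0" for a b y :: "complex fls"
  proof -
    define z where "z = 1 / y"
    have yz: "y * z = 1"
      using that by (simp add: z_def)
    then have "(1 + a * z ^ 2 + b * y ^ 2) ^ 4 = (1 + 12 * a * b + 6 * a ^ 2 * b ^ 2)
      + ((6 * a ^ 2 + 4 * a ^ 3 * b) * z ^ 5 + 4 * b ^ 3 * y ^ 5) * y
      + (4 * b + 12 * a * b ^ 2 + a ^ 4 * (z ^ 5) ^ 2) * y ^ 2
      + ((6 * b ^ 2 + 4 * a * b ^ 3) * y ^ 5 + 4 * a ^ 3 * z ^ 5) * z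
      + (4 * a + 12 * a ^ 2 * b + b ^ 4 * (y ^ 5) ^ 2) * z ^ 2"
      by algebra
    then show ?thesis
      by (simp add: z_def divide_inverse power_inverse)
  qed
  from this[OF y] show ?thesis
    unfolding d vec5_def by (simp add: yy_5)
qed

abbreviation "EE \<equiv> phi ^ 4"

text \<open>Dividing E by the series \<open>V5 (V5 phi) ^ 4\<close> makes it accessible to
  \<open>vec5\<close>; \<open>U5\<close> returns that factor as V5 E, and \<open>ee\<close>^2 times
  V5 E is E again.\<close>

lemma U5_E_aux:
  assumes "U5 (b * (phi / V5 (V5 phi)) ^ 4) = u * ee ^ 2 + v"
  shows "U5 (b * EE) = u * EE + v * V5 EE"
proof -
  have "b * EE = V5 (V5 phi ^ 4) * (b * (phi / V5 (V5 phi)) ^ 4)"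
    using phi_nonzero by (simp add: power_divide)
  then have "U5 (b * EE) = V5 phi ^ 4 * (u * ee ^ 2 + v)"
    by (simp only: U5_V5_mult assms)
  also have "\<dots> = u * EE + v * V5 EE"
    using phi_nonzero by (simp add: ee_def power_divide algebra_simps flip: power_mult)
  finally show ?thesis .
qed

text \<open>\<open>vec5_mult\<close> yields rational functions of \<open>ss\<close>, in which u
  \<open>ee\<close>^2 + v is recognized. Five powers determine all others by
  \<open>bb_quintic\<close>. The cube brings in 1 / t, so a window of polynomials in t has to begin
  at the square.\<close>

lemma U5_b_E:
  "U5 EE = 6 * EE - 5 * V5 EE"
  "U5 (bb * EE) = - 2 * EE + 25 * V5 EE"
  "U5 (bb ^ 2 * EE) = - 25 * V5 EE"
  "U5 (bb ^ 3 * EE) = (1 / tt + 5) * EE - (1 / tt) * V5 EE"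
  "U5 (bb ^ 4 * EE) = - 125 * V5 EE"
proof -
  define A where "A = - ((1 - ss) / ss)"
  define B where "B = 1 + ss"
  note d = dd_vec5[OF A_def B_def]
  note s = ss_nonzero(1-3)
  have f: "ff = (1 - ss) ^ 2 / (ss * (1 + ss) ^ 2)"
    by (rule ff_def)
  have one: "1 = vec5 1 0 0 0 0"
    by (simp add: vec5_def)
  have "U5 (1 * EE) = 6 * EE + (- 5) * V5 EE"
    by (rule U5_E_aux, subst one, unfold d vec5_mult ee_eq A_def B_def f)
       (use s in \<open>simp add: divide_simps\<close>, use s in \<open>simp add: algebra_simps eval_nat_numeral\<close>)
  then show "U5 EE = 6 * EE - 5 * V5 EE"
    by simp
  show "U5 (bb * EE) = - 2 * EE + 25 * V5 EE"
    by (rule U5_E_aux, unfold bb_vec5(1) d vec5_mult ee_eq A_def B_def f)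
       (use s in \<open>simp add: divide_simps\<close>, use s in \<open>simp add: algebra_simps eval_nat_numeral\<close>)
  have "U5 (bb ^ 2 * EE) = 0 * EE + (- 25) * V5 EE"
    by (rule U5_E_aux, unfold bb_vec5(2) d vec5_mult ee_eq A_def B_def f)
       (use s in \<open>simp add: divide_simps\<close>, use s in \<open>simp add: algebra_simps eval_nat_numeral\<close>)
  then show "U5 (bb ^ 2 * EE) = - 25 * V5 EE"
    by simp
  have "U5 (bb ^ 3 * EE) = (1 / tt + 5) * EE + (- (1 / tt)) * V5 EE"
    by (rule U5_E_aux, unfold bb_vec5(3) d vec5_mult inverse_tt ee_eq A_def B_def f)
       (use s in \<open>simp add: divide_simps\<close>, use s in \<open>simp add: algebra_simps eval_nat_numeral\<close>)
  then show "U5 (bb ^ 3 * EE) = (1 / tt + 5) * EE - (1 / tt) * V5 EE"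
    by simp
  have "U5 (bb ^ 4 * EE) = 0 * EE + (- 125) * V5 EE"
    by (rule U5_E_aux, unfold bb_vec5(4) d vec5_mult ee_eq A_def B_def f)
       (use s in \<open>simp add: divide_simps\<close>, use s in \<open>simp add: algebra_simps eval_nat_numeral\<close>)
  then show "U5 (bb ^ 4 * EE) = - 125 * V5 EE"
    by simp
qed

lemma U5_b:
  "U5 1 = 1" "U5 bb = - 1" "U5 (bb ^ 2) = - 1" "U5 (bb ^ 3) = 5" "U5 (bb ^ 4) = - 5"
  using U5_V5[of 1] unfolding bb_vec5(2-4) by (simp_all only: bb_vec5(1) U5_vec5 V5_simps)

section \<open>Five-adic estimates\<close>

definition ev :: "int poly \<Rightarrow> complex fls" where
  "ev p = poly (map_poly of_int p) tt"

lemma ev_pCons [simp]: "ev (pCons a p) = of_int a + tt * ev p" and ev_0 [simp]: "ev 0 = 0"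
  by (simp_all add: ev_def map_poly_pCons)

lemma ev_add [simp]: "ev (p + q) = ev p + ev q"
  by (induction p q rule: poly_induct2) (simp_all add: algebra_simps)

lemma ev_smult [simp]: "ev (smult a p) = of_int a * ev p"
  by (induction p) (simp_all add: algebra_simps)

lemma ev_sum: "ev (\<Sum>i\<in>I. f i) = (\<Sum>i\<in>I. ev (f i))"
  by (induction I rule: infinite_finite_induct) simp_all

lemma ev_poly_shift:
  "(\<And>j. j < n \<Longrightarrow> coeff p j = 0) \<Longrightarrow> ev p = tt ^ n * ev (poly_shift n p)"
proof (induction n arbitrary: p)
  case 0
  then show ?case by (simp add: poly_shift_0)
next
  case (Suc n)
  obtain a p' where p: "p = pCons a p'"
    by (rule pCons_cases)
  have "a = 0" "\<And>j. j < n \<Longrightarrow> coeff p' j = 0"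
    using Suc.prems[of 0] Suc.prems[of "Suc _"] by (simp_all add: p)
  moreover have "poly_shift (Suc n) p = poly_shift n p'"
    by (rule poly_eqI) (simp add: coeff_poly_shift p)
  ultimately show ?case
    using Suc.IH[of p'] by (simp add: p mult_ac)
qed

lemma ev_altdef:
  assumes "degree p \<le> D"
  shows "ev p = (\<Sum>n\<le>D. of_int (coeff p n) * tt ^ n)"
proof -
  have "ev p = (\<Sum>n\<le>degree p. of_int (coeff p n) * tt ^ n)"
  proof (induction p)
    case (pCons a p)
    show ?case
    proof (cases "p = 0")
      case False
      then have "degree (pCons a p) = Suc (degree p)"
        by simp
      then have "(\<Sum>n\<le>degree (pCons a p). of_int (coeff (pCons a p) n) * tt ^ n)
          = of_int a + (\<Sum>n\<le>degree p. of_int (coeff p n) * tt ^ Suc n)"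
        by (simp only: sum.atMost_Suc_shift coeff_pCons_0 coeff_pCons_Suc) simp
      then show ?thesis
        using pCons by (simp add: sum_distrib_left mult_ac)
    qed simp
  qed simp
  also have "\<dots> = (\<Sum>n\<le>D. of_int (coeff p n) * tt ^ n)"
    using assms by (intro sum.mono_neutral_left) (auto simp: coeff_eq_0)
  finally show ?thesis .
qed

text \<open>Index \<open>i\<close> belongs to the power \<open>bb\<close> to the \<open>2 - i\<close>.\<close>

fun urec :: "(nat \<Rightarrow> int poly) \<Rightarrow> nat \<Rightarrow> int poly" where
  "urec f n = (if n < 5 then f n else pCons 0 (smult 25 (urec f (n - 1)) + smult 25 (urec f (n - 2))
    + smult 15 (urec f (n - 3)) + smult 5 (urec f (n - 4)) + urec f (n - 5)))"

declare urec.simps [simp del]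

lemma urec_init: "n < 5 \<Longrightarrow> urec f n = f n"
  by (simp add: urec.simps)

lemma urec_step: "urec f (n + 5) = pCons 0 (smult 25 (urec f (n + 4)) + smult 25 (urec f (n + 3))
    + smult 15 (urec f (n + 2)) + smult 5 (urec f (n + 1)) + urec f n)"
  by (subst urec.simps) (simp add: eval_nat_numeral)

text \<open>\<open>uu\<close> and \<open>vv\<close> are the coefficients of E and V5 E in
  \<open>U5 (bb ^ 2 * beta ^ n * EE)\<close>, and \<open>mm\<close> is
  \<open>U5 (bb ^ 2 * beta ^ n)\<close>. The values for n = 0, 1, 2 are those of
  \<open>U5_b_E\<close> and \<open>U5_b\<close>; those for n = 3, 4 follow by solving the quintic
  for \<open>beta\<close> and \<open>beta\<close>^2.\<close>

definition uu :: "nat \<Rightarrow> int poly" where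
  "uu = urec (\<lambda>n. [0, [:- 2:], [:6:], [:5, 125:], [:1, 250, 3125:]] ! n)"
definition vv :: "nat \<Rightarrow> int poly" where
  "vv = urec (\<lambda>n. [[:- 25:], [:25:], [:- 5:], [:- 5:], [:- 1:]] ! n)"
definition mm :: "nat \<Rightarrow> int poly" where
  "mm = urec (\<lambda>n. [[:- 1:], [:- 1:], [:1:], [:0, 5:], [:0, 10, 125:]] ! n)"

lemma uvm_init:
  "uu 0 = 0" "uu 1 = [:- 2:]" "uu 2 = [:6:]" "uu 3 = [:5, 125:]" "uu 4 = [:1, 250, 3125:]"
  "vv 0 = [:- 25:]" "vv 1 = [:25:]" "vv 2 = [:- 5:]" "vv 3 = [:- 5:]" "vv 4 = [:- 1:]"
  "mm 0 = [:- 1:]" "mm 1 = [:- 1:]" "mm 2 = [:1:]" "mm 3 = [:0, 5:]" "mm 4 = [:0, 10, 125:]"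
  by (simp_all add: uu_def vv_def mm_def urec_init del: One_nat_def)

lemma less_5_cases: "n < 5 \<Longrightarrow> n = 0 \<or> n = 1 \<or> n = 2 \<or> n = 3 \<or> n = (4::nat)"
  by auto

lemma nat_add_5_induct [case_names init step]:
  assumes "\<And>n. n < 5 \<Longrightarrow> P n"
    and "\<And>n. P n \<Longrightarrow> P (n + 1) \<Longrightarrow> P (n + 2) \<Longrightarrow> P (n + 3) \<Longrightarrow> P (n + 4) \<Longrightarrow> P (n + 5)"
  shows "P (n :: nat)"
proof (induction n rule: less_induct)
  case (less n)
  show ?case
  proof (cases "n < 5")
    case False
    then have "n = (n - 5) + 5"
      by simp
    moreover have "P ((n - 5) + 5)"
      using False by (intro assms(2) less.IH) auto
    ultimately show ?thesis
      by (simp only:)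
  qed (rule assms(1))
qed

text \<open>The weights of the indices n + 4, ..., n have the 5-adic orders 2, 2, 1, 1, 0. Compared
  with the target exponent, which is X div 2, the index n + i loses at most i / 2 rounded up, that
  is 2, 2, 1, 1, 0: each weight pays exactly for its loss.\<close>

lemma urec_dvd:
  assumes "\<And>n j. n < 5 \<Longrightarrow> 5 ^ ((5 * j + c - n) div 2) dvd coeff (f n) j"
  shows "5 ^ ((5 * j + c - n) div 2) dvd coeff (urec f n) j"
proof (induction n arbitrary: j rule: nat_add_5_induct)
  case (init n)
  then show ?case using assms by (simp add: urec_init)
next
  case (step n)
  show ?case
  proof (cases j)
    case 0
    then show ?thesis by (simp add: urec_step)
  next
    case (Suc i)
    define X where "X = 5 * i + c - n"
    have *: "5 ^ (X div 2) dvd 5 ^ a * y" if "5 ^ b dvd y" "X div 2 \<le> a + b" for a b and y :: int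
    proof -
      have "(5::int) ^ (X div 2) dvd 5 ^ (a + b)"
        using that(2) by (rule le_imp_power_dvd)
      also have "\<dots> dvd 5 ^ a * y"
        unfolding power_add using that(1) by (intro mult_dvd_mono) auto
      finally show ?thesis .
    qed
    have le: "X div 2 \<le> 2 + (5 * i + c - (n + 4)) div 2" "X div 2 \<le> 2 + (5 * i + c - (n + 3)) div 2"
      "X div 2 \<le> 1 + (5 * i + c - (n + 2)) div 2" "X div 2 \<le> 1 + (5 * i + c - (n + 1)) div 2"
      "X div 2 \<le> 0 + (5 * i + c - n) div 2"
      unfolding X_def by linarith+
    have "5 ^ (X div 2) dvd 5 ^ 2 * coeff (urec f (n + 4)) i" "5 ^ (X div 2) dvd 5 ^ 2 * coeff (urec f (n + 3)) i"
      "5 ^ (X div 2) dvd 5 ^ 1 * coeff (urec f (n + 2)) i" "5 ^ (X div 2) dvd 5 ^ 1 * coeff (urec f (n + 1)) i"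
      "5 ^ (X div 2) dvd 5 ^ 0 * coeff (urec f n) i"
      using *[OF step.IH(5)[of i], of 2] *[OF step.IH(4)[of i], of 2] *[OF step.IH(3)[of i], of 1]
        *[OF step.IH(2)[of i], of 1] *[OF step.IH(1)[of i], of 0] le
      by (simp_all only: True_implies_equals)
    then have "5 ^ (X div 2) dvd 25 * coeff (urec f (n + 4)) i + 25 * coeff (urec f (n + 3)) i
        + 3 * (5 * coeff (urec f (n + 2)) i) + 5 * coeff (urec f (n + 1)) i + coeff (urec f n) i"
      by (intro dvd_add dvd_mult[of _ _ 3]) simp_all
    moreover have "5 * j + c - (n + 5) = X"
      by (simp add: Suc X_def)
    ultimately show ?thesis
      by (simp add: urec_step Suc)
  qed
qed

text \<open>Five indices raise the order of vanishing in t by one, so at indices 6 n + e a division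
  by t^n stays possible.\<close>

lemma urec_low:
  assumes "\<And>n j. n < 5 \<Longrightarrow> 5 * j + d < n \<Longrightarrow> coeff (f n) j = 0"
  shows "5 * j + d < n \<Longrightarrow> coeff (urec f n) j = 0"
proof (induction n arbitrary: j rule: nat_add_5_induct)
  case (init n)
  then show ?case using assms by (simp add: urec_init)
next
  case (step n)
  then show ?case by (cases j) (simp_all add: urec_step)
qed

lemma coeff_const: "coeff [:a:] j = (if j = 0 then a else 0)"
  and coeff_linear: "coeff [:a, b:] j = (if j = 0 then a else if j = 1 then b else 0)"
  and coeff_quadratic: "coeff [:a, b, c:] j = (if j = 0 then a else if j = 1 then b else if j = 2 then c else 0)"
  by (auto simp: coeff_pCons split: nat.split)

lemmas coeff_small = coeff_const coeff_linear coeff_quadratic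

lemma uu_dvd: "5 ^ ((5 * j + 2 - n) div 2) dvd coeff (uu n) j"
  unfolding uu_def
  by (rule urec_dvd, drule less_5_cases) (auto simp: coeff_small simp del: One_nat_def)

lemma vv_dvd: "5 ^ ((5 * j + 4 - n) div 2) dvd coeff (vv n) j"
  unfolding vv_def
  by (rule urec_dvd, drule less_5_cases) (auto simp: coeff_small simp del: One_nat_def)

lemma mm_dvd: "5 ^ ((5 * j + 1 - n) div 2) dvd coeff (mm n) j"
  unfolding mm_def
  by (rule urec_dvd, drule less_5_cases) (auto simp: coeff_small simp del: One_nat_def)

lemma uu_low: "5 * j + 4 < n \<Longrightarrow> coeff (uu n) j = 0"
  and vv_low: "5 * j + 4 < n \<Longrightarrow> coeff (vv n) j = 0"
  unfolding uu_def vv_def by (erule urec_low[rotated], simp)+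

lemma mm_low: "5 * j + 2 < n \<Longrightarrow> coeff (mm n) j = 0"
  unfolding mm_def
  by (erule urec_low[rotated], drule less_5_cases) (auto simp: coeff_small)

text \<open>The constant terms of \<open>uu\<close> and \<open>vv\<close> cancel at n = 3 and n = 4,
  and the common recurrence preserves the higher order of vanishing of the sum. This is the source
  of the condition P(0) + Q(0) = 0.\<close>

lemma uu_vv_low: "5 * j + 2 < n \<Longrightarrow> coeff (uu n) j + coeff (vv n) j = 0"
proof (induction n arbitrary: j rule: nat_add_5_induct)
  case (init n)
  then show ?case using less_5_cases[of n] by (auto simp: uvm_init coeff_small simp del: One_nat_def)
next
  case (step n)
  show ?case
  proof (cases j)
    case (Suc i)
    then have "5 * i + 2 < n"
      using step.prems by simp
    then have "coeff (uu m) i = - coeff (vv m) i" if "m \<in> {n, n + 1, n + 2, n + 3, n + 4}" for m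
      using step.IH[of i] that by (auto simp: eq_neg_iff_add_eq_0)
    then show ?thesis
      unfolding Suc uu_def vv_def urec_step by (simp flip: uu_def vv_def)
  qed (simp add: uu_def vv_def urec_step)
qed

section \<open>The values of \<open>U5\<close> on powers of \<open>beta\<close>\<close>

definition beta :: "complex fls" where "beta = 1 / bb"

lemma beta_5: "beta ^ 5 = V5 tt * (25 * beta ^ 4 + 25 * beta ^ 3 + 15 * beta ^ 2 + 5 * beta + 1)"
  and beta_eq: "beta = V5 tt * (bb ^ 4 + 5 * bb ^ 3 + 15 * bb ^ 2 + 25 * bb + 25)"
proof -
  have "V5 tt * (bb ^ 5 + 5 * bb ^ 4 + 15 * bb ^ 3 + 25 * bb ^ 2 + 25 * bb) = 1"
    unfolding bb_quintic using tt_nonzero by simp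
  then have *: "V5 tt * bb * (bb ^ 4 + 5 * bb ^ 3 + 15 * bb ^ 2 + 25 * bb + 25) = 1"
    by (simp add: algebra_simps eval_nat_numeral)
  then show "beta = V5 tt * (bb ^ 4 + 5 * bb ^ 3 + 15 * bb ^ 2 + 25 * bb + 25)"
    using bb_nonzero by (simp add: beta_def field_simps)
  have b: "beta * bb = 1"
    using bb_nonzero by (simp add: beta_def)
  have "beta ^ 5 = beta ^ 5 * (V5 tt * bb * (bb ^ 4 + 5 * bb ^ 3 + 15 * bb ^ 2 + 25 * bb + 25))"
    unfolding * by simp
  also have "\<dots> = V5 tt * (25 * beta ^ 4 + 25 * beta ^ 3 + 15 * beta ^ 2 + 5 * beta + 1)"
    using b by algebra
  finally show "beta ^ 5 = V5 tt * (25 * beta ^ 4 + 25 * beta ^ 3 + 15 * beta ^ 2 + 5 * beta + 1)" .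
qed

lemma U5_numeral_mult: "U5 (numeral k * f) = numeral k * U5 f"
  using U5_V5_mult[of "numeral k" f] by simp

lemma U5_beta_init:
  "U5 (beta * F) = tt * (U5 (bb ^ 4 * F) + 5 * U5 (bb ^ 3 * F) + 15 * U5 (bb ^ 2 * F) + 25 * U5 (bb * F) + 25 * U5 F)"
  "U5 (beta ^ 2 * F) = tt * (U5 (bb ^ 3 * F) + 5 * U5 (bb ^ 2 * F) + 15 * U5 (bb * F) + 25 * U5 F + 25 * U5 (beta * F))"
proof -
  have "beta * F = V5 tt * (bb ^ 4 * F + 5 * (bb ^ 3 * F) + 15 * (bb ^ 2 * F) + 25 * (bb * F) + 25 * F)"
    by (subst beta_eq) (simp add: algebra_simps)
  then show "U5 (beta * F) = tt * (U5 (bb ^ 4 * F) + 5 * U5 (bb ^ 3 * F) + 15 * U5 (bb ^ 2 * F) + 25 * U5 (bb * F) + 25 * U5 F)"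
    by (simp only: U5_V5_mult U5_add U5_numeral_mult)
  have b: "beta * bb = 1"
    using bb_nonzero by (simp add: beta_def)
  have "beta ^ 2 = beta * (V5 tt * (bb ^ 4 + 5 * bb ^ 3 + 15 * bb ^ 2 + 25 * bb + 25))"
    by (subst beta_eq[symmetric]) (simp add: power2_eq_square)
  also have "\<dots> = V5 tt * (bb ^ 3 + 5 * bb ^ 2 + 15 * bb + 25 + 25 * beta)"
    using b by algebra
  finally have "beta ^ 2 * F = V5 tt * (bb ^ 3 * F + 5 * (bb ^ 2 * F) + 15 * (bb * F) + 25 * F + 25 * (beta * F))"
    by (simp add: algebra_simps)
  then show "U5 (beta ^ 2 * F) = tt * (U5 (bb ^ 3 * F) + 5 * U5 (bb ^ 2 * F) + 15 * U5 (bb * F) + 25 * U5 F + 25 * U5 (beta * F))"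
    by (simp only: U5_V5_mult U5_add U5_numeral_mult)
qed

lemma U5_beta_step:
  "U5 (bb ^ 2 * beta ^ (n + 5) * F) = tt * (25 * U5 (bb ^ 2 * beta ^ (n + 4) * F) + 25 * U5 (bb ^ 2 * beta ^ (n + 3) * F)
    + 15 * U5 (bb ^ 2 * beta ^ (n + 2) * F) + 5 * U5 (bb ^ 2 * beta ^ (n + 1) * F) + U5 (bb ^ 2 * beta ^ n * F))"
proof -
  have "bb ^ 2 * beta ^ (n + 5) * F = V5 tt * (25 * (bb ^ 2 * beta ^ (n + 4) * F) + 25 * (bb ^ 2 * beta ^ (n + 3) * F)
    + 15 * (bb ^ 2 * beta ^ (n + 2) * F) + 5 * (bb ^ 2 * beta ^ (n + 1) * F) + bb ^ 2 * beta ^ n * F)"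
    unfolding power_add beta_5 by (simp add: algebra_simps)
  then show ?thesis
    by (simp only: U5_V5_mult U5_add U5_numeral_mult)
qed

lemma bb_beta: "bb ^ 2 * beta ^ 0 = bb ^ 2" "bb ^ 2 * beta ^ 1 = bb" "bb ^ 2 * beta ^ 2 = 1"
  "bb ^ 2 * beta ^ 3 = beta" "bb ^ 2 * beta ^ 4 = beta ^ 2"
  using bb_nonzero by (simp_all add: beta_def field_simps eval_nat_numeral)

lemma U5_beta_E: "U5 (bb ^ 2 * beta ^ n * EE) = ev (uu n) * EE + ev (vv n) * V5 EE"
proof (induction n rule: nat_add_5_induct)
  case (init n)
  have b: "U5 (beta * EE) = (5 + 125 * tt) * EE - 5 * V5 EE"
    unfolding U5_beta_init(1) U5_b_E using tt_nonzero by (simp add: field_simps)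
  have b2: "U5 (beta ^ 2 * EE) = (1 + 250 * tt + 3125 * tt ^ 2) * EE - V5 EE"
    unfolding U5_beta_init(2) b unfolding U5_b_E using tt_nonzero by (simp add: field_simps power2_eq_square)
  from init have "n = 0 \<or> n = 1 \<or> n = 2 \<or> n = 3 \<or> n = 4"
    by (rule less_5_cases)
  then show ?case
    by (elim disjE; simp only: bb_beta uvm_init mult_1_left b b2 U5_b_E)
       (simp_all add: algebra_simps power2_eq_square)
next
  case (step n)
  show ?case
    unfolding U5_beta_step step.IH unfolding uu_def vv_def urec_step
    by (simp add: algebra_simps)
qed

lemma U5_beta: "U5 (bb ^ 2 * beta ^ n) = ev (mm n)"
proof (induction n rule: nat_add_5_induct)
  case (init n)
  have b: "U5 beta = 5 * tt"
    using U5_beta_init(1)[of 1] unfolding mult_1_right U5_b by simp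
  have b2: "U5 (beta ^ 2) = 10 * tt + 125 * tt ^ 2"
    using U5_beta_init(2)[of 1] unfolding mult_1_right U5_b b by (simp add: algebra_simps power2_eq_square)
  from init have "n = 0 \<or> n = 1 \<or> n = 2 \<or> n = 3 \<or> n = 4"
    by (rule less_5_cases)
  then show ?case
    by (elim disjE; simp only: bb_beta uvm_init b b2 U5_b) (simp_all add: algebra_simps power2_eq_square)
next
  case (step n)
  show ?case
    using U5_beta_step[of n 1] unfolding mult_1_right step.IH unfolding mm_def urec_step
    by (simp add: algebra_simps)
qed

section \<open>Iteration of \<open>U\<^sub>5\<close>\<close>

text \<open>From tt V5 tt = beta^6 one gets tt^n beta^a = V5 (tt^(-n)) bb^2 beta^(6n+2+a). Hence the
  index 6 n + e, where e is 2 plus the power a of \<open>beta\<close> present, and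
  \<open>poly_shift n\<close> as the division by tt^n. The polynomial Q meets only \<open>mm\<close>
  and enters only the coefficient of E, because V5 E leaves \<open>U5\<close> as E.\<close>

definition stepP :: "nat \<Rightarrow> int poly \<Rightarrow> int poly \<Rightarrow> int poly" where
  "stepP e P Q = (\<Sum>n\<le>max (degree P) (degree Q). smult (coeff P n) (poly_shift n (uu (6 * n + e)))
    + smult (coeff Q n) (poly_shift n (mm (6 * n + e))))"

definition stepQ :: "nat \<Rightarrow> int poly \<Rightarrow> int poly \<Rightarrow> int poly" where
  "stepQ e P Q = (\<Sum>n\<le>max (degree P) (degree Q). smult (coeff P n) (poly_shift n (vv (6 * n + e))))"

lemma U5_tt_beta:
  "U5 (tt ^ n * beta ^ e * EE) = ev (poly_shift n (uu (6 * n + 2 + e))) * EE + ev (poly_shift n (vv (6 * n + 2 + e))) * V5 EE"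
  "U5 (tt ^ n * beta ^ e * V5 EE) = ev (poly_shift n (mm (6 * n + 2 + e))) * EE"
proof -
  have "tt * V5 tt = beta ^ 6"
    using tt_V5_tt bb_nonzero by (simp add: beta_def field_simps)
  then have "(tt * V5 tt) ^ n = beta ^ (6 * n)"
    by (simp add: power_mult)
  moreover have "bb ^ 2 * beta ^ (6 * n + 2 + e) = (bb ^ 2 * beta ^ 2) * beta ^ (6 * n) * beta ^ e"
    by (simp only: power_add mult_ac)
  ultimately have *: "tt ^ n * beta ^ e = V5 (1 / tt ^ n) * (bb ^ 2 * beta ^ (6 * n + 2 + e))"
    unfolding bb_beta using tt_nonzero by (simp add: power_mult_distrib field_simps)
  have low: "5 * j + 4 < 6 * n + 2 + e" "5 * j + 2 < 6 * n + 2 + e" if "j < n" for j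
    using that by simp_all
  have "U5 (tt ^ n * beta ^ e * EE) = 1 / tt ^ n * (ev (uu (6 * n + 2 + e)) * EE + ev (vv (6 * n + 2 + e)) * V5 EE)"
    unfolding * mult.assoc[of "V5 _"] U5_V5_mult U5_beta_E ..
  also have "\<dots> = ev (poly_shift n (uu (6 * n + 2 + e))) * EE + ev (poly_shift n (vv (6 * n + 2 + e))) * V5 EE"
    using ev_poly_shift[of n "uu (6 * n + 2 + e)"] ev_poly_shift[of n "vv (6 * n + 2 + e)"] uu_low vv_low low tt_nonzero
    by (simp add: field_simps)
  finally show "U5 (tt ^ n * beta ^ e * EE) =
    ev (poly_shift n (uu (6 * n + 2 + e))) * EE + ev (poly_shift n (vv (6 * n + 2 + e))) * V5 EE" .
  have "tt ^ n * beta ^ e * V5 EE = V5 (1 / tt ^ n * EE) * (bb ^ 2 * beta ^ (6 * n + 2 + e))"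
    unfolding * by simp
  then have "U5 (tt ^ n * beta ^ e * V5 EE) = 1 / tt ^ n * EE * ev (mm (6 * n + 2 + e))"
    by (simp only: U5_V5_mult U5_beta)
  also have "\<dots> = ev (poly_shift n (mm (6 * n + 2 + e))) * EE"
    using ev_poly_shift[of n "mm (6 * n + 2 + e)"] mm_low low tt_nonzero by (simp add: field_simps)
  finally show "U5 (tt ^ n * beta ^ e * V5 EE) = ev (poly_shift n (mm (6 * n + 2 + e))) * EE" .
qed

lemma U5_of_int_mult: "U5 (of_int c * f) = of_int c * U5 f"
  by (rule fls_eqI) simp

lemma U5_step:
  "U5 (beta ^ e * (ev P * EE + ev Q * V5 EE)) = ev (stepP (2 + e) P Q) * EE + ev (stepQ (2 + e) P Q) * V5 EE"
proof -
  have ring: "x * (a * E + b * V) + y * (c * E) = (x * a + y * c) * E + x * b * V" for x y a b c E V :: "complex fls"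
    by (simp add: algebra_simps)
  define D where "D = max (degree P) (degree Q)"
  define A where "A = (\<lambda>n. ev (poly_shift n (uu (6 * n + (2 + e)))))"
  define B where "B = (\<lambda>n. ev (poly_shift n (vv (6 * n + (2 + e)))))"
  define C where "C = (\<lambda>n. ev (poly_shift n (mm (6 * n + (2 + e)))))"
  have U: "U5 (tt ^ n * beta ^ e * EE) = A n * EE + B n * V5 EE" "U5 (tt ^ n * beta ^ e * V5 EE) = C n * EE" for n
    using U5_tt_beta[of n e] by (simp_all only: A_def B_def C_def add.assoc[of "6 * n" 2 e])
  have step: "ev (stepP (2 + e) P Q) = (\<Sum>n\<le>D. of_int (coeff P n) * A n + of_int (coeff Q n) * C n)"
    "ev (stepQ (2 + e) P Q) = (\<Sum>n\<le>D. of_int (coeff P n) * B n)"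
    by (simp_all only: stepP_def stepQ_def D_def A_def B_def C_def ev_sum ev_add ev_smult)
  have PQ: "ev P = (\<Sum>n\<le>D. of_int (coeff P n) * tt ^ n)" "ev Q = (\<Sum>n\<le>D. of_int (coeff Q n) * tt ^ n)"
    by (rule ev_altdef, simp add: D_def)+
  have expand: "beta ^ e * (ev P * EE + ev Q * V5 EE) =
      (\<Sum>n\<le>D. of_int (coeff P n) * (tt ^ n * beta ^ e * EE) + of_int (coeff Q n) * (tt ^ n * beta ^ e * V5 EE))"
    unfolding PQ sum_distrib_left sum_distrib_right sum.distrib[symmetric]
    by (intro sum.cong refl) (simp add: algebra_simps)
  have "U5 (beta ^ e * (ev P * EE + ev Q * V5 EE)) = (\<Sum>n\<le>D. of_int (coeff P n) * U5 (tt ^ n * beta ^ e * EE)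
      + of_int (coeff Q n) * U5 (tt ^ n * beta ^ e * V5 EE))"
    unfolding expand by (simp only: U5_sum U5_add U5_of_int_mult)
  also have "\<dots> = (\<Sum>n\<le>D. (of_int (coeff P n) * A n + of_int (coeff Q n) * C n) * EE + of_int (coeff P n) * B n * V5 EE)"
    unfolding U by (rule sum.cong[OF refl ring])
  also have "\<dots> = ev (stepP (2 + e) P Q) * EE + ev (stepQ (2 + e) P Q) * V5 EE"
    unfolding step by (simp only: sum.distrib sum_distrib_right distrib_right)
  finally show ?thesis .
qed

text \<open>The divisibility carried through the iteration. The exponents are those that \<open>uu_dvd\<close>, \<open>vv_dvd\<close> and
  \<open>mm_dvd\<close> reproduce with \<open>k\<close> increased by 1, for \<open>c\<close> alternating between 4 and 3. Their gain vanishes for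
  the constant coefficients, where the factor 5 comes from \<open>coeff P 0 + coeff Q 0 = 0\<close>.\<close>

definition stage :: "nat \<Rightarrow> nat \<Rightarrow> int poly \<Rightarrow> int poly \<Rightarrow> bool" where
  "stage c k P Q \<longleftrightarrow> coeff P 0 + coeff Q 0 = 0 \<and> 5 ^ k dvd coeff P 0 \<and>
    (\<forall>n\<ge>1. 5 ^ (k + (5 * n - c) div 2) dvd coeff P n \<and> 5 ^ (k + (5 * n - c) div 2 + 1) dvd coeff Q n)"

lemma stageD:
  assumes "stage c k P Q"
  shows "coeff Q 0 = - coeff P 0" "5 ^ k dvd coeff P 0"
    "n \<ge> 1 \<Longrightarrow> 5 ^ (k + (5 * n - c) div 2) dvd coeff P n"
    "n \<ge> 1 \<Longrightarrow> 5 ^ (k + (5 * n - c) div 2 + 1) dvd coeff Q n"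
  using assms by (auto simp: stage_def add_eq_0_iff)

lemma stage_dvd: "stage c k P Q \<Longrightarrow> 5 ^ k dvd coeff P n \<and> 5 ^ k dvd coeff Q n"
proof -
  assume *: "stage c k P Q"
  show ?thesis
  proof (cases "n = 0")
    case False
    then have "(5::int) ^ k dvd 5 ^ (k + (5 * n - c) div 2)" "(5::int) ^ k dvd 5 ^ (k + (5 * n - c) div 2 + 1)"
      by (intro le_imp_power_dvd; simp)+
    moreover have "n \<ge> 1"
      using False by simp
    ultimately show ?thesis
      using stageD(3,4)[OF *, of n] by (blast intro: dvd_trans)
  qed (use stageD(1,2)[OF *] in auto)
qed

lemma power_dvd_mult:
  fixes x y :: int
  assumes "5 ^ a dvd x" "5 ^ b dvd y" "t \<le> a + b"
  shows "5 ^ t dvd x * y"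
proof -
  have "(5::int) ^ t dvd 5 ^ (a + b)"
    using assms(3) by (rule le_imp_power_dvd)
  also have "\<dots> dvd x * y"
    unfolding power_add using assms(1,2) by (rule mult_dvd_mono)
  finally show ?thesis .
qed

lemma coeff_stepP: "coeff (stepP e P Q) j = (\<Sum>n\<le>max (degree P) (degree Q).
    coeff P n * coeff (uu (6 * n + e)) (j + n) + coeff Q n * coeff (mm (6 * n + e)) (j + n))"
  and coeff_stepQ: "coeff (stepQ e P Q) j = (\<Sum>n\<le>max (degree P) (degree Q).
    coeff P n * coeff (vv (6 * n + e)) (j + n))"
  by (simp_all add: stepP_def stepQ_def coeff_sum coeff_poly_shift)

lemma sum_head_dvd:
  fixes f :: "nat \<Rightarrow> int"
  assumes "d dvd f 0" "\<And>n. n \<in> {1..D} \<Longrightarrow> d dvd f n"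
  shows "d dvd (\<Sum>n\<le>D. f n)"
proof (rule dvd_sum)
  fix n assume "n \<in> {..D}"
  then show "d dvd f n"
    using assms by (cases "n = 0") auto
qed

text \<open>For n > 0 the constant terms cancel by \<open>uu_vv_low\<close> and \<open>mm\<close>
  does not reach them. For n = 0 they are 6 P(0) + Q(0) - 5 P(0) = P(0) + Q(0) if e = 2, and 5 P(0)
  - 5 P(0) if e = 3.\<close>

lemma step_const:
  assumes "coeff Q 0 = - coeff P 0" "e = 2 \<or> e = 3"
  shows "coeff (stepP e P Q) 0 + coeff (stepQ e P Q) 0 = 0"
proof -
  have "coeff P n * coeff (uu (6 * n + e)) n + coeff Q n * coeff (mm (6 * n + e)) n
      + coeff P n * coeff (vv (6 * n + e)) n = 0" for n
  proof (cases "n = 0")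
    case True
    then show ?thesis
      using assms(2) True assms(1) by (auto simp: uvm_init coeff_small simp del: One_nat_def)
  next
    case False
    then have "coeff (uu (6 * n + e)) n = - coeff (vv (6 * n + e)) n" "coeff (mm (6 * n + e)) n = 0"
      using uu_vv_low[of n "6 * n + e"] mm_low[of n "6 * n + e"] assms(2) by (auto simp: eq_neg_iff_add_eq_0)
    then show ?thesis by simp
  qed
  then show ?thesis
    unfolding coeff_stepP coeff_stepQ sum.distrib[symmetric] by (simp add: sum.neutral)
qed

text \<open>Rounding both halves down costs at most 1 in all, and integrality settles the remaining
  1/2; a surplus of 3 is thus enough for one full power of 5, the gain of a step.\<close>

lemma half_sum_bound: "i + 3 \<le> l + m \<Longrightarrow> Suc (i div 2) \<le> l div 2 + m div (2 :: nat)"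
  by linarith

lemma exponent_bounds:
  fixes n j :: nat
  assumes "n \<ge> 1" "j \<ge> 1"
  shows "5 * j - 3 + 3 \<le> 5 * n - 4 + (5 * (j + n) + 2 - (6 * n + 2))"
    "5 * j - 3 + 2 + 3 \<le> 5 * n - 4 + (5 * (j + n) + 4 - (6 * n + 2))"
    "5 * j - 4 + 3 \<le> 5 * n - 3 + (5 * (j + n) + 2 - (6 * n + 3))"
    "5 * j - 4 + 2 + 3 \<le> 5 * n - 3 + (5 * (j + n) + 4 - (6 * n + 3))"
proof -
  obtain n' j' where nj: "n = Suc n'" "j = Suc j'"
    using assms by (metis One_nat_def Suc_le_D)
  show "5 * j - 3 + 3 \<le> 5 * n - 4 + (5 * (j + n) + 2 - (6 * n + 2))"
    "5 * j - 3 + 2 + 3 \<le> 5 * n - 4 + (5 * (j + n) + 4 - (6 * n + 2))"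
    "5 * j - 4 + 3 \<le> 5 * n - 3 + (5 * (j + n) + 2 - (6 * n + 3))"
    "5 * j - 4 + 2 + 3 \<le> 5 * n - 3 + (5 * (j + n) + 4 - (6 * n + 3))"
    unfolding nj by simp_all
qed

text \<open>The bound for \<open>mm\<close> can be one power of 5 weaker than that for
  \<open>uu\<close>; the additional factor 5 in the coefficients of Q makes up for it.\<close>

lemma tail_dvd_P:
  assumes st: "stage c k P Q" and n: "n \<ge> 1"
    and le: "t \<le> k + (5 * n - c) div 2 + (5 * (j + n) + 2 - (6 * n + e)) div 2"
  shows "5 ^ t dvd coeff P n * coeff (uu (6 * n + e)) (j + n) + coeff Q n * coeff (mm (6 * n + e)) (j + n)"
proof (rule dvd_add)
  show "5 ^ t dvd coeff P n * coeff (uu (6 * n + e)) (j + n)"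
    by (rule power_dvd_mult[OF stageD(3)[OF st n] uu_dvd le])
  have "t \<le> k + (5 * n - c) div 2 + 1 + (5 * (j + n) + 1 - (6 * n + e)) div 2"
    using le by linarith
  then show "5 ^ t dvd coeff Q n * coeff (mm (6 * n + e)) (j + n)"
    by (rule power_dvd_mult[OF stageD(4)[OF st n] mm_dvd])
qed

lemma tail_dvd_Q:
  assumes st: "stage c k P Q" and n: "n \<ge> 1"
    and le: "t \<le> k + (5 * n - c) div 2 + (5 * (j + n) + 4 - (6 * n + e)) div 2"
  shows "5 ^ t dvd coeff P n * coeff (vv (6 * n + e)) (j + n)"
  by (rule power_dvd_mult[OF stageD(3)[OF st n] vv_dvd le])

text \<open>In the constant coefficient, n = 0 contributes 6 P(0) + Q(0) = 5 P(0), and n = 1 is the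
  one term to which the exponents give no gain. For j > 0 the terms with n = 0 vanish and
  \<open>exponent_bounds\<close> suffices.\<close>

lemma stage_step_2:
  assumes st: "stage 4 k P Q"
  shows "stage 3 (Suc k) (stepP 2 P Q) (stepQ 2 P Q)"
  unfolding stage_def
proof (intro conjI allI impI)
  note q0 = stageD(1)[OF st]
  show "coeff (stepP 2 P Q) 0 + coeff (stepQ 2 P Q) 0 = 0"
    using q0 by (rule step_const) simp
  \<comment> \<open>The general bound for this coefficient is only 5^0; its actual value 10 supplies
    the missing factor.\<close>
  have "coeff (uu 8) 1 = 25 * coeff (uu 7) 0 + 25 * coeff (uu 6) 0 + 15 * coeff (uu 5) 0 + 5 * coeff (uu 4) 0 + coeff (uu 3) 0"
    unfolding uu_def using urec_step[of _ 3] by simp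
  moreover have "coeff (uu 7) 0 = 0" "coeff (uu 6) 0 = 0" "coeff (uu 5) 0 = 0"
    by (rule uu_low, simp)+
  ultimately have u8: "coeff (uu (6 * 1 + 2)) (0 + 1) = 10"
    by (simp add: uvm_init)
  have m8: "coeff (mm (6 * 1 + 2)) (0 + 1) = 0"
    by (rule mm_low) simp
  have tail: "5 ^ Suc k dvd coeff P n * coeff (uu (6 * n + 2)) (0 + n) + coeff Q n * coeff (mm (6 * n + 2)) (0 + n)"
    if "n \<ge> 1" for n
  proof (cases "n = 1")
    case True
    have "5 ^ Suc k dvd coeff P 1 * 10"
      using stage_dvd[OF st, of 1] by (intro power_dvd_mult[of k _ 1]) simp_all
    then show ?thesis
      unfolding True u8 m8 by simp
  next
    case False
    then show ?thesis
      using that by (intro tail_dvd_P[OF st that]) linarith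
  qed
  have "5 ^ Suc k dvd coeff P 0 * 5"
    using stageD(2)[OF st] by (intro power_dvd_mult[of k _ 1]) simp_all
  then have head: "5 ^ Suc k dvd coeff P 0 * coeff (uu (6 * 0 + 2)) (0 + 0) + coeff Q 0 * coeff (mm (6 * 0 + 2)) (0 + 0)"
    by (simp only: mult_0_right add_0_left add_0_right q0 uvm_init) simp
  show "5 ^ Suc k dvd coeff (stepP 2 P Q) 0"
    unfolding coeff_stepP by (rule sum_head_dvd, rule head, rule tail, simp)
next
  fix j :: nat assume j: "1 \<le> j"
  have P0: "coeff P 0 * coeff (uu (6 * 0 + 2)) (j + 0) + coeff Q 0 * coeff (mm (6 * 0 + 2)) (j + 0) = 0"
    and Q0: "coeff P 0 * coeff (vv (6 * 0 + 2)) (j + 0) = 0"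
    using j by (simp_all only: mult_0_right add_0_left add_0_right uvm_init coeff_small) simp_all
  have le: "Suc k + (5 * j - 3) div 2 \<le> k + (5 * n - 4) div 2 + (5 * (j + n) + 2 - (6 * n + 2)) div 2"
    "Suc k + (5 * j - 3) div 2 + 1 \<le> k + (5 * n - 4) div 2 + (5 * (j + n) + 4 - (6 * n + 2)) div 2" if "n \<ge> 1" for n
  proof -
    from exponent_bounds(1,2)[OF that j, THEN half_sum_bound] show
      "Suc k + (5 * j - 3) div 2 \<le> k + (5 * n - 4) div 2 + (5 * (j + n) + 2 - (6 * n + 2)) div 2"
      "Suc k + (5 * j - 3) div 2 + 1 \<le> k + (5 * n - 4) div 2 + (5 * (j + n) + 4 - (6 * n + 2)) div 2"
      by simp_all
  qed
  show "5 ^ (Suc k + (5 * j - 3) div 2) dvd coeff (stepP 2 P Q) j"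
    unfolding coeff_stepP
  proof (rule sum_head_dvd)
    fix n assume "n \<in> {1..max (degree P) (degree Q)}"
    then have "n \<ge> 1"
      by simp
    then show "5 ^ (Suc k + (5 * j - 3) div 2) dvd
        coeff P n * coeff (uu (6 * n + 2)) (j + n) + coeff Q n * coeff (mm (6 * n + 2)) (j + n)"
      using le(1) by (intro tail_dvd_P[OF st])
  qed (simp only: P0 dvd_0_right)
  show "5 ^ (Suc k + (5 * j - 3) div 2 + 1) dvd coeff (stepQ 2 P Q) j"
    unfolding coeff_stepQ
  proof (rule sum_head_dvd)
    fix n assume "n \<in> {1..max (degree P) (degree Q)}"
    then have "n \<ge> 1"
      by simp
    then show "5 ^ (Suc k + (5 * j - 3) div 2 + 1) dvd coeff P n * coeff (vv (6 * n + 2)) (j + n)"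
      using le(2) by (intro tail_dvd_Q[OF st])
  qed (simp only: Q0 dvd_0_right)
qed

text \<open>Here n = 0 also reaches j = 1, with 125 P(0) + 5 Q(0) = 120 P(0); one factor 5 is enough
  there because (5 - 4) div 2 = 0. The constant coefficient receives 5 P(0) from n = 0, and for n >
  0 the exponents suffice since (5 - 3) div 2 is already 1.\<close>

lemma stage_step_3:
  assumes st: "stage 3 k P Q"
  shows "stage 4 (Suc k) (stepP 3 P Q) (stepQ 3 P Q)"
  unfolding stage_def
proof (intro conjI allI impI)
  note q0 = stageD(1)[OF st]
  show "coeff (stepP 3 P Q) 0 + coeff (stepQ 3 P Q) 0 = 0"
    using q0 by (rule step_const) simp
  have p0: "5 ^ Suc k dvd coeff P 0 * 5"
    using stageD(2)[OF st] by (intro power_dvd_mult[of k _ 1]) simp_all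
  have tail: "5 ^ Suc k dvd coeff P n * coeff (uu (6 * n + 3)) (0 + n) + coeff Q n * coeff (mm (6 * n + 3)) (0 + n)"
    if "n \<ge> 1" for n
    using that by (intro tail_dvd_P[OF st that]) linarith
  have head: "5 ^ Suc k dvd coeff P 0 * coeff (uu (6 * 0 + 3)) (0 + 0) + coeff Q 0 * coeff (mm (6 * 0 + 3)) (0 + 0)"
    using p0 by (simp add: q0 uvm_init)
  show "5 ^ Suc k dvd coeff (stepP 3 P Q) 0"
    unfolding coeff_stepP by (rule sum_head_dvd, rule head, rule tail, simp)
next
  fix j :: nat assume j: "1 \<le> j"
  note q0 = stageD(1)[OF st]
  have P0: "5 ^ (Suc k + (5 * j - 4) div 2) dvd
      coeff P 0 * coeff (uu (6 * 0 + 3)) (j + 0) + coeff Q 0 * coeff (mm (6 * 0 + 3)) (j + 0)"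
  proof (cases "j = 1")
    case True
    have "coeff P 0 * coeff (uu (6 * 0 + 3)) (j + 0) + coeff Q 0 * coeff (mm (6 * 0 + 3)) (j + 0) = coeff P 0 * 120"
      by (simp add: True q0 uvm_init)
    moreover have "5 ^ (Suc k + (5 * j - 4) div 2) dvd coeff P 0 * 120"
      using stageD(2)[OF st] by (intro power_dvd_mult[of k _ 1]) (simp_all add: True)
    ultimately show ?thesis
      by (simp only:)
  next
    case False
    then have "coeff P 0 * coeff (uu (6 * 0 + 3)) (j + 0) + coeff Q 0 * coeff (mm (6 * 0 + 3)) (j + 0) = 0"
      using j by (simp add: uvm_init coeff_small)
    then show ?thesis
      by (simp only: dvd_0_right)
  qed
  have Q0: "coeff P 0 * coeff (vv (6 * 0 + 3)) (j + 0) = 0"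
    using j by (simp add: uvm_init coeff_small)
  have le: "Suc k + (5 * j - 4) div 2 \<le> k + (5 * n - 3) div 2 + (5 * (j + n) + 2 - (6 * n + 3)) div 2"
    "Suc k + (5 * j - 4) div 2 + 1 \<le> k + (5 * n - 3) div 2 + (5 * (j + n) + 4 - (6 * n + 3)) div 2" if "n \<ge> 1" for n
  proof -
    from exponent_bounds(3,4)[OF that j, THEN half_sum_bound] show
      "Suc k + (5 * j - 4) div 2 \<le> k + (5 * n - 3) div 2 + (5 * (j + n) + 2 - (6 * n + 3)) div 2"
      "Suc k + (5 * j - 4) div 2 + 1 \<le> k + (5 * n - 3) div 2 + (5 * (j + n) + 4 - (6 * n + 3)) div 2"
      by simp_all
  qed
  show "5 ^ (Suc k + (5 * j - 4) div 2) dvd coeff (stepP 3 P Q) j"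
    unfolding coeff_stepP
  proof (rule sum_head_dvd)
    fix n assume "n \<in> {1..max (degree P) (degree Q)}"
    then have "n \<ge> 1"
      by simp
    then show "5 ^ (Suc k + (5 * j - 4) div 2) dvd
        coeff P n * coeff (uu (6 * n + 3)) (j + n) + coeff Q n * coeff (mm (6 * n + 3)) (j + n)"
      using le(1) by (intro tail_dvd_P[OF st])
  qed (rule P0)
  show "5 ^ (Suc k + (5 * j - 4) div 2 + 1) dvd coeff (stepQ 3 P Q) j"
    unfolding coeff_stepQ
  proof (rule sum_head_dvd)
    fix n assume "n \<in> {1..max (degree P) (degree Q)}"
    then have "n \<ge> 1"
      by simp
    then show "5 ^ (Suc k + (5 * j - 4) div 2 + 1) dvd coeff P n * coeff (vv (6 * n + 3)) (j + n)"
      using le(2) by (intro tail_dvd_Q[OF st])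
  qed (simp only: Q0 dvd_0_right)
qed

section \<open>Integrality of the series involved\<close>

definition int_coeffs :: "complex fls \<Rightarrow> bool" where
  "int_coeffs f \<longleftrightarrow> (\<exists>g. f = F2L g \<and> (\<forall>n. fps_nth g n \<in> \<int>))"

lemma int_coeffs_add: "int_coeffs f \<Longrightarrow> int_coeffs g \<Longrightarrow> int_coeffs (f + g)"
proof -
  assume "int_coeffs f" "int_coeffs g"
  then obtain f' g' where f': "f = F2L f'" "\<And>n. fps_nth f' n \<in> \<int>" and g': "g = F2L g'" "\<And>n. fps_nth g' n \<in> \<int>"
    by (auto simp: int_coeffs_def)
  have "fps_nth (f' + g') n \<in> \<int>" for n
    using f' g' by simp
  then show ?thesis
    unfolding int_coeffs_def f'(1) g'(1) F2L_simps(2)[symmetric] by blast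
qed

lemma int_coeffs_mult: "int_coeffs f \<Longrightarrow> int_coeffs g \<Longrightarrow> int_coeffs (f * g)"
proof -
  assume "int_coeffs f" "int_coeffs g"
  then obtain f' g' where f': "f = F2L f'" "\<And>n. fps_nth f' n \<in> \<int>" and g': "g = F2L g'" "\<And>n. fps_nth g' n \<in> \<int>"
    by (auto simp: int_coeffs_def)
  have "fps_nth (f' * g') n \<in> \<int>" for n
    unfolding fps_mult_nth using f' g' by (intro Ints_sum Ints_mult)
  then show ?thesis
    unfolding int_coeffs_def f'(1) g'(1) F2L_simps(1)[symmetric] by blast
qed

lemma int_coeffs_unit: "int_unit_fps g \<Longrightarrow> int_coeffs (F2L g)"
  by (auto simp: int_coeffs_def int_unit_fps_def)

lemma F2L_of_int: "F2L (of_int c) = of_int c"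
  by (cases c rule: int_cases2) (simp_all add: F2L_def)

lemma int_coeffs_of_int: "int_coeffs (of_int c)"
  unfolding int_coeffs_def F2L_of_int[symmetric]
  by (rule exI[of _ "of_int c"]) (simp flip: fps_of_int)

lemma int_coeffs_power: "int_coeffs f \<Longrightarrow> int_coeffs (f ^ n)"
proof (induction n)
  case 0
  show ?case using int_coeffs_of_int[of 1] by simp
qed (simp add: int_coeffs_mult)

lemma int_coeffs_nth: "int_coeffs f \<Longrightarrow> fls_nth f n \<in> \<int>"
  by (auto simp: int_coeffs_def F2L_def)

lemma int_unit_fps_compose:
  "m > 0 \<Longrightarrow> int_unit_fps f \<Longrightarrow> int_unit_fps (f oo fps_X ^ m)"
  by (simp add: int_unit_fps_def fps_nth_compose_X_power)

lemma int_unit_qX: "i > 0 \<Longrightarrow> m > 0 \<Longrightarrow> int_unit_fps (qX i m)"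
  by (rule qpoch_inf_fps(2)) auto

lemma int_unit_theta: "int_unit_fps (theta (- 1) 1 1)"
  using phi_product[of 1] int_unit_qX[of 1 2] int_unit_qX[of 2 2]
  by (simp add: int_unit_fps_mult int_unit_fps_power)

lemma int_coeffs_phi: "int_coeffs EE" "int_coeffs (V5 EE)"
  and int_coeffs_P2: "int_coeffs (1 / P2)" "int_coeffs (1 / V5 P2)"
  and int_coeffs_tt: "int_coeffs tt"
proof -
  note P = int_unit_qX[of 2 2]
  have P2: "int_unit_fps (qX 2 2)" "int_unit_fps (qX 2 2 oo fps_X ^ 5)"
    using P by (simp_all add: int_unit_fps_compose)
  then have n0: "fps_nth (qX 2 2) 0 \<noteq> 0" "fps_nth (qX 2 2 oo fps_X ^ 5) 0 \<noteq> 0"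
    by (simp_all add: int_unit_fps_def)
  show "int_coeffs EE" "int_coeffs (V5 EE)"
    unfolding phi_def V5_simps F2L_compose[symmetric] F2L_simps(4)[symmetric]
    by (intro int_coeffs_unit int_unit_fps_power int_unit_fps_compose int_unit_theta; simp)+
  show inv: "int_coeffs (1 / P2)" "int_coeffs (1 / V5 P2)"
    unfolding P2_def F2L_compose[symmetric] F2L_simps(7)[symmetric] F2L_divide[OF n0(1)] F2L_divide[OF n0(2)]
    using P2 by (auto intro!: int_coeffs_unit int_unit_fps_inverse)
  have "int_coeffs (V5 P2)"
    unfolding P2_def F2L_compose[symmetric] using P2 by (intro int_coeffs_unit)
  moreover have "int_coeffs qL"
    unfolding int_coeffs_def by (rule exI[of _ fps_X]) (simp add: F2L_simps fps_X_nth)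
  moreover have "tt = qL ^ 2 * V5 P2 ^ 6 * (1 / P2) ^ 6"
    using P2_nonzero by (simp add: tt_def power_one_over)
  ultimately show "int_coeffs tt"
    using inv by (metis int_coeffs_mult int_coeffs_power)
qed

lemma int_coeffs_ev: "int_coeffs (ev p)"
proof (induction p)
  case 0
  show ?case using int_coeffs_of_int[of 0] by simp
next
  case (pCons a p)
  then show ?case
    by (simp add: int_coeffs_add int_coeffs_mult int_coeffs_of_int int_coeffs_tt)
qed

lemma fls_nth_of_int_mult: "fls_nth (of_int c * f) n = of_int c * fls_nth f n"
  by simp

lemma stage_int_coeffs:
  assumes st: "stage c k P Q" and r: "int_coeffs r"
  shows "\<exists>z. fls_nth ((ev P * EE + ev Q * V5 EE) * r) m = of_int (5 ^ k * z)"
proof -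
  have ring: "((x * a) * E + (x * b) * V) * s = x * ((a * E + b * V) * s)" for x a b E V s :: "complex fls"
    by (simp add: algebra_simps)
  have "[:5 ^ k:] dvd P" "[:5 ^ k:] dvd Q"
    using stage_dvd[OF st] by (auto simp: const_poly_dvd_iff)
  then obtain P' Q' where P': "P = smult (5 ^ k) P'" "Q = smult (5 ^ k) Q'"
    by (auto elim!: dvdE)
  have "int_coeffs ((ev P' * EE + ev Q' * V5 EE) * r)"
    using r by (intro int_coeffs_mult int_coeffs_add int_coeffs_ev int_coeffs_phi)
  then obtain z where z: "fls_nth ((ev P' * EE + ev Q' * V5 EE) * r) m = of_int z"
    using int_coeffs_nth by (blast elim: Ints_cases)
  have "(ev P * EE + ev Q * V5 EE) * r = of_int (5 ^ k) * ((ev P' * EE + ev Q' * V5 EE) * r)"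
    unfolding P' ev_smult by (rule ring)
  then have "fls_nth ((ev P * EE + ev Q * V5 EE) * r) m = of_int (5 ^ k * z)"
    unfolding of_int_mult z[symmetric] by (simp only: fls_nth_of_int_mult)
  then show ?thesis ..
qed

section \<open>The coefficients of K along the progressions\<close>

definition KK :: "complex fls" where "KK = EE / P2"

lemma qL_power_mult_nth: "fls_nth (qL ^ n * f) m = fls_nth f (m - int n)"
  by (simp add: qL_def fls_X_power_times_conv_shift)

text \<open>Multiplication by q^2 turns 1 / \<open>P2\<close> into \<open>beta\<close> over a series
  in q^25, which \<open>U5\<close> releases as 1 / \<open>V5 P2\<close>. In
  \<open>U5_even_stage\<close> the denominator is itself a series in q^5, so neither a shift nor
  \<open>beta\<close> occurs.\<close>

lemma U5_odd_stage: "U5 (qL ^ 2 * (F / P2)) = U5 (beta ^ 1 * F) / V5 P2"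
proof -
  have "qL ^ 2 * (F / P2) = V5 (1 / V5 P2) * (beta ^ 1 * F)"
    using P2_nonzero by (simp add: beta_def bb_def)
  then show ?thesis
    by (simp only: U5_V5_mult) simp
qed

lemma U5_even_stage: "U5 (F / V5 P2) = U5 (beta ^ 0 * F) / P2"
  using U5_V5_mult[of "1 / P2" F] by simp

lemma U5_odd_step: "fls_nth (U5 (beta ^ 1 * F) / V5 P2) m = fls_nth (F / P2) (5 * m - 2)"
  unfolding U5_odd_stage[symmetric] U5_nth qL_power_mult_nth by simp

lemma U5_even_step: "fls_nth (U5 (beta ^ 0 * F) / P2) m = fls_nth (F / V5 P2) (5 * m)"
  unfolding U5_even_stage[symmetric] U5_nth ..

text \<open>The hypothesis means c = 2 (1 + 25 + ... + 25^k). An induction step applies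
  \<open>U5\<close> twice, once without a shift and once with the shift by 2, which adds 2 *
  5^(2k+2) to c.\<close>

lemma stages:
  fixes c :: int
  assumes "12 * c = 5 ^ (2 * k + 2) - 1"
  shows "\<exists>P Q. stage 4 (2 * k + 1) P Q \<and>
    (\<forall>m. fls_nth ((ev P * EE + ev Q * V5 EE) / V5 P2) m = fls_nth KK (5 ^ (2 * k + 1) * m - c))"
  using assms
proof (induction k arbitrary: c)
  case 0
  have "U5 (beta ^ 1 * EE) = ev (uu 3) * EE + ev (vv 3) * V5 EE"
    using U5_beta_E[of 3] by (simp add: bb_beta)
  then have "fls_nth ((ev (uu 3) * EE + ev (vv 3) * V5 EE) / V5 P2) m = fls_nth KK (5 * m - 2)" for m
    using U5_odd_step[of EE m] unfolding KK_def by (simp only:)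
  moreover have "stage 4 1 (uu 3) (vv 3)"
    by (auto simp: stage_def uvm_init coeff_small)
  moreover have "c = 2"
    using 0 by simp
  ultimately show ?case
    by (intro exI[of _ "uu 3"] exI[of _ "vv 3"]) simp
next
  case (Suc k)
  define d :: int where "d = c - 2 * 5 ^ (2 * k + 2)"
  have "12 * d = 5 ^ (2 * k + 2) - 1"
    using Suc.prems by (simp add: d_def power_add)
  from Suc.IH[OF this] obtain P Q where st: "stage 4 (2 * k + 1) P Q" and
    nth: "\<And>m. fls_nth ((ev P * EE + ev Q * V5 EE) / V5 P2) m = fls_nth KK (5 ^ (2 * k + 1) * m - d)"
    by blast
  have two_plus_one: "(2 :: nat) + 1 = 3"
    by simp
  define P' Q' P'' Q'' where "P' = stepP 2 P Q" "Q' = stepQ 2 P Q" "P'' = stepP 3 P' Q'" "Q'' = stepQ 3 P' Q'"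
  note defs = this
  have st': "stage 4 (2 * Suc k + 1) P'' Q''"
    using stage_step_3[OF stage_step_2[OF st]] by (simp add: defs)
  have nth': "fls_nth ((ev P' * EE + ev Q' * V5 EE) / P2) m = fls_nth KK (5 ^ (2 * k + 1) * (5 * m) - d)" for m
    using U5_even_step[of "ev P * EE + ev Q * V5 EE" m] unfolding U5_step nth defs add_0_right .
  note st'
  moreover have "fls_nth ((ev P'' * EE + ev Q'' * V5 EE) / V5 P2) m = fls_nth KK (5 ^ (2 * k + 1) * (5 * (5 * m - 2)) - d)" for m
    using U5_odd_step[of "ev P' * EE + ev Q' * V5 EE" m] unfolding U5_step two_plus_one defs(3,4) nth' .
  moreover have "5 ^ (2 * k + 1) * (5 * (5 * m - 2)) - d = 5 ^ (2 * Suc k + 1) * m - c" for m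
    by (simp add: d_def power_add algebra_simps)
  ultimately show ?case by metis
qed

lemma KK_nth_odd:
  assumes "12 * c = 5 ^ (2 * k + 2) - 1"
  shows "\<exists>z. fls_nth KK (5 ^ (2 * k + 1) * m - c) = of_int (5 ^ (2 * k + 1) * z)"
proof -
  from stages[OF assms] obtain P Q where st: "stage 4 (2 * k + 1) P Q" and
    nth: "\<And>m. fls_nth ((ev P * EE + ev Q * V5 EE) / V5 P2) m = fls_nth KK (5 ^ (2 * k + 1) * m - c)"
    by blast
  show ?thesis
    using stage_int_coeffs[OF st int_coeffs_P2(2), of m] unfolding nth[symmetric] by simp
qed

lemma KK_nth_even:
  assumes "12 * c = 5 ^ (2 * k + 2) - 1"
  shows "\<exists>z. fls_nth KK (5 ^ (2 * k + 2) * m - c) = of_int (5 ^ (2 * k + 2) * z)"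
proof -
  from stages[OF assms] obtain P Q where st: "stage 4 (2 * k + 1) P Q" and
    nth: "\<And>m. fls_nth ((ev P * EE + ev Q * V5 EE) / V5 P2) m = fls_nth KK (5 ^ (2 * k + 1) * m - c)"
    by blast
  have "fls_nth ((ev (stepP 2 P Q) * EE + ev (stepQ 2 P Q) * V5 EE) / P2) m = fls_nth KK (5 ^ (2 * k + 1) * (5 * m) - c)"
    using U5_even_step[of "ev P * EE + ev Q * V5 EE" m] unfolding U5_step nth add_0_right .
  moreover have "(5::int) ^ (2 * k + 1) * (5 * m) = 5 ^ (2 * k + 2) * m"
    by simp
  ultimately have "fls_nth ((ev (stepP 2 P Q) * EE + ev (stepQ 2 P Q) * V5 EE) * (1 / P2)) m
      = fls_nth KK (5 ^ (2 * k + 2) * m - c)"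
    by (simp only: times_divide_eq_right mult_1_right)
  moreover have "Suc (2 * k + 1) = 2 * k + 2"
    by simp
  ultimately show ?thesis
    using stage_int_coeffs[OF stage_step_2[OF st] int_coeffs_P2(1), of m] by (simp only:)
qed

section \<open>Sums of four squares\<close>

lemma XD_mult: "fps_XD (f * g) = f * fps_XD g + fps_XD f * g" for f g :: "complex fps"
  by (simp add: fps_XD_def algebra_simps)

lemma log_XD_mult:
  fixes f g :: "complex fps"
  assumes "fps_XD f = l * f" "fps_XD g = k * g"
  shows "fps_XD (f * g) = (l + k) * (f * g)"
  unfolding XD_mult assms by (simp add: algebra_simps)

lemma log_XD_power:
  fixes f :: "complex fps"
  assumes "fps_XD f = l * f"
  shows "fps_XD (f ^ n) = of_nat n * l * f ^ n"
proof (induction n)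
  case 0
  show ?case by (simp add: fps_XD_def)
next
  case (Suc n)
  then show ?case
    using log_XD_mult[OF assms Suc] by (simp add: algebra_simps)
qed

lemma log_XD_cancel:
  fixes f g :: "complex fps"
  assumes "fps_XD (f * g) = m * (f * g)" "fps_XD g = k * g" "g \<noteq> 0"
  shows "fps_XD f = (m - k) * f"
proof -
  have "(fps_XD f - (m - k) * f) * g = 0"
    using assms(1) unfolding XD_mult assms(2) by (simp add: algebra_simps)
  then show ?thesis
    using assms(3) by simp
qed

lemma fps_mult_inverse_eqI:
  fixes x y a :: "complex fps"
  assumes "fps_nth y 0 \<noteq> 0" "y * a = x"
  shows "x * inverse y = a"
proof -
  have "x * inverse y = (inverse y * y) * a"
    unfolding assms(2)[symmetric] by (simp only: mult_ac)
  then show ?thesis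
    using assms(1) by (simp add: inverse_mult_eq_1)
qed

lemma dvd_diff_self_iff: "d \<le> j \<Longrightarrow> d dvd j - d \<longleftrightarrow> d dvd j"
  for d j :: nat
  by (metis dvd_diffD dvd_diff_nat dvd_refl)

lemma fps_nth_X_power_geometric:
  assumes "d > 0"
  shows "fps_nth (fps_X ^ d * inverse (1 - fps_X ^ d)) j = (if j > 0 \<and> d dvd j then 1 else (0::complex))"
proof -
  have "(1 - fps_X ^ d) * Abs_fps (\<lambda>j. if j > 0 \<and> d dvd j then 1 else 0) = (fps_X ^ d :: complex fps)"
    using assms dvd_diff_self_iff[of d]
    by (auto simp: fps_eq_iff algebra_simps fps_X_power_mult_nth fps_X_power_nth dest: dvd_imp_le)
  then have "fps_X ^ d * inverse (1 - fps_X ^ d) = Abs_fps (\<lambda>j. if j > 0 \<and> d dvd j then 1 else (0::complex))"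
    by (intro fps_mult_inverse_eqI) (simp_all add: assms)
  then show ?thesis
    by simp
qed

lemma fps_nth_X_power_geometric2:
  assumes "d > 0"
  shows "fps_nth (fps_X ^ d * inverse ((1 - fps_X ^ d) ^ 2)) j = (if d dvd j then of_nat (j div d) else (0::complex))"
proof -
  define a where "a = Abs_fps (\<lambda>j. if d dvd j then of_nat (j div d) else (0::complex))"
  have "(1 - fps_X ^ d) * a = fps_X ^ d * inverse (1 - fps_X ^ d)"
  proof (rule fps_ext)
    fix j
    have "j div d = Suc ((j - d) div d)" if "d \<le> j"
      using that assms by (simp add: le_div_geq)
    then show "fps_nth ((1 - fps_X ^ d) * a) j = fps_nth (fps_X ^ d * inverse (1 - fps_X ^ d)) j"
      unfolding fps_nth_X_power_geometric[OF assms] using assms dvd_diff_self_iff[of d j]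
      by (auto simp: a_def algebra_simps fps_X_power_mult_nth dest: dvd_imp_le)
  qed
  then have "fps_X ^ d * inverse (1 - fps_X ^ d) * inverse (1 - fps_X ^ d) = a"
    by (intro fps_mult_inverse_eqI) (simp_all add: assms)
  then have "fps_X ^ d * inverse ((1 - fps_X ^ d) ^ 2) = a"
    by (simp add: power2_eq_square fps_inverse_mult mult.assoc)
  then show ?thesis
    by (simp add: a_def)
qed

text \<open>The coefficient at 0 vanishes because the sum over an infinite set is 0.\<close>

definition divisor_series :: "nat \<Rightarrow> complex fps" where
  "divisor_series m = Abs_fps (\<lambda>j. \<Sum>d | m * d dvd j. of_nat d)"

lemma XD_qfin:
  assumes "m > 0"
  shows "fps_XD (qfin (fps_X ^ m) (fps_X ^ m) n)
    = - (\<Sum>k<n. of_nat (m * Suc k) * (fps_X ^ (m * Suc k) * inverse (1 - fps_X ^ (m * Suc k)))) * qfin (fps_X ^ m) (fps_X ^ m) n"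
proof (induction n)
  case 0
  show ?case by (simp add: fps_XD_def)
next
  case (Suc n)
  define d where "d = m * Suc n"
  have d: "d > 0"
    using assms by (simp add: d_def)
  have "fps_XD (1 - fps_X ^ d :: complex fps) = - (of_nat d * fps_X ^ d)"
    using d by (auto simp: fps_eq_iff fps_X_power_nth simp flip: fps_of_nat)
  also have "\<dots> = - (of_nat d * (fps_X ^ d * inverse (1 - fps_X ^ d))) * (1 - fps_X ^ d)"
    using d inverse_mult_eq_1[of "1 - fps_X ^ d :: complex fps"] by (simp add: mult.assoc)
  finally have "fps_XD (1 - fps_X ^ d :: complex fps) = - (of_nat d * (fps_X ^ d * inverse (1 - fps_X ^ d))) * (1 - fps_X ^ d)" .
  from log_XD_mult[OF Suc.IH this] show ?case
    unfolding qfin_Suc sum.lessThan_Suc d_def by (simp add: power_add power_mult algebra_simps)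
qed

text \<open>The logarithmic derivative of the product is a Lambert series. The coefficient at j is
  read off from the first j factors, so no infinite sum of series has to be formed.\<close>

lemma XD_qX:
  assumes m: "m > 0"
  shows "fps_XD (qX m m) = - (of_nat m * divisor_series m) * qX m m"
proof (rule fps_ext)
  fix j
  let ?L = "\<Sum>k<j. of_nat (m * Suc k) * (fps_X ^ (m * Suc k) * inverse (1 - fps_X ^ (m * Suc k))) :: complex fps"
  have Q: "fps_nth (qX m m) i = fps_nth (qfin (fps_X ^ m) (fps_X ^ m) j) i" if "i \<le> j" for i
    using m that by (intro qpoch_inf_nth) auto
  have L: "fps_nth ?L i = fps_nth (of_nat m * divisor_series m) i" if "i \<le> j" for i
  proof (cases "i = 0")
    case True
    then show ?thesis
      using m by (simp add: divisor_series_def fps_sum_nth fps_mult_nth_0)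
  next
    case False
    have "fps_nth ?L i = (\<Sum>k<j. if m * Suc k dvd i then of_nat (m * Suc k) else 0)"
      unfolding fps_sum_nth
      using m False by (intro sum.cong refl) (simp add: fps_nth_X_power_geometric flip: fps_of_nat del: of_nat_mult mult_Suc_right of_nat_Suc)
    also have "\<dots> = (\<Sum>d\<in>Suc ` {..<j}. if m * d dvd i then of_nat (m * d) else 0)"
      by (simp add: sum.reindex)
    also have "\<dots> = (\<Sum>d\<in>{d. m * d dvd i}. of_nat (m * d))"
    proof (intro sum.mono_neutral_cong_right)
      show "{d. m * d dvd i} \<subseteq> Suc ` {..<j}"
      proof
        fix d assume "d \<in> {d. m * d dvd i}"
        then have "m * d dvd i" by simp
        then have "m * d \<le> i" "d > 0"
          using False by (auto intro: dvd_imp_le Nat.gr0I)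
        moreover have "1 * d \<le> m * d"
          using m by (intro mult_right_mono) auto
        ultimately have "d = Suc (d - 1)" "d - 1 < j"
          using that by linarith+
        then show "d \<in> Suc ` {..<j}"
          by blast
      qed
    qed auto
    finally show ?thesis
      by (simp add: divisor_series_def sum_distrib_left flip: fps_of_nat)
  qed
  have "fps_nth (fps_XD (qX m m)) j = fps_nth (fps_XD (qfin (fps_X ^ m) (fps_X ^ m) j)) j"
    by (simp add: Q)
  also have "\<dots> = - fps_nth (?L * qfin (fps_X ^ m) (fps_X ^ m) j) j"
    unfolding XD_qfin[OF m] by simp
  also have "fps_nth (?L * qfin (fps_X ^ m) (fps_X ^ m) j) j = fps_nth (of_nat m * divisor_series m * qX m m) j"
    unfolding fps_mult_nth[of ?L] fps_mult_nth[of "of_nat m * divisor_series m"]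
    by (intro sum.cong refl arg_cong2[where f = "(*)"] L Q[symmetric]) auto
  finally show "fps_nth (fps_XD (qX m m)) j = fps_nth (- (of_nat m * divisor_series m) * qX m m) j"
    by simp
qed

lemma texp_2_0: "int (texp 2 0 n) = n * (n + 1)"
  using texp_eq[of 2 0 n] by simp

lemma fps_nth_numeral_mult: "fps_nth (numeral k * f) n = numeral k * fps_nth f n"
  for f :: "complex fps"
  by (simp add: numeral_fps_const)

text \<open>Square Jacobi's identity for the cube and substitute \<open>(m, n) = (r + s, r - s)\<close> or
  \<open>(m, n) = (r + s, s - r - 1)\<close> according to the parity of \<open>m - n\<close>; both halves give the same series (Hirschhorn).\<close>

lemma euler_sixth_power:
  defines "Psi \<equiv> lsum UNIV (texp 2 0) (\<lambda>_. 1)" and "Phi \<equiv> lsum UNIV (texp 1 1) (\<lambda>_. 1)"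
  shows "2 * qX 1 1 ^ 6 = (4 * fps_XD Psi + Psi) * Phi - 4 * (Psi * fps_XD Phi)"
proof -
  let ?e = "\<lambda>(m, n). texp 1 0 m + texp 1 0 n"
  let ?c = "\<lambda>(m, n). ((- 1) ^ nat \<bar>m\<bar> * of_int (2 * m + 1)) * ((- 1) ^ nat \<bar>n\<bar> * of_int (2 * n + 1)) :: complex"
  let ?h = "\<lambda>r (a, b). (a + b + r, a - b) :: int \<times> int"
  let ?E = "\<lambda>(a, b). texp 2 0 a + texp 1 1 b"
  let ?C = "\<lambda>(a, b). of_int ((2 * a + 1)\<^sup>2 - 4 * b\<^sup>2) :: complex"
  have regroup: "(s * x) * (t * y) = u * v" if "s * t = u" "x * y = v" for s t u v x y :: complex
    using that by (metis mult.assoc mult.left_commute)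
  have fin: "finite_fibres UNIV (texp 1 0)" "finite_fibres UNIV (texp 2 0)" "finite_fibres UNIV (texp 1 1)"
  proof -
    show "finite_fibres UNIV (texp 2 0)"
    proof (rule finite_fibres_intI)
      fix n :: int
      have "0 \<le> (\<bar>n\<bar> - 1) * (\<bar>n\<bar> - 1)"
        by simp
      then have "2 * \<bar>n\<bar> \<le> n * n + 1"
        by (simp add: algebra_simps)
      then show "\<bar>n\<bar> \<le> int (texp 2 0 n) + 1"
        unfolding texp_2_0 by (simp add: algebra_simps)
    qed
  qed (rule finite_fibres_texp_1_0, rule finite_fibres_texp, simp_all)
  have "4 * qX 1 1 ^ 6 = (2 * qX 1 1 ^ 3) * (2 * qX 1 1 ^ 3)"
    by (simp flip: power_add)
  also have "\<dots> = lsum UNIV ?e ?c"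
    unfolding power_one_right jacobi_cube by (subst lsum_mult[OF fin(1) fin(1)]) simp
  also have "\<dots> = (\<Sum>r\<in>{0, 1}. lsum UNIV (\<lambda>m. ?e (?h r m)) (\<lambda>m. ?c (?h r m)))"
    using finite_fibres_times[OF fin(1) fin(1)] by (intro lsum_decompose[OF _ bij_betw_parity]) auto
  also have "\<dots> = lsum UNIV (\<lambda>m. ?e (?h 0 m)) (\<lambda>m. ?c (?h 0 m)) + lsum UNIV (\<lambda>m. ?e (?h 1 m)) (\<lambda>m. ?c (?h 1 m))"
    by simp
  also have "lsum UNIV (\<lambda>m. ?e (?h 0 m)) (\<lambda>m. ?c (?h 0 m)) = lsum UNIV ?E ?C"
  proof (intro lsum_cong refl)
    fix m :: "int \<times> int"
    obtain a b where m: "m = (a, b)" by force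
    have "texp 1 0 (a + b + 0) + texp 1 0 (a - b) = texp 2 0 a + texp 1 1 b"
      by (rule of_nat_double_cancel) (simp only: of_nat_add distrib_left[of "2::int"] texp_eq; simp add: algebra_simps)
    then show "?e (?h 0 m) = ?E m"
      by (simp add: m)
    have "(2 * (a + b + 0) + 1) * (2 * (a - b) + 1) = (2 * a + 1)\<^sup>2 - 4 * b\<^sup>2"
      by (simp add: algebra_simps power2_eq_square)
    then have "of_int (2 * (a + b + 0) + 1) * of_int (2 * (a - b) + 1) = (of_int ((2 * a + 1)\<^sup>2 - 4 * b\<^sup>2) :: complex)"
      by (simp only: flip: of_int_mult)
    moreover have "(- 1) ^ nat \<bar>a + b + 0\<bar> * (- 1) ^ nat \<bar>a - b\<bar> = (1 :: complex)"
      unfolding sign_power_abs_minus by simp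
    ultimately have "((- 1) ^ nat \<bar>a + b + 0\<bar> * of_int (2 * (a + b + 0) + 1)) * ((- 1) ^ nat \<bar>a - b\<bar> * of_int (2 * (a - b) + 1))
        = (1 :: complex) * of_int ((2 * a + 1)\<^sup>2 - 4 * b\<^sup>2)"
      by (intro regroup)
    then show "?c (?h 0 m) = ?C m"
      unfolding m prod.case mult_1 .
  qed
  also have "lsum UNIV (\<lambda>m. ?e (?h 1 m)) (\<lambda>m. ?c (?h 1 m)) = lsum UNIV ?E ?C"
  proof (rule lsum_reindex[symmetric, of "\<lambda>(a, b). (b, a + 1)"])
    show "bij_betw (\<lambda>(a, b). (b, a + 1)) UNIV (UNIV :: (int \<times> int) set)"
      by (rule bij_betw_byWitness[of _ "\<lambda>(a, b). (b - 1, a)"]) auto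
    fix m :: "int \<times> int"
    obtain a b where m: "m = (a, b)" by force
    have "texp 1 0 (a + b + 1) + texp 1 0 (a - b) = texp 2 0 b + texp 1 1 (a + 1)"
      by (rule of_nat_double_cancel) (simp only: of_nat_add distrib_left[of "2::int"] texp_eq; simp add: algebra_simps)
    then show "?E (case m of (a, b) \<Rightarrow> (b, a + 1)) = ?e (?h 1 m)"
      by (simp add: m)
    have "(2 * (a + b + 1) + 1) * (2 * (a - b) + 1) = - ((2 * b + 1)\<^sup>2 - 4 * (a + 1)\<^sup>2)"
      by (simp add: algebra_simps power2_eq_square)
    then have "of_int (2 * (a + b + 1) + 1) * of_int (2 * (a - b) + 1) = - (of_int ((2 * b + 1)\<^sup>2 - 4 * (a + 1)\<^sup>2) :: complex)"
      by (simp only: flip: of_int_mult of_int_minus)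
    moreover have "(- 1) ^ nat \<bar>a + b + 1\<bar> * (- 1) ^ nat \<bar>a - b\<bar> = (- 1 :: complex)"
      unfolding sign_power_abs_minus by simp
    ultimately have "((- 1) ^ nat \<bar>a + b + 1\<bar> * of_int (2 * (a + b + 1) + 1)) * ((- 1) ^ nat \<bar>a - b\<bar> * of_int (2 * (a - b) + 1))
        = (- 1 :: complex) * - of_int ((2 * b + 1)\<^sup>2 - 4 * (a + 1)\<^sup>2)"
      by (intro regroup)
    then show "?C (case m of (a, b) \<Rightarrow> (b, a + 1)) = ?c (?h 1 m)"
      unfolding m prod.case by (simp only: minus_mult_minus mult_1)
  qed
  finally have six: "4 * qX 1 1 ^ 6 = 2 * lsum UNIV ?E ?C"
    by simp
  \<comment> \<open>Since (2 a + 1)^2 = 4 a (a + 1) + 1, the quadratic weights are linear in the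
    exponents and become derivatives of the two theta series.\<close>
  have split: "?C p = (\<lambda>(a, b). (4 * (of_nat (texp 2 0 a) * 1) + 1) * 1) p + (- 4) * (\<lambda>(a, b). 1 * (of_nat (texp 1 1 b) * 1)) p" for p
  proof -
    obtain a b where p: "p = (a, b)" by force
    have "(2 * a + 1)\<^sup>2 - 4 * b\<^sup>2 = 4 * int (texp 2 0 a) + 1 - 4 * int (texp 1 1 b)"
      unfolding texp_2_0 int_texp_1_1 by (simp add: algebra_simps power2_eq_square)
    then have "of_int ((2 * a + 1)\<^sup>2 - 4 * b\<^sup>2) = (of_int (4 * int (texp 2 0 a) + 1 - 4 * int (texp 1 1 b)) :: complex)"
      by (simp only:)
    then show ?thesis
      unfolding p by simp
  qed
  have "lsum UNIV ?E ?C = (4 * fps_XD Psi + Psi) * Phi - 4 * (Psi * fps_XD Phi)"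
  proof -
    have "lsum UNIV ?E ?C = lsum UNIV ?E (\<lambda>(a, b). (4 * (of_nat (texp 2 0 a) * 1) + 1) * 1)
        + fps_const (- 4) * lsum UNIV ?E (\<lambda>(a, b). 1 * (of_nat (texp 1 1 b) * 1))"
      unfolding split lsum_add lsum_const_mult ..
    also have "lsum UNIV ?E (\<lambda>(a, b). (4 * (of_nat (texp 2 0 a) * 1) + 1) * 1)
        = lsum UNIV (texp 2 0) (\<lambda>a. 4 * (of_nat (texp 2 0 a) * 1) + 1) * Phi"
      unfolding Phi_def by (subst lsum_mult[OF fin(2) fin(3)]) simp
    also have "lsum UNIV (texp 2 0) (\<lambda>a. 4 * (of_nat (texp 2 0 a) * 1) + 1) = fps_const 4 * fps_XD Psi + Psi"
      unfolding Psi_def lsum_add lsum_const_mult lsum_XD ..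
    also have "lsum UNIV ?E (\<lambda>(a, b). 1 * (of_nat (texp 1 1 b) * 1)) = Psi * fps_XD Phi"
      unfolding Psi_def Phi_def lsum_XD[symmetric] by (subst lsum_mult[OF fin(2) fin(3)]) simp
    finally show ?thesis
      by (simp flip: numeral_fps_const fps_const_neg)
  qed
  moreover have "2 * x = y" if "4 * x = 2 * y" for x y :: "complex fps"
  proof -
    have "4 * fps_nth x n = 2 * fps_nth y n" for n
      using arg_cong[OF that, of "\<lambda>f. fps_nth f n"] unfolding fps_nth_numeral_mult .
    then show ?thesis
      by (simp add: fps_eq_iff fps_nth_numeral_mult)
  qed
  ultimately show ?thesis
    using six by metis
qed

text \<open>Jacobi's four-square theorem at -q. The theta series of \<open>euler_sixth_power\<close>
  are, up to constants, quotients of products of a, b and c, so their logarithmic derivatives are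
  divisor series. Dividing by Psi Phi leaves a^8 / b^4, the fourth power of a^2 / b =
  phi(-q).\<close>

lemma phi_fourth_power:
  "theta (- 1) 1 1 ^ 4 = 1 - 8 * divisor_series 1 + 48 * divisor_series 2 - 64 * divisor_series 4"
proof -
  define a b c o' p where "a = qX 1 1" "b = qX 2 2" "c = qX 4 4" "o' = qX 1 2" "p = qX 2 4"
  note defs = this
  have nz: "a \<noteq> 0" "b \<noteq> 0" "c \<noteq> 0" "o' \<noteq> 0" "p \<noteq> 0"
    unfolding defs by (rule qX_nonzero; simp)+
  define Psi Phi where "Psi = theta 1 2 6" "Phi = theta 1 1 1"
  note PP = this
  have a: "a = o' * b" and b: "b = p * c"
    using qX_split2[of 1 1, unfolded one_add_one mult_1] qX_split2[of 2 2] by (simp_all add: defs)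
  have "Psi * p = c"
    using psi_product[of 2] by (simp add: defs PP)
  then have Psi: "Psi * b = c ^ 2"
    by (simp add: b power2_eq_square algebra_simps)
  have "Phi * o' ^ 2 = (o' * qpoch_inf (- (fps_X ^ 1)) (fps_X ^ 2)) ^ 2 * b"
    unfolding PP defs by (subst theta_plus_eq) (simp_all add: power2_eq_square mult_ac)
  also have "o' * qpoch_inf (- (fps_X ^ 1)) (fps_X ^ 2) = p"
    using qX_mult_minus[of 1 2] by (simp add: defs)
  finally have "Phi * (o' * b) ^ 2 * c ^ 2 = (p * c) ^ 2 * b ^ 3"
    by (simp add: power_mult_distrib eval_nat_numeral mult_ac)
  then have Phi: "Phi * (a ^ 2 * c ^ 2) = b ^ 5"
    unfolding a[symmetric] b[symmetric] by (simp add: eval_nat_numeral mult_ac)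
  have phi: "theta (- 1) 1 1 * b = a ^ 2"
    using phi_product[of 1] by (simp add: a defs eval_nat_numeral mult_ac)
  define A B C where "A = divisor_series 1" "B = 2 * divisor_series 2" "C = 4 * divisor_series 4"
  note ABC = this
  have XD: "fps_XD a = - A * a" "fps_XD b = - B * b" "fps_XD c = - C * c"
    unfolding defs ABC using XD_qX[of 1] XD_qX[of 2] XD_qX[of 4] by simp_all
  have XD_Psi: "fps_XD Psi = (of_nat 2 * - C - - B) * Psi"
    by (rule log_XD_cancel[OF _ XD(2) nz(2)]) (simp only: Psi log_XD_power[OF XD(3)])
  have XD_Phi: "fps_XD Phi = (of_nat 5 * - B - (of_nat 2 * - A + of_nat 2 * - C)) * Phi"
    by (rule log_XD_cancel[OF _ log_XD_mult[OF log_XD_power[OF XD(1)] log_XD_power[OF XD(3)]]])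
      (simp only: Phi log_XD_power[OF XD(2)], simp add: nz)
  have "lsum UNIV (texp 2 0) (\<lambda>_. 1) = lsum UNIV (texp 1 0) (\<lambda>_. 1) oo fps_X ^ 2"
    unfolding lsum_compose[symmetric, OF zero_less_numeral]
    by (intro lsum_cong refl texp_eqI) (simp add: texp_eq)
  also have "\<dots> = 2 * Psi"
    unfolding psi_eq PP using theta_compose[of 2 1 1 3] by (simp add: fps_compose_mult_distrib)
  finally have Psi_eq: "lsum UNIV (texp 2 0) (\<lambda>_. 1) = 2 * Psi" .
  have Phi_eq: "lsum UNIV (texp 1 1) (\<lambda>_. 1) = Phi"
    by (simp add: PP theta_def)
  have "2 * a ^ 6 = (4 * (2 * fps_XD Psi) + 2 * Psi) * Phi - 4 * (2 * Psi * fps_XD Phi)"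
    using euler_sixth_power unfolding Psi_eq Phi_eq by (simp add: defs XD_mult fps_XD_def mult_ac)
  also have "\<dots> = 2 * (Psi * Phi * (1 - 8 * A + 24 * B - 16 * C))"
    unfolding XD_Psi XD_Phi by (simp add: algebra_simps)
  finally have six: "a ^ 6 = Psi * Phi * (1 - 8 * A + 24 * B - 16 * C)"
    by simp
  have "(b ^ 5 * c ^ 2) * (1 - 8 * A + 24 * B - 16 * C) = (Phi * (a ^ 2 * c ^ 2)) * (Psi * b) * (1 - 8 * A + 24 * B - 16 * C)"
    unfolding Psi Phi ..
  also have "\<dots> = a ^ 6 * (a ^ 2 * c ^ 2 * b)"
    unfolding six by (simp only: mult_ac)
  also have "\<dots> = (a ^ 2) ^ 4 * (c ^ 2 * b)"
    by (simp flip: power_mult power_add add: mult_ac)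
  also have "\<dots> = (b ^ 5 * c ^ 2) * theta (- 1) 1 1 ^ 4"
    unfolding phi[symmetric] power_mult_distrib by (simp add: eval_nat_numeral mult_ac)
  finally show ?thesis
    using nz by (simp add: ABC)
qed

section \<open>The generating function of \<open>spt_C5\<close>\<close>

text \<open>Up to the factor \<open>1 / (1 - q^n)^2\<close>, \<open>spt_base n\<close> is the \<open>n\<close>-th term of the defining series, multiplied by the product
  of all \<open>1 - q^(2m)\<close>. Inserting \<open>spt_corr N n\<close>, which tends to 1 as \<open>N\<close> grows, makes the sum over \<open>n\<close> finite and
  telescoping in \<open>N\<close>.\<close>

definition spt_base :: "nat \<Rightarrow> complex fps" where
  "spt_base n = (\<Prod>i<n. fps_X ^ Suc i * (1 - fps_X ^ Suc i) * inverse (1 - fps_X ^ (2 * i + 1)))"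

definition spt_corr :: "nat \<Rightarrow> nat \<Rightarrow> complex fps" where
  "spt_corr N n = (\<Prod>i<n. (1 - fps_X ^ (2 * (N - i))) * inverse (1 - fps_X ^ (2 * N - i)))"

lemma one_minus_X_nonzero: "n > 0 \<Longrightarrow> 1 - fps_X ^ n \<noteq> (0 :: complex fps)"
proof
  assume n: "n > 0" and eq: "1 - fps_X ^ n = (0 :: complex fps)"
  have "fps_nth (1 - fps_X ^ n :: complex fps) 0 = 1"
    using n by simp
  then show False
    unfolding eq by simp
qed

lemma one_minus_X_inverse: "n > 0 \<Longrightarrow> inverse (1 - fps_X ^ n) * (1 - fps_X ^ n) = (1 :: complex fps)"
  by (rule inverse_mult_eq_1) simp

lemma spt_base_Suc: "spt_base (Suc n) * (1 - fps_X ^ (2 * n + 1)) = spt_base n * (fps_X ^ Suc n * (1 - fps_X ^ Suc n))"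
  using one_minus_X_inverse[of "2 * n + 1"] by (simp add: spt_base_def mult.assoc del: power_Suc)

lemma spt_corr_Suc:
  assumes "n \<le> N" "N \<ge> 1"
  shows "spt_corr N (Suc n) * (1 - fps_X ^ (2 * N - n)) = spt_corr N n * (1 - fps_X ^ (2 * (N - n)))"
  using one_minus_X_inverse[of "2 * N - n"] assms by (simp add: spt_corr_def mult.assoc del: power_Suc)

abbreviation (input) spt_fin :: "nat \<Rightarrow> nat \<Rightarrow> complex fps" where
  "spt_fin N n \<equiv> spt_base n * spt_corr N n"

lemma spt_fin_Suc:
  assumes "n \<le> N" "N \<ge> 1"
  shows "spt_fin N (Suc n) * (1 - fps_X ^ (2 * n + 1)) * (1 - fps_X ^ (2 * N - n))
    = spt_fin N n * (fps_X ^ Suc n * (1 - fps_X ^ Suc n)) * (1 - fps_X ^ (2 * (N - n)))"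
proof -
  have "spt_fin N (Suc n) * (1 - fps_X ^ (2 * n + 1)) * (1 - fps_X ^ (2 * N - n))
    = (spt_base (Suc n) * (1 - fps_X ^ (2 * n + 1))) * (spt_corr N (Suc n) * (1 - fps_X ^ (2 * N - n)))"
    by (simp only: mult_ac)
  then show ?thesis
    unfolding spt_base_Suc spt_corr_Suc[OF assms] by (simp only: mult_ac)
qed

lemma spt_fin_shift_step:
  fixes c c' c1 c1' :: "'a::idom"
  assumes "c' * A * B = c * P * Q" "c1' * D * Q = c' * M * A" "c1 * D * S = c * M * T" "D \<noteq> 0" "Q \<noteq> 0"
  shows "c1' * T * B = c1 * S * P"
proof -
  have "(c1' * T * B) * (D * Q) = (c1' * D * Q) * (T * B)"
    by (simp only: mult_ac)
  also have "\<dots> = (c' * A * B) * (M * T)"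
    unfolding assms(2) by (simp only: mult_ac)
  also have "\<dots> = (c1 * D * S) * (P * Q)"
    unfolding assms(1,3) by (simp only: mult_ac)
  also have "\<dots> = (c1 * S * P) * (D * Q)"
    by (simp only: mult_ac)
  finally show ?thesis
    using assms(4,5) by simp
qed

lemma spt_fin_shift:
  assumes "n \<le> N" "N \<ge> 1"
  shows "spt_fin (Suc N) n * (1 - fps_X ^ (2 * (Suc N - n))) * (1 - fps_X ^ (2 * N + 1))
    = spt_fin N n * (1 - fps_X ^ (2 * N + 1 - n)) * (1 - fps_X ^ (2 * Suc N - n))"
  using assms(1)
proof (induction n)
  case 0
  show ?case by (simp add: spt_base_def spt_corr_def mult.commute)
next
  case (Suc n)
  have le: "n \<le> N" "n \<le> Suc N"
    using Suc.prems by simp_all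
  have idx: "2 * (Suc N - Suc n) = 2 * (N - n)" "2 * N + 1 - Suc n = 2 * N - n" "2 * Suc N - Suc n = 2 * N + 1 - n"
    by simp_all
  show ?case
    unfolding idx
    by (rule spt_fin_shift_step[OF Suc.IH[OF le(1)] spt_fin_Suc[OF le(2)] spt_fin_Suc[OF le(1) assms(2)]])
      ((rule one_minus_X_nonzero)?, use le in simp)+
qed

text \<open>Here x = q^n and s = q^(2(N-n)), while c, c1 and c1' stand for \<open>spt_fin\<close> at
  (N, n), (N, n + 1) and (N + 1, n + 1). Expressing c1 and c1' by c reduces the claim to the
  polynomial identities \<open>id1\<close> and \<open>id2\<close>.\<close>

lemma spt_fin_telescope_step:
  fixes c c1 c1' x s q :: "'a::idom"
  assumes c1': "c1' * (1 - q * x\<^sup>2) * (1 - q * x\<^sup>2 * s) = c * (q * x * (1 - q * x)) * (1 - q * x * s)"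
    and c1: "c1 * (1 - q * x\<^sup>2) * (1 - x * s) = c * (q * x * (1 - q * x)) * (1 - s)"
    and nz: "1 - q * x\<^sup>2 \<noteq> 0" "1 - x * s \<noteq> 0"
  shows "(c1' - c1) * (1 - q * x\<^sup>2 * s)\<^sup>2 = (1 - q * x)\<^sup>2 * (c * (q * x * s) - c1 * (x * s))"
proof -
  define B D S T P M where "B = 1 - q * x\<^sup>2 * s" "D = 1 - q * x\<^sup>2" "S = 1 - x * s" "T = 1 - s" "P = 1 - q * x * s"
    "M = q * x * (1 - q * x)"
  note defs = this
  have id1: "P * S - T * B = s * (1 - x) * (1 - q * x)" and id2: "D * S - x * (1 - q * x) * T = (1 - x) * B"
    by (simp_all add: defs algebra_simps power2_eq_square)
  have "(c1' - c1) * B\<^sup>2 * (D * S) = (c1' * D * B) * (S * B) - (c1 * D * S) * B\<^sup>2"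
    by (simp add: algebra_simps power2_eq_square)
  also have "\<dots> = c * M * B * (P * S - T * B)"
    unfolding c1'[folded defs] c1[folded defs] by (simp add: algebra_simps power2_eq_square)
  also have "\<dots> = (1 - q * x)\<^sup>2 * (c * (q * x * s)) * ((1 - x) * B)"
    unfolding id1 by (simp add: defs(6) power2_eq_square mult_ac)
  also have "\<dots> = (1 - q * x)\<^sup>2 * (c * (q * x * s) * (D * S) - (c * M * T) * (x * s))"
    unfolding id2[symmetric] by (simp add: defs(6) algebra_simps)
  also have "\<dots> = (1 - q * x)\<^sup>2 * (c * (q * x * s) - c1 * (x * s)) * (D * S)"
    unfolding c1[folded defs, symmetric] by (simp add: algebra_simps)
  finally show ?thesis
    using nz[folded defs] by (simp add: defs)
qed

lemma spt_fin_telescope: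
  assumes "n \<le> N" "N \<ge> 1"
  shows "(spt_fin (Suc N) (Suc n) - spt_fin N (Suc n)) * (1 - fps_X ^ (2 * N + 1)) ^ 2
    = (1 - fps_X ^ Suc n) ^ 2 * (spt_fin N n * fps_X ^ (2 * N + 1 - n) - spt_fin N (Suc n) * fps_X ^ (2 * N - n))"
proof -
  obtain r where N: "N = n + r"
    using assms(1) by (metis le_Suc_ex)
  let ?M = "fps_X ^ Suc n * (1 - fps_X ^ Suc n) :: complex fps"
  have Q: "1 - fps_X ^ (2 * Suc N - n) \<noteq> (0 :: complex fps)"
    using assms by (intro one_minus_X_nonzero) simp
  have "spt_fin (Suc N) (Suc n) * (1 - fps_X ^ (2 * n + 1)) * (1 - fps_X ^ (2 * N + 1)) * (1 - fps_X ^ (2 * Suc N - n))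
      = (spt_fin (Suc N) (Suc n) * (1 - fps_X ^ (2 * n + 1)) * (1 - fps_X ^ (2 * Suc N - n))) * (1 - fps_X ^ (2 * N + 1))"
    by (simp only: mult_ac)
  also have "\<dots> = (spt_fin (Suc N) n * (1 - fps_X ^ (2 * (Suc N - n))) * (1 - fps_X ^ (2 * N + 1))) * ?M"
    using assms by (subst spt_fin_Suc) (simp_all only: mult_ac le_SucI)
  also have "\<dots> = spt_fin N n * ?M * (1 - fps_X ^ (2 * N + 1 - n)) * (1 - fps_X ^ (2 * Suc N - n))"
    unfolding spt_fin_shift[OF assms] by (simp only: mult_ac)
  finally have 1: "spt_fin (Suc N) (Suc n) * (1 - fps_X ^ (2 * n + 1)) * (1 - fps_X ^ (2 * N + 1))
      = spt_fin N n * ?M * (1 - fps_X ^ (2 * N + 1 - n))"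
    using Q by simp
  define x s where "x = (fps_X :: complex fps) ^ n" "s = (fps_X :: complex fps) ^ (2 * r)"
  have pow: "fps_X ^ Suc n = fps_X * x" "fps_X ^ (2 * n + 1) = fps_X * x\<^sup>2" "fps_X ^ (2 * N + 1) = fps_X * x\<^sup>2 * s"
    "fps_X ^ (2 * N + 1 - n) = fps_X * x * s" "fps_X ^ (2 * N - n) = x * s" "fps_X ^ (2 * (N - n)) = s"
  proof -
    have idx: "2 * N + 1 - n = 1 + n + 2 * r" "2 * N - n = n + 2 * r" "2 * N + 1 = 1 + n * 2 + 2 * r"
      "2 * n + 1 = 1 + n * 2" "Suc n = 1 + n" "2 * (N - n) = 2 * r"
      by (simp_all add: N)
    show "fps_X ^ Suc n = fps_X * x" "fps_X ^ (2 * n + 1) = fps_X * x\<^sup>2" "fps_X ^ (2 * N + 1) = fps_X * x\<^sup>2 * s"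
      "fps_X ^ (2 * N + 1 - n) = fps_X * x * s" "fps_X ^ (2 * N - n) = x * s" "fps_X ^ (2 * (N - n)) = s"
      unfolding idx(1,2,6) unfolding idx(3,4,5) x_s_def power_add power_one_right power_mult[of _ n] by (rule refl)+
  qed
  have nz: "1 - fps_X * x\<^sup>2 \<noteq> 0" "1 - x * s \<noteq> 0"
    unfolding pow(2,5)[symmetric] using assms by (intro one_minus_X_nonzero; simp)+
  show ?thesis
    using spt_fin_telescope_step[OF 1[unfolded pow] spt_fin_Suc[OF assms, unfolded pow] nz] unfolding pow .
qed

lemma spt_corr_eq_0: "spt_corr N (Suc N) = 0"
  by (simp add: spt_corr_def)

text \<open>When N grows by one, the increments on the left telescope in n. The upper end vanishes
  because \<open>spt_corr N (Suc N)\<close> is 0, which also lets both sums run over the same range,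
  and the lower end is q^(2N+1) / (1 - q^(2N+1))^2, the new term on the right.\<close>

lemma spt_finite_identity:
  assumes "N \<ge> 1"
  shows "(\<Sum>n<N. inverse ((1 - fps_X ^ Suc n) ^ 2) * spt_fin N (Suc n))
    = (\<Sum>i<N. fps_X ^ (2 * i + 1) * inverse ((1 - fps_X ^ (2 * i + 1)) ^ 2))"
  using assms
proof (induction N rule: dec_induct)
  case base
  have "spt_base 1 = fps_X"
    using spt_base_Suc[of 0] one_minus_X_nonzero[of 1] by (simp add: spt_base_def)
  moreover have "spt_corr 1 1 = 1"
    using one_minus_X_inverse[of 2] by (simp add: spt_corr_def mult.commute)
  ultimately show ?case
    by (simp add: mult.commute)
next
  case (step N)
  define I where "I = (\<lambda>n. inverse ((1 - fps_X ^ Suc n) ^ 2) :: complex fps)"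
  define g where "g = (\<lambda>n. spt_fin N n * fps_X ^ (2 * N + 1 - n))"
  let ?B = "(1 - fps_X ^ (2 * N + 1)) ^ 2 :: complex fps"
  have I: "I n * (1 - fps_X ^ Suc n) ^ 2 = 1" for n
    unfolding I_def by (rule inverse_mult_eq_1) simp
  have B: "inverse ?B * ?B = 1"
    by (rule inverse_mult_eq_1) simp
  have diff: "I n * (spt_fin (Suc N) (Suc n) - spt_fin N (Suc n)) * ?B = g n - g (Suc n)" if "n \<le> N" for n
  proof -
    have idx: "2 * N + 1 - Suc n = 2 * N - n"
      by simp
    have "I n * (spt_fin (Suc N) (Suc n) - spt_fin N (Suc n)) * ?B = (I n * (1 - fps_X ^ Suc n) ^ 2) * (g n - g (Suc n))"
      unfolding g_def idx mult.assoc spt_fin_telescope[OF that step.hyps(1), unfolded mult.assoc] ..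
    then show ?thesis
      unfolding I by simp
  qed
  have "((\<Sum>n<Suc N. I n * spt_fin (Suc N) (Suc n)) - (\<Sum>n<N. I n * spt_fin N (Suc n))) * ?B
      = (\<Sum>n<Suc N. I n * (spt_fin (Suc N) (Suc n) - spt_fin N (Suc n)) * ?B)"
    unfolding sum_distrib_right[symmetric] right_diff_distrib sum_subtractf by (simp add: spt_corr_eq_0)
  also have "\<dots> = (\<Sum>n<Suc N. g n - g (Suc n))"
    by (intro sum.cong refl diff) simp
  also have "\<dots> = fps_X ^ (2 * N + 1)"
    unfolding sum_lessThan_telescope' by (simp add: g_def spt_corr_eq_0) (simp add: spt_base_def spt_corr_def)
  finally have *: "((\<Sum>n<Suc N. I n * spt_fin (Suc N) (Suc n)) - (\<Sum>n<N. I n * spt_fin N (Suc n))) * ?B = fps_X ^ (2 * N + 1)" .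
  have "fps_X ^ (2 * N + 1) * inverse ?B = (\<Sum>n<Suc N. I n * spt_fin (Suc N) (Suc n)) - (\<Sum>n<N. I n * spt_fin N (Suc n))"
    by (rule fps_mult_inverse_eqI) (simp, simp only: * mult.commute[of ?B])
  then show ?case
    using step.IH unfolding I_def by (simp add: algebra_simps del: power_Suc)
qed


section \<open>Comparison with the defining series and passage to the limit\<close>

lemma square_mult_power: "q ^ 2 * (q ^ 2) ^ n = (q :: 'a::monoid_mult) ^ (2 * n + 2)"
  by (simp only: power_mult[symmetric] power_add[symmetric] add.commute)

lemma prod_odd_qfin:
  "(\<Prod>i<n. 1 - fps_X ^ (2 * i + 1)) * qfin (fps_X ^ 2) (fps_X ^ 2) n = qfin fps_X fps_X (2 * n)"
proof (induction n)
  case (Suc n)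
  have "qfin fps_X fps_X (2 * Suc n) = qfin fps_X fps_X (2 * n) * (1 - fps_X ^ (2 * n + 1)) * (1 - fps_X ^ (2 * n + 2))"
    by (simp only: mult_Suc_right add_2_eq_Suc add_2_eq_Suc' qfin_Suc power_Suc[symmetric] Suc_eq_plus1[symmetric])
  then show ?case
    unfolding Suc.IH[symmetric] by (simp only: qfin_Suc square_mult_power prod.lessThan_Suc mult_ac)
qed simp

lemma spt_base_eq:
  "spt_base n * qfin (fps_X ^ (n + 1)) fps_X n = fps_X ^ ((n ^ 2 + n) div 2) * qfin (fps_X ^ 2) (fps_X ^ 2) n"
proof -
  define O' where "O' = (\<Prod>i<n. 1 - fps_X ^ (2 * i + 1) :: complex fps)"
  have O': "O' \<noteq> 0"
    unfolding O'_def prod_zero_iff[OF finite_lessThan] using one_minus_X_nonzero[of "2 * _ + 1"] by auto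
  have base: "spt_base n * (\<Prod>i<n. 1 - fps_X ^ (2 * i + 1)) = fps_X ^ ((n ^ 2 + n) div 2) * qfin fps_X fps_X n" for n
  proof (induction n)
    case 0
    show ?case by (simp add: spt_base_def)
  next
    case (Suc n)
    have "(Suc n) ^ 2 + Suc n = (n ^ 2 + n) + Suc n * 2"
      by (simp add: power2_eq_square)
    then have e: "((Suc n) ^ 2 + Suc n) div 2 = (n ^ 2 + n) div 2 + Suc n"
      by simp
    have "spt_base (Suc n) * (\<Prod>i<Suc n. 1 - fps_X ^ (2 * i + 1))
        = (spt_base (Suc n) * (1 - fps_X ^ (2 * n + 1))) * (\<Prod>i<n. 1 - fps_X ^ (2 * i + 1))"
      unfolding prod.lessThan_Suc by (simp only: mult_ac)
    also have "\<dots> = (spt_base n * (\<Prod>i<n. 1 - fps_X ^ (2 * i + 1))) * (fps_X ^ Suc n * (1 - fps_X ^ Suc n))"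
      unfolding spt_base_Suc by (simp only: mult_ac)
    also have "\<dots> = fps_X ^ (((Suc n) ^ 2 + Suc n) div 2) * qfin fps_X fps_X (Suc n)"
      unfolding Suc.IH e qfin_Suc power_add[of _ "(n ^ 2 + n) div 2"] power_Suc[symmetric] by (simp only: mult_ac)
    finally show ?case .
  qed
  have "qfin fps_X fps_X (2 * n) = qfin fps_X fps_X n * qfin (fps_X ^ (n + 1)) fps_X n"
    using qfin_add[of fps_X fps_X n n] by (simp add: mult_2)
  then have "(spt_base n * O') * qfin (fps_X ^ (n + 1)) fps_X n = fps_X ^ ((n ^ 2 + n) div 2) * (O' * qfin (fps_X ^ 2) (fps_X ^ 2) n)"
    unfolding O'_def base prod_odd_qfin by (simp only: mult_ac)
  then have "O' * (spt_base n * qfin (fps_X ^ (n + 1)) fps_X n) = O' * (fps_X ^ ((n ^ 2 + n) div 2) * qfin (fps_X ^ 2) (fps_X ^ 2) n)"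
    by (simp only: mult_ac)
  then show ?thesis
    using O' by simp
qed

lemma spt_C5_term_mult:
  assumes "n \<ge> 1"
  shows "spt_C5_term n fps_X * qX 2 2 = inverse ((1 - fps_X ^ n) ^ 2) * spt_base n"
proof -
  define F where "F = qfin (fps_X ^ (n + 1)) fps_X n"
  define G where "G = qX (2 * n + 2) 2"
  have "qpoch_inf (fps_X ^ (n + 1)) fps_X = F * qpoch_inf (fps_X ^ (n + 1) * fps_X ^ n) fps_X"
    unfolding F_def by (rule qpoch_inf_shift) simp_all
  moreover have "fps_nth (qpoch_inf (fps_X ^ (n + 1) * fps_X ^ n) fps_X) 0 = (1 :: complex)"
    by (rule qpoch_inf_nth_0) simp_all
  ultimately have F: "qpoch (fps_X ^ (n + 1)) fps_X n = F"
    unfolding qpoch_def by (simp add: fps_divide_unit inverse_mult_eq_1' mult.assoc del: power_Suc)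
  have "qX 2 2 = qfin (fps_X ^ 2) (fps_X ^ 2) n * qpoch_inf (fps_X ^ 2 * (fps_X ^ 2) ^ n) (fps_X ^ 2)"
    by (rule qpoch_inf_shift) simp_all
  also have "fps_X ^ 2 * (fps_X ^ 2) ^ n = (fps_X :: complex fps) ^ (2 * n + 2)"
    by (rule square_mult_power)
  finally have Q: "qX 2 2 = qfin (fps_X ^ 2) (fps_X ^ 2) n * G"
    by (simp only: G_def)
  define D where "D = (1 - fps_X ^ n) ^ 2 * F * G"
  have D0: "fps_nth D 0 \<noteq> 0"
    using assms by (simp add: D_def F_def G_def qfin_nth_0)
  have inv: "(1 - fps_X ^ n) ^ 2 * inverse ((1 - fps_X ^ n) ^ 2) = (1 :: complex fps)"
    by (rule inverse_mult_eq_1') (use assms in simp)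
  have "D * (inverse ((1 - fps_X ^ n) ^ 2) * spt_base n)
      = ((1 - fps_X ^ n) ^ 2 * inverse ((1 - fps_X ^ n) ^ 2)) * (spt_base n * F) * G"
    unfolding D_def by (simp only: mult_ac)
  also have "\<dots> = fps_X ^ ((n ^ 2 + n) div 2) * qX 2 2"
    unfolding inv F_def spt_base_eq Q by (simp only: mult_1 mult.assoc)
  finally have "fps_X ^ ((n ^ 2 + n) div 2) * qX 2 2 * inverse D = inverse ((1 - fps_X ^ n) ^ 2) * spt_base n"
    by (rule fps_mult_inverse_eqI[OF D0])
  moreover have "spt_C5_term n fps_X = fps_X ^ ((n ^ 2 + n) div 2) * inverse D"
    unfolding spt_C5_term_def F D_def[unfolded G_def, symmetric] using D0 by (rule fps_divide_unit)
  ultimately show ?thesis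
    by (simp only: mult_ac)
qed

lemma spt_base_nth_0:
  assumes "k \<le> n"
  shows "fps_nth (f * spt_base (Suc n)) k = 0"
proof -
  have eq: "f * spt_base (Suc n) = fps_X ^ Suc n * (f * spt_base n * (1 - fps_X ^ Suc n) * inverse (1 - fps_X ^ (2 * n + 1)))"
    unfolding spt_base_def prod.lessThan_Suc by (simp only: mult_ac)
  show ?thesis
    unfolding eq using assms by (simp add: fps_X_power_mult_nth del: power_Suc)
qed

lemma spt_corr_cong_1:
  assumes "n \<le> k" "2 * k < N"
  shows "fps_X ^ k dvd spt_corr N n - 1"
  using assms(1)
proof (induction n)
  case 0
  show ?case by (simp add: spt_corr_def)
next
  case (Suc n)
  define I where "I = (inverse (1 - fps_X ^ (2 * N - n)) :: complex fps)"
  have I: "I * (1 - fps_X ^ (2 * N - n)) = 1"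
    unfolding I_def by (rule one_minus_X_inverse) (use assms Suc.prems in simp)
  have "fps_X ^ k dvd (fps_X ^ (2 * N - n) :: complex fps)" "fps_X ^ k dvd (fps_X ^ (2 * (N - n)) :: complex fps)"
    using assms Suc.prems by (intro le_imp_power_dvd; simp)+
  then have "fps_X ^ k dvd I * (fps_X ^ (2 * N - n) - fps_X ^ (2 * (N - n)))"
    by (intro dvd_mult dvd_diff)
  also have "I * (fps_X ^ (2 * N - n) - fps_X ^ (2 * (N - n)))
      = (1 - fps_X ^ (2 * (N - n))) * I - I * (1 - fps_X ^ (2 * N - n))"
    by (simp add: algebra_simps)
  finally have "fps_X ^ k dvd (1 - fps_X ^ (2 * (N - n))) * I - 1"
    unfolding I .
  then have "fps_X ^ k dvd spt_corr N n * ((1 - fps_X ^ (2 * (N - n))) * I - 1) + (spt_corr N n - 1)"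
    using Suc by (intro dvd_add dvd_mult) simp_all
  also have "\<dots> = spt_corr N (Suc n) - 1"
    by (simp add: spt_corr_def I_def algebra_simps)
  finally show ?case .
qed

text \<open>If n is at least k, the base is divisible by q^(k+1); otherwise the correction is 1
  modulo q^(k+1). One bound on N therefore serves all n at once.\<close>

lemma spt_corr_nth:
  assumes "2 * k + 2 < N"
  shows "fps_nth (f * spt_fin N (Suc n)) k = fps_nth (f * spt_base (Suc n)) k"
proof (cases "k \<le> n")
  case True
  then show ?thesis
    using spt_base_nth_0[of k n f] spt_base_nth_0[of k n "f * spt_corr N (Suc n)"] by (simp only: mult_ac)
next
  case False
  then have "fps_X ^ Suc k dvd spt_corr N (Suc n) - 1"
    using assms by (intro spt_corr_cong_1) simp_all
  then obtain g where "spt_corr N (Suc n) - 1 = fps_X ^ Suc k * g"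
    by (elim dvdE)
  then have g: "spt_corr N (Suc n) = 1 + fps_X ^ Suc k * g"
    by (simp add: algebra_simps)
  have "f * spt_fin N (Suc n) = f * spt_base (Suc n) + fps_X ^ Suc k * (f * spt_base (Suc n) * g)"
    unfolding g by (simp add: algebra_simps)
  then show ?thesis
    by (simp add: fps_X_power_mult_nth del: power_Suc)
qed

theorem spt_C5_series_mult_nth:
  "fps_nth (spt_C5_series fps_X * qX 2 2) k = (\<Sum>d | odd d \<and> d dvd k. of_nat (k div d))"
proof -
  define T where "T = (\<lambda>n. inverse ((1 - fps_X ^ Suc n) ^ 2) * spt_base (Suc n))"
  have "(\<lambda>n. spt_C5_term (Suc n) fps_X) sums spt_C5_series (fps_X :: complex fps)"
    unfolding spt_C5_series_def by (rule summable_sums[OF spt_C5_series_fps(1)])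
  then have "(\<lambda>N. (\<Sum>n<N. spt_C5_term (Suc n) fps_X) * qX 2 2) \<longlonglongrightarrow> spt_C5_series fps_X * qX 2 2"
    unfolding sums_def by (intro tendsto_fps_mult tendsto_const)
  then have "(\<lambda>N. \<Sum>n<N. T n) \<longlonglongrightarrow> spt_C5_series fps_X * qX 2 2"
    by (simp add: sum_distrib_right spt_C5_term_mult T_def del: power_Suc)
  then have "\<forall>\<^sub>F N in sequentially. fps_nth (\<Sum>n<N. T n) k = fps_nth (spt_C5_series fps_X * qX 2 2) k"
    by (simp add: tendsto_fps_iff)
  then obtain N where N: "N \<ge> 2 * k + 3" "fps_nth (\<Sum>n<N. T n) k = fps_nth (spt_C5_series fps_X * qX 2 2) k"
    unfolding eventually_sequentially by (metis nat_le_linear)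
  have "fps_nth (\<Sum>n<N. T n) k = fps_nth (\<Sum>n<N. inverse ((1 - fps_X ^ Suc n) ^ 2) * spt_fin N (Suc n)) k"
    unfolding fps_sum_nth T_def using N(1) by (intro sum.cong refl spt_corr_nth[symmetric]) simp
  also have "\<dots> = (\<Sum>i<N. if 2 * i + 1 dvd k then of_nat (k div (2 * i + 1)) else 0)"
    using N(1) by (subst spt_finite_identity) (simp_all only: fps_sum_nth fps_nth_X_power_geometric2)
  also have "\<dots> = (\<Sum>d | odd d \<and> d dvd k. of_nat (k div d))"
  proof (cases "k = 0")
    case False
    have "(\<Sum>i<N. if 2 * i + 1 dvd k then of_nat (k div (2 * i + 1)) else 0)
        = (\<Sum>i | i \<in> {..<N} \<and> 2 * i + 1 dvd k. of_nat (k div (2 * i + 1)) :: complex)"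
      by (rule sum.inter_filter[symmetric]) simp
    also have "\<dots> = (\<Sum>d | odd d \<and> d dvd k. of_nat (k div d))"
    proof (rule sum.reindex_bij_witness[where i = "\<lambda>d. d div 2" and j = "\<lambda>i. 2 * i + 1"])
      fix d assume d: "d \<in> {d. odd d \<and> d dvd k}"
      then have "d \<le> k"
        using False by (auto dest: dvd_imp_le)
      then show "d div 2 \<in> {i. i \<in> {..<N} \<and> 2 * i + 1 dvd k}"
        using d N(1) by auto
    qed auto
    finally show ?thesis .
  qed (simp add: sum.neutral)
  finally show ?thesis
    using N(2) by simp
qed

section \<open>The congruences\<close>

lemma sum_divisors_split:
  fixes f :: "nat \<Rightarrow> complex"
  assumes "k > 0"
  shows "(\<Sum>d | d dvd k. f d) = (\<Sum>d | odd d \<and> d dvd k. f d) + (\<Sum>d | 2 * d dvd k. f (2 * d))"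
proof -
  have fin: "finite {d. d dvd k}"
    using assms by simp
  have eq: "{d. d dvd k} = {d. odd d \<and> d dvd k} \<union> (*) 2 ` {d. 2 * d dvd k}"
    by (auto simp: image_iff elim!: evenE)
  have "(\<Sum>d | d dvd k. f d) = (\<Sum>d | odd d \<and> d dvd k. f d) + sum f ((*) 2 ` {d. 2 * d dvd k})"
    unfolding eq using fin[unfolded eq] by (intro sum.union_disjoint) auto
  then show ?thesis
    by (simp add: sum.reindex inj_on_def)
qed

lemma sum_divisors_cofactor:
  fixes f :: "nat \<Rightarrow> complex"
  assumes "k > 0"
  shows "(\<Sum>d | d dvd k. f (k div d)) = (\<Sum>d | d dvd k. f d)"
  by (rule sum.reindex_bij_witness[where i = "\<lambda>d. k div d" and j = "\<lambda>d. k div d"]) (use assms in auto)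

text \<open>For k > 0 both sides are 24 times the sum of the odd divisors of k: the coefficient of
  the fourth power is 24 times that sum for even k and -8 times it for odd k, whence the factor -3.
  For k = 2 M this follows from \<open>P 1 = o1 + 2 * P 2\<close>, \<open>P 2 = o1 + 2 * P 4\<close>
  and \<open>s = P 1 - P 2\<close>.\<close>

lemma spt_coefficients:
  "fps_nth (24 * (spt_C5_series fps_X * qX 2 2) - 24 * divisor_series 2 + 1) k
    = (if even k then 1 else - 3) * fps_nth (theta (- 1) 1 1 ^ 4) k"
proof -
  define s where "s = (\<Sum>d | odd d \<and> d dvd k. of_nat (k div d) :: complex)"
  define P where "P = (\<lambda>m. \<Sum>d | m * d dvd k. of_nat d :: complex)"
  have L: "fps_nth (24 * (spt_C5_series fps_X * qX 2 2) - 24 * divisor_series 2 + 1) k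
      = 24 * s - 24 * P 2 + (if k = 0 then 1 else 0)"
    by (simp add: fps_nth_numeral_mult spt_C5_series_mult_nth s_def P_def divisor_series_def)
  have R: "fps_nth (theta (- 1) 1 1 ^ 4) k = (if k = 0 then 1 else 0) - 8 * P 1 + 48 * P 2 - 64 * P 4"
    unfolding phi_fourth_power by (simp add: fps_nth_numeral_mult P_def divisor_series_def)
  consider "k = 0" | "odd k" | M where "k = 2 * M" "M > 0"
    by (cases "k = 0") (auto elim!: evenE)
  then show ?thesis
  proof cases
    case 1
    then show ?thesis
      unfolding L R by (simp add: s_def P_def)
  next
    case 2
    then have k: "k > 0"
      by (rule odd_pos)
    have odd: "odd d" if "d dvd k" for d
      using 2 that dvd_trans by blast
    have "{d. odd d \<and> d dvd k} = {d. d dvd k}"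
      using odd by auto
    then have "s = P 1"
      unfolding s_def P_def using sum_divisors_cofactor[OF k, of of_nat] by simp
    moreover have "{d. 2 * d dvd k} = {}" "{d. 4 * d dvd k} = {}"
      using odd by fastforce+
    then have "P 2 = 0" "P 4 = 0"
      unfolding P_def by (simp_all only: sum.empty)
    ultimately show ?thesis
      unfolding L R using 2 k by simp
  next
    case 3
    have k: "k > 0"
      using 3 by simp
    define o1 where "o1 = (\<Sum>d | odd d \<and> d dvd M. of_nat d :: complex)"
    have P2: "P 2 = (\<Sum>d | d dvd M. of_nat d)"
      by (simp add: P_def 3)
    have dvd4: "4 * d dvd 2 * M \<longleftrightarrow> 2 * d dvd M" for d
      using nat_mult_dvd_cancel_disj[of 2 "2 * d" M] by simp
    have P4: "P 4 = (\<Sum>d | 2 * d dvd M. of_nat d)"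
      by (simp add: P_def 3 dvd4)
    have odd_dvd: "odd d \<and> d dvd k \<longleftrightarrow> odd d \<and> d dvd M" for d
      unfolding 3 using coprime_dvd_mult_right_iff[of d 2 M] by auto
    have 1: "P 1 = o1 + 2 * P 2"
      using sum_divisors_split[OF k, of of_nat] unfolding odd_dvd
      by (simp add: P_def o1_def sum_distrib_left)
    have 2: "P 2 = o1 + 2 * P 4"
      using sum_divisors_split[OF 3(2), of of_nat] unfolding P2 P4 by (simp add: o1_def sum_distrib_left)
    have "P 1 = s + (\<Sum>d | d dvd M. of_nat (M div d))"
      using sum_divisors_split[OF k, of "\<lambda>d. of_nat (k div d)"] unfolding sum_divisors_cofactor[OF k]
      by (simp add: P_def s_def) (simp add: 3)
    then have s: "s = P 1 - P 2"
      unfolding sum_divisors_cofactor[OF 3(2)] P2[symmetric] by simp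
    show ?thesis
      unfolding L R s 1 2 using k 3 by (simp add: algebra_simps)
  qed
qed

text \<open>The product is a series in q^2. In the Cauchy product of \<open>spt_C5_eq\<close> only
  even N - i remain, so the parity factor of \<open>spt_coefficients\<close> can be taken at N
  instead of i.\<close>

lemma inverse_qX_odd_nth:
  assumes "odd n"
  shows "fps_nth (inverse (qX 2 2)) n = 0"
proof -
  have qfin: "qfin (fps_X ^ 2) (fps_X ^ 2) n = qfin fps_X fps_X n oo fps_X ^ 2" for n
    unfolding qfin_def fps_compose_prod_distrib[of "fps_X ^ 2", simplified]
    by (intro prod.cong refl) (simp add: fps_compose_sub_distrib fps_compose_mult_distrib flip: fps_compose_power)
  have "qX 2 2 = qpoch_inf fps_X fps_X oo fps_X ^ 2"
  proof (intro fps_ext)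
    fix n
    have "fps_nth (qpoch_inf fps_X fps_X) (n div 2) = fps_nth (qfin fps_X fps_X n) (n div 2)"
      by (rule qpoch_inf_nth) simp_all
    moreover have "fps_nth (qX 2 2) n = fps_nth (qfin (fps_X ^ 2) (fps_X ^ 2) n) n"
      by (rule qpoch_inf_nth) simp_all
    ultimately show "fps_nth (qX 2 2) n = fps_nth (qpoch_inf fps_X fps_X oo fps_X ^ 2) n"
      by (simp add: qfin fps_nth_compose_X_power)
  qed
  then have "inverse (qX 2 2) = inverse (qpoch_inf fps_X fps_X) oo fps_X ^ 2"
    by (simp add: fps_inverse_compose)
  then show ?thesis
    using assms by (simp add: fps_nth_compose_X_power)
qed

text \<open>The divisor series is absorbed by a derivative: q d/dq multiplies 1 / (q^2; q^2) by 2
  \<open>divisor_series 2\<close>, and the coefficients of that derivative produce 12 N.\<close>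

lemma spt_C5_eq:
  "24 * of_int (spt_C5 N) = (if even N then 1 else - 3) * fps_nth (theta (- 1) 1 1 ^ 4 * inverse (qX 2 2)) N
    + (12 * of_nat N - 1) * fps_nth (inverse (qX 2 2)) N"
proof -
  define b where "b = qX 2 2"
  define ib where "ib = inverse b"
  define H where "H = 24 * (spt_C5_series fps_X * b) - 24 * divisor_series 2 + 1"
  have ib: "ib * b = 1"
    unfolding ib_def b_def by (rule inverse_mult_eq_1) simp
  have XD: "fps_XD ib = (0 - - (2 * divisor_series 2)) * ib"
  proof (rule log_XD_cancel)
    show "fps_XD (ib * b) = 0 * (ib * b)"
      unfolding ib by (simp add: fps_XD_def)
    show "fps_XD b = - (2 * divisor_series 2) * b"
      using XD_qX[of 2] by (simp add: b_def)
    show "b \<noteq> 0"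
      by (simp add: b_def)
  qed
  have "24 * spt_C5_series fps_X = 24 * spt_C5_series fps_X * (ib * b)"
    unfolding ib by simp
  also have "\<dots> = H * ib + 12 * fps_XD ib - ib"
    unfolding H_def XD by (simp add: algebra_simps)
  finally have eq: "24 * spt_C5_series fps_X = H * ib + 12 * fps_XD ib - ib" .
  have "fps_nth H i * fps_nth ib (N - i) = (if even N then 1 else - 3) * (fps_nth (theta (- 1) 1 1 ^ 4) i * fps_nth ib (N - i))"
    if "i \<le> N" for i
  proof (cases "even (N - i)")
    case True
    then have "even N \<longleftrightarrow> even i"
      using that by auto
    then show ?thesis
      unfolding H_def b_def spt_coefficients by simp
  next
    case False
    then show ?thesis
      unfolding ib_def b_def by (simp add: inverse_qX_odd_nth)
  qed
  then have "fps_nth (H * ib) N = (if even N then 1 else - 3) * fps_nth (theta (- 1) 1 1 ^ 4 * ib) N"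
    unfolding fps_mult_nth sum_distrib_left by (intro sum.cong refl) simp
  moreover have "fps_nth (24 * spt_C5_series fps_X) N = fps_nth (H * ib) N + 12 * (of_nat N * fps_nth ib N) - fps_nth ib N"
    unfolding eq by (simp add: fps_nth_numeral_mult)
  ultimately show ?thesis
    unfolding fps_nth_numeral_mult of_int_spt_C5 ib_def b_def by (simp add: left_diff_distrib)
qed

lemma KK_nth: "fls_nth KK (int N) = fps_nth (theta (- 1) 1 1 ^ 4 * inverse (qX 2 2)) N"
proof -
  have KK: "KK = F2L (theta (- 1) 1 1 ^ 4 * inverse (qX 2 2))"
    unfolding KK_def phi_def P2_def F2L_simps(4)[symmetric] by (rule F2L_divide) simp
  show ?thesis
    unfolding KK F2L_def by simp
qed

lemma spt_C5_dvd:
  assumes N: "12 * int N = 5 ^ j * w + 1" and K: "fls_nth KK (int N) = of_int (5 ^ j * z)"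
  shows "5 ^ j dvd spt_C5 N"
proof -
  have "fps_nth (inverse (qX 2 2)) N \<in> \<int>"
    using int_unit_fps_inverse[OF int_unit_qX[of 2 2]] by (simp add: int_unit_fps_def)
  then obtain r where r: "fps_nth (inverse (qX 2 2)) N = of_int r"
    by (elim Ints_cases)
  define c :: int where "c = (if even N then 1 else - 3)"
  have "12 * of_nat N - 1 = (of_int (5 ^ j * w) :: complex)"
    using arg_cong[OF N, of "of_int :: int \<Rightarrow> complex"] by simp
  then have "of_int (24 * spt_C5 N) = (of_int (c * (5 ^ j * z) + 5 ^ j * w * r) :: complex)"
    using spt_C5_eq[of N] K unfolding r KK_nth by (simp add: c_def)
  then have "24 * spt_C5 N = 5 ^ j * (c * z + w * r)"
    unfolding of_int_eq_iff by (simp add: algebra_simps)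
  then have "5 ^ j dvd 24 * spt_C5 N"
    by simp
  moreover have "coprime (5 ^ j) (24 :: int)"
  proof -
    have "coprime (5 :: int) 24"
    proof (rule coprimeI)
      fix c :: int
      assume "c dvd 5" "c dvd 24"
      then have "c dvd 5 * 5 - 24"
        by (intro dvd_diff dvd_mult)
      then show "is_unit c"
        by simp
    qed
    then show ?thesis
      by simp
  qed
  ultimately show ?thesis
    by (simp add: coprime_dvd_mult_right_iff)
qed

lemma twelve_times_int:
  assumes "12 * m = a * p + (1 :: nat)"
  shows "12 * int (p * n + m) = int p * (12 * int n + int a) + 1"
proof -
  have "12 * int m = int a * int p + 1"
    using arg_cong[OF assms, of int] by simp
  then show ?thesis
    by (simp add: algebra_simps)
qed

theorem theorem1p2:
  fixes k n :: nat
  assumes "k \<ge> 1"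
  shows "[spt_C5 (5 ^ (2 * k - 1) * n + (7 * 5 ^ (2 * k - 1) + 1) div 12) = 0]
           (mod 5 ^ (2 * k - 1)) \<and>
         [spt_C5 (5 ^ (2 * k) * n + (11 * 5 ^ (2 * k) + 1) div 12) = 0] (mod 5 ^ (2 * k))"
proof (intro conjI; unfold cong_0_iff)
  obtain l where l: "2 * k - 1 = 2 * l + 1" "2 * k = 2 * l + 2"
    using assms by (cases k) auto
  show "5 ^ (2 * k - 1) dvd spt_C5 (5 ^ (2 * k - 1) * n + (7 * 5 ^ (2 * k - 1) + 1) div 12)" (is "_ dvd spt_C5 ?N")
  proof -
    have "12 * ((7 * 5 ^ (2 * k - 1) + 1) div 12) = 7 * 5 ^ (2 * k - 1) + (1 :: nat)"
      by (rule dvd_mult_div_cancel[OF twelve_dvd_odd[OF assms]])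
    from twelve_times_int[OF this, of n] have N: "12 * int ?N = 5 ^ (2 * k - 1) * (12 * int n + 7) + 1"
      by (simp only: of_nat_power of_nat_numeral)
    \<comment> \<open>Since 12 - 7 = 5, the number c = 5^(2l+1) (n + 1) - N meets the hypothesis of
      \<open>KK_nth_odd\<close>; in the other progression 12 - 11 = 1 leads to the same value of 12
      c.\<close>
    then have "12 * (5 ^ (2 * l + 1) * (int n + 1) - int ?N) = 5 ^ (2 * l + 2) - 1"
      unfolding l by (simp add: algebra_simps)
    from KK_nth_odd[OF this, of "int n + 1"] obtain z where "fls_nth KK (int ?N) = of_int (5 ^ (2 * k - 1) * z)"
      unfolding l by auto
    with N show ?thesis
      by (rule spt_C5_dvd)
  qed
  show "5 ^ (2 * k) dvd spt_C5 (5 ^ (2 * k) * n + (11 * 5 ^ (2 * k) + 1) div 12)" (is "_ dvd spt_C5 ?N")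
  proof -
    have "12 * ((11 * 5 ^ (2 * k) + 1) div 12) = 11 * 5 ^ (2 * k) + (1 :: nat)"
      by (rule dvd_mult_div_cancel[OF twelve_dvd_even])
    from twelve_times_int[OF this, of n] have N: "12 * int ?N = 5 ^ (2 * k) * (12 * int n + 11) + 1"
      by (simp only: of_nat_power of_nat_numeral)
    then have "12 * (5 ^ (2 * l + 2) * (int n + 1) - int ?N) = 5 ^ (2 * l + 2) - 1"
      unfolding l by (simp add: algebra_simps)
    from KK_nth_even[OF this, of "int n + 1"] obtain z where "fls_nth KK (int ?N) = of_int (5 ^ (2 * k) * z)"
      unfolding l by auto
    with N show ?thesis
      by (rule spt_C5_dvd)
  qed
qed

end
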